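(* Suppose the real input variables $\{x_{a,b}: 1\le a\le b\}$ satisfy (A1) or (A2) or (A3). Let $\widetilde{W}_n = S_n\odot W_n$ be the $n\times n$ skew-symmetric Wigner matrix, where $W_n=((x_{\min\{i,j\},\max\{i,j\}}))_{1\le i,j\le n}$. Then, almost surely, the empirical spectral distributions $F^{n^{-1/2}\widetilde{W}_n}$ converge weakly, as $n\to\infty$, to the semi-circular law (the probability distribution on $\mathbb{R}$ with density $\frac{1}{2\pi}\sqrt{4-x^2}$ on $[-2,2]$).
   Context: Assumptions on the real input random variables: (A1) they are independent and uniformly bounded with mean $0$ and variance $1$; (A2) they are i.i.d. with mean $0$ and variance $1$; (A3) they are independent with mean $0$ and variance $1$, and with uniformly bounded moments of all orders. $S_n=((s_{ij}))_{1\le i,j\le n}$ is the skew-symmetric sign matrix with $s_{ij}=1$ if $i<j$, $s_{ii}=0$, $s_{ij}=-1$ if $i>j$. The symbol $\odot$ denotes the entrywise (Schur–Hadamard) product. For a real skew-symmetric $n\times n$ matrix $A$ with (purely imaginary) eigenvalues $\lambda_1,\dots,\lambda_n$, the empirical spectral distribution is the distribution function on $\mathbb{R}$ given by $F^A(x)=\frac1n\#\{j: \mathrm{i}\lambda_j\le x\}$, where $\mathrm{i}=\sqrt{-1}$. Almost sure weak convergence of $F^{A_n}$ to a non-random distribution function $F$ means that outside a null set $F^{A_n}(x)\to F(x)$ at all continuity points $x$ of $F$; then $F$ is called the limiting spectral distribution (LSD). *)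

theory Defs
  imports "HOL-Probability.Probability" "Jordan_Normal_Form.Char_Poly"
begin

section \<open>Input variables\<close>

text \<open>The input family is \<open>x a b\<close> for \<open>1 \<le> a \<le> b\<close>; values of \<open>x\<close> at other index pairs
  are never constrained and never used.\<close>

definition input_index :: "(nat \<times> nat) set" where
  "input_index = {(a, b). 1 \<le> a \<and> a \<le> b}"

context prob_space
begin

definition indep_input :: "(nat \<Rightarrow> nat \<Rightarrow> 'a \<Rightarrow> real) \<Rightarrow> bool" where
  "indep_input x \<longleftrightarrow> indep_vars (\<lambda>_. borel) (\<lambda>(a, b). x a b) input_index"

text \<open>Integrability is stated explicitly because the Bochner integral of a
  non-integrable function is 0.\<close>

definition standardized_input :: "(nat \<Rightarrow> nat \<Rightarrow> 'a \<Rightarrow> real) \<Rightarrow> bool" where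
  "standardized_input x \<longleftrightarrow>
     (\<forall>(a, b) \<in> input_index.
        integrable M (x a b) \<and> integrable M (\<lambda>\<omega>. (x a b \<omega>)\<^sup>2) \<and>
        expectation (x a b) = 0 \<and> variance (x a b) = 1)"

definition assumption_A1 :: "(nat \<Rightarrow> nat \<Rightarrow> 'a \<Rightarrow> real) \<Rightarrow> bool" where
  "assumption_A1 x \<longleftrightarrow>
     indep_input x \<and> standardized_input x \<and>
     (\<exists>C. \<forall>(a, b) \<in> input_index. AE \<omega> in M. \<bar>x a b \<omega>\<bar> \<le> C)"

definition assumption_A2 :: "(nat \<Rightarrow> nat \<Rightarrow> 'a \<Rightarrow> real) \<Rightarrow> bool" where
  "assumption_A2 x \<longleftrightarrow>
     indep_input x \<and> standardized_input x \<and>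
     (\<forall>(a, b) \<in> input_index. \<forall>(c, d) \<in> input_index.
        distr M borel (x a b) = distr M borel (x c d))"

definition assumption_A3 :: "(nat \<Rightarrow> nat \<Rightarrow> 'a \<Rightarrow> real) \<Rightarrow> bool" where
  "assumption_A3 x \<longleftrightarrow>
     indep_input x \<and> standardized_input x \<and>
     (\<forall>k::nat. \<exists>C. \<forall>(a, b) \<in> input_index.
        integrable M (\<lambda>\<omega>. \<bar>x a b \<omega>\<bar> ^ k) \<and> expectation (\<lambda>\<omega>. \<bar>x a b \<omega>\<bar> ^ k) \<le> C)"

end

section \<open>Matrices\<close>

definition hadamard :: "'a::times mat \<Rightarrow> 'a mat \<Rightarrow> 'a mat" (infixl "\<odot>" 70) where
  "A \<odot> B = Matrix.mat (dim_row A) (dim_col A) (\<lambda>ij. A $$ ij * B $$ ij)"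

definition sign_mat :: "nat \<Rightarrow> real mat" where
  "sign_mat n = Matrix.mat n n (\<lambda>(i, j). if i < j then 1 else if i = j then 0 else - 1)"

text \<open>Matrix entries are indexed from 0, the input variables from 1.\<close>

definition wigner_mat :: "(nat \<Rightarrow> nat \<Rightarrow> real) \<Rightarrow> nat \<Rightarrow> real mat" where
  "wigner_mat x n =
     Matrix.mat n n (\<lambda>(i, j). x (min (Suc i) (Suc j)) (max (Suc i) (Suc j)))"

definition skew_wigner_mat :: "(nat \<Rightarrow> nat \<Rightarrow> real) \<Rightarrow> nat \<Rightarrow> real mat" where
  "skew_wigner_mat x n = sign_mat n \<odot> wigner_mat x n"

section \<open>Empirical spectral distribution and the semi-circular law\<close>

text \<open>Complex eigenvalues of a real square matrix, with algebraic multiplicity.\<close>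

definition complex_eigenvalues :: "real mat \<Rightarrow> complex multiset" where
  "complex_eigenvalues A = proots (char_poly (map_mat complex_of_real A))"

text \<open>For skew-symmetric \<open>A\<close> the eigenvalues \<open>\<mu>\<close> are purely imaginary, so \<open>\<i> * \<mu>\<close> is
  real; \<open>Re\<close> only transfers that real number to the type \<open>real\<close>.\<close>

definition skew_esd :: "real mat \<Rightarrow> real \<Rightarrow> real" where
  "skew_esd A t =
     real (size {#\<mu> \<in># complex_eigenvalues A. Re (\<i> * \<mu>) \<le> t#}) / real (dim_row A)"

definition semicircle_law :: "real measure" where
  "semicircle_law =
     density lborel (\<lambda>t. ennreal (1 / (2 * pi) * sqrt (4 - t\<^sup>2) * indicator {-2..2} t))"

end

theory Submission
  imports Defs "Jordan_Normal_Form.Schur_Decomposition"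
begin

text \<open>
  Multiplying the skew-symmetric matrix by \<open>\<i>\<close> gives a Hermitian matrix \<open>H\<close>; let \<open>G = (H - z)\<^sup>-\<^sup>1\<close> and let
  \<open>m\<close> be the normalized trace of \<open>G\<close>. Expanding \<open>G\<close> to second order in a single pair of entries \<open>H\<^sub>i\<^sub>j, H\<^sub>j\<^sub>i\<close>
  and averaging over that entry alone turns the identity \<open>H G = 1 + z G\<close> into \<open>1 + z E m + E m\<^sup>2 = o(1)\<close>.
  The entries of \<open>G\<close> are bounded by \<open>1 / Im z\<close>, so the error is governed by
  \<open>E (x\<^sup>2 min(1, \<bar>x\<bar> / sqrt n))\<close>, which tends to 0 uniformly over the inputs under each of (A1), (A2), (A3); no
  truncation is needed. Replacing one row and column of \<open>H\<close> is a perturbation of rank two, which moves \<open>m\<close> by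
  \<open>O(1 / n)\<close>; bounded differences over the \<open>n\<close> independent rows then give \<open>E \<bar>m - E m\<bar>\<^sup>4 = O(1 / n\<^sup>2)\<close> without
  any moment assumption, hence almost sure concentration. So \<open>1 + z m + m\<^sup>2 \<rightarrow> 0\<close> almost surely for countably
  many \<open>z\<close>, therefore on whole horizontal lines, and \<open>m\<close> converges to the root with positive imaginary part.
  Poisson smoothing of Lipschitz test functions turns this into convergence of distribution functions: the
  boundary values of the imaginary part of that root are \<open>\<pi>\<close> times the semicircle density.
\<close>

section \<open>The Stieltjes transform of the semicircle law\<close>

text \<open>The entry being varied is \<open>h = \<i> * t\<close>, with \<open>- h\<close> opposite
  it. Because \<open>h\<close> squared is negative, the products \<open>G i i * G j j\<close> enter
  with the same sign as for real symmetric matrices; skew symmetry only flips the sign of the terms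
  \<open>(G j i)\<^sup>2\<close>, whose total is of lower order. Hence the same equation and the
  same limit. Concentration over rows rather than over single inputs is forced: one input moves m by
  O(1 / n), but there are of order n^2 inputs, so the squared differences would not sum to something
  small. Grouped by the larger index there are only n blocks, and the rank argument shows that a
  whole block still moves m by only O(1 / n). The fourth moment is taken because a variance of order
  1 / n is not summable; it also closes the gap between E m^2 and (E m)^2. Countably many z matter
  because Poisson smoothing integrates over an entire horizontal line, so the exceptional null set
  must not depend on z.\<close>

lemma quadratic_root_upper_half_plane:
  fixes z :: complex
  assumes "Im z > 0"
  shows "\<exists>r. r\<^sup>2 + z * r + 1 = 0 \<and> Im r > 0"
proof -
  define w where "w = csqrt (z\<^sup>2 - 4)"
  have w2: "w\<^sup>2 = z\<^sup>2 - 4" unfolding w_def by simp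
  define r q where "r = (- z + w) / 2" and "q = (- z - w) / 2"
  have "4 * (r\<^sup>2 + z * r + 1) = w\<^sup>2 - (z\<^sup>2 - 4)" "4 * (q\<^sup>2 + z * q + 1) = w\<^sup>2 - (z\<^sup>2 - 4)"
    unfolding r_def q_def by (simp_all add: power2_eq_square field_simps)
  then have r: "r\<^sup>2 + z * r + 1 = 0" and q: "q\<^sup>2 + z * q + 1 = 0"
    unfolding w2 by (simp_all only: diff_self mult_eq_0_iff) simp_all
  have sum: "r + q = - z" unfolding r_def q_def by (simp add: field_simps)
  have "4 * (r * q) = z\<^sup>2 - w\<^sup>2" unfolding r_def q_def
    by (simp add: power2_eq_square field_simps)
  then have prod: "r * q = 1" using w2 by simp
  \<comment> \<open>Inversion reverses the sign of the imaginary part. Two roots with product 1 and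
    no positive imaginary part are therefore both real, which contradicts their sum
    \<open>- z\<close>.\<close>
  have "Im r > 0 \<or> Im q > 0"
  proof (rule ccontr)
    assume "\<not> ?thesis"
    then have neg: "Im r \<le> 0" "Im q \<le> 0" by auto
    have "r \<noteq> 0" using prod by auto
    then have "q = inverse r" using prod by (simp add: field_simps)
    then have "Im q = - Im r / ((Re r)\<^sup>2 + (Im r)\<^sup>2)" by (simp add: complex_inverse)
    moreover have "(Re r)\<^sup>2 + (Im r)\<^sup>2 > 0"
      using \<open>r \<noteq> 0\<close> by (simp add: complex_neq_0)
    ultimately have "Im r = 0" "Im q = 0" using neg by (auto simp: field_simps zero_le_divide_iff)
    then have "Im (r + q) = 0" by simp
    then show False using assms unfolding sum by simp
  qed
  then show ?thesis using r q by blast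
qed

text \<open>Convention 1 / (t - z), under which the transform maps the upper half plane to itself.
  The sign of the imaginary part selects the root, so no branch of the square root has to be
  followed.\<close>

definition semicircle_stieltjes :: "complex \<Rightarrow> complex" where
  "semicircle_stieltjes z = (SOME r. r\<^sup>2 + z * r + 1 = 0 \<and> Im r > 0)"

lemma
  assumes "Im z > 0"
  shows semicircle_stieltjes_eq: "(semicircle_stieltjes z)\<^sup>2 + z * semicircle_stieltjes z + 1 = 0"
    and Im_semicircle_stieltjes_pos: "Im (semicircle_stieltjes z) > 0"
  using someI_ex[OF quadratic_root_upper_half_plane[OF assms]]
  unfolding semicircle_stieltjes_def by blast+

text \<open>The other root q equals 1 / r, so Im q = - Im r / |r|^2, and also - z - r, so Im q < -
  Im r; together these force |r| < 1. Unlike the bound 1 / Im z, this one survives as z approaches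
  the real axis and serves there as a dominating function.\<close>

lemma norm_semicircle_stieltjes_le_1:
  assumes "Im z > 0"
  shows "norm (semicircle_stieltjes z) \<le> 1"
proof -
  define r where "r = semicircle_stieltjes z"
  define q where "q = - z - r"
  have pos: "Im r > 0" unfolding r_def by (rule Im_semicircle_stieltjes_pos[OF assms])
  have "r * q = 1"
  proof -
    have "r * q = 1 - (r\<^sup>2 + z * r + 1)" unfolding q_def by (simp add: power2_eq_square algebra_simps)
    then show ?thesis using semicircle_stieltjes_eq[OF assms] unfolding r_def by simp
  qed
  then have "r \<noteq> 0" and "q = inverse r" by (auto simp: inverse_unique)
  then have Imq: "Im q = - Im r / (norm r)\<^sup>2" by (simp add: complex_inverse cmod_power2)
  have "Im q < - Im r" using assms unfolding q_def by simp
  then have "Im r < Im r / (norm r)\<^sup>2" using Imq by simp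
  moreover have "(norm r)\<^sup>2 > 0" using \<open>r \<noteq> 0\<close> by simp
  ultimately have "Im r * (norm r)\<^sup>2 < Im r" by (simp add: pos_less_divide_eq)
  then have "(norm r)\<^sup>2 < 1" using pos by simp
  then show ?thesis unfolding r_def by (simp add: abs_square_less_1 less_imp_le)
qed

text \<open>The second root of the quadratic equation has imaginary part below \<open>- Im z\<close>, so it stays away
  from the upper half plane.\<close>

lemma semicircle_stieltjes_stability:
  assumes "Im z > 0" "Im m \<ge> 0"
  shows "norm (m - semicircle_stieltjes z) * Im z \<le> norm (1 + z * m + m\<^sup>2)"
proof -
  define r where "r = semicircle_stieltjes z"
  have eq: "r\<^sup>2 + z * r + 1 = 0" unfolding r_def by (rule semicircle_stieltjes_eq[OF assms(1)])
  have pos: "Im r > 0" unfolding r_def by (rule Im_semicircle_stieltjes_pos[OF assms(1)])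
  have "1 + z * m + m\<^sup>2 = (m - r) * (m + z + r) + (r\<^sup>2 + z * r + 1)" by (simp add: algebra_simps power2_eq_square)
  then have "1 + z * m + m\<^sup>2 = (m - r) * (m + z + r)" using eq by simp
  moreover have "Im z \<le> norm (m + z + r)"
    using abs_Im_le_cmod[of "m + z + r"] pos assms by simp
  ultimately show ?thesis
    unfolding r_def[symmetric] by (simp add: norm_mult mult_left_mono)
qed

definition semicircle_density :: "real \<Rightarrow> real" where
  "semicircle_density t = 1 / (2 * pi) * sqrt (4 - t\<^sup>2) * indicator {-2..2} t"

text \<open>At height y the root r almost solves the equation with real coefficient x: the defect is
  y |r|, at most y. Factor that real quadratic. For |x| < 2 its roots are conjugate and r stays at
  distance at least d from the lower one, so it is within y / d of the upper one. For |x| \<ge> 2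
  both roots are real and each is at distance at least Im r, so (Im r)^2 is at most y.\<close>

lemma Im_semicircle_stieltjes_boundary:
  assumes y: "\<And>k. y k > 0" and "y \<longlonglongrightarrow> 0"
  shows "(\<lambda>k. Im (semicircle_stieltjes (Complex x (y k))) / pi) \<longlonglongrightarrow> semicircle_density x"
proof -
  define r where "r k = semicircle_stieltjes (Complex x (y k))" for k
  have eq: "(r k)\<^sup>2 + Complex x (y k) * r k + 1 = 0" and pos: "Im (r k) > 0"
    and le1: "norm (r k) \<le> 1" for k
    unfolding r_def by (intro semicircle_stieltjes_eq Im_semicircle_stieltjes_pos
        norm_semicircle_stieltjes_le_1; simp add: y)+
  have c: "Complex x (y k) = of_real x + \<i> * of_real (y k)" for k by (simp add: complex_eq_iff)
  have Q: "norm ((r k)\<^sup>2 + of_real x * r k + 1) \<le> y k" for k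
  proof -
    have "(r k)\<^sup>2 + of_real x * r k + 1 = - (\<i> * of_real (y k) * r k)"
    proof -
      have "(r k)\<^sup>2 + of_real x * r k + 1
        = ((r k)\<^sup>2 + Complex x (y k) * r k + 1) - (\<i> * of_real (y k) * r k)"
        unfolding c by (simp add: algebra_simps)
      then show ?thesis unfolding eq by simp
    qed
    then have "norm ((r k)\<^sup>2 + of_real x * r k + 1) = y k * norm (r k)"
      using y[of k] by (simp add: norm_mult)
    then show ?thesis using le1[of k] y[of k] by (simp add: mult_left_le)
  qed
  have "(\<lambda>k. Im (r k)) \<longlonglongrightarrow> pi * semicircle_density x"
  proof (cases "\<bar>x\<bar> < 2")
    case True
    define d where "d = sqrt (4 - x\<^sup>2) / 2"
    have x4: "x\<^sup>2 < 4" using True abs_square_less_1[of "x / 2"] by (simp add: power_divide)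
    have d: "d > 0" unfolding d_def using x4 by simp
    have d2: "4 * d\<^sup>2 = 4 - x\<^sup>2" unfolding d_def using x4 by (simp add: power_divide)
    define s where "s = Complex (- x / 2) d"
    have fac: "(r k)\<^sup>2 + of_real x * r k + 1 = (r k - s) * (r k - cnj s)" for k
      unfolding s_def using d2
      by (auto simp: complex_eq_iff power2_eq_square algebra_simps)
    have bnd: "norm (Im (r k) - d) \<le> y k / d" for k
    proof -
      have "d \<le> norm (r k - cnj s)"
        using abs_Im_le_cmod[of "r k - cnj s"] pos[of k] d unfolding s_def by simp
      then have "norm (r k - s) * d \<le> norm (r k - s) * norm (r k - cnj s)"
        by (rule mult_left_mono) simp
      also have "\<dots> \<le> y k" using Q[of k] unfolding fac norm_mult .
      finally have "norm (r k - s) \<le> y k / d" using d by (simp add: field_simps)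
      moreover have "\<bar>Im (r k) - d\<bar> \<le> norm (r k - s)"
        using abs_Im_le_cmod[of "r k - s"] by (simp add: s_def)
      ultimately show ?thesis by simp
    qed
    have "(\<lambda>k. y k / d) \<longlonglongrightarrow> 0" using tendsto_divide[OF assms(2) tendsto_const, of d] d by simp
    then have "(\<lambda>k. Im (r k) - d) \<longlonglongrightarrow> 0" by (rule Lim_null_comparison[rotated]) (use bnd in simp)
    then have "(\<lambda>k. Im (r k)) \<longlonglongrightarrow> d" by (simp add: LIM_zero_iff)
    moreover have "pi * semicircle_density x = d"
      using True unfolding semicircle_density_def d_def by (auto simp: indicator_def)
    ultimately show ?thesis by simp
  next
    case False
    define e where "e = sqrt (x\<^sup>2 - 4) / 2"
    have x4: "x\<^sup>2 \<ge> 4" using False abs_square_less_1[of "x / 2"] by (simp add: power_divide)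
    then have e2: "4 * e\<^sup>2 = x\<^sup>2 - 4" unfolding e_def by (simp add: power_divide)
    have fac: "(r k)\<^sup>2 + of_real x * r k + 1 = (r k - of_real (- x / 2 + e)) * (r k - of_real (- x / 2 - e))" for k
      using e2 by (auto simp: complex_eq_iff power2_eq_square algebra_simps)
    have bnd: "norm (Im (r k)) \<le> sqrt (y k)" for k
    proof -
      have "Im (r k) \<le> norm (r k - of_real (- x / 2 + e))" "Im (r k) \<le> norm (r k - of_real (- x / 2 - e))"
        using abs_Im_le_cmod[of "r k - of_real (- x / 2 + e)"]
          abs_Im_le_cmod[of "r k - of_real (- x / 2 - e)"] by auto
      then have "Im (r k) * Im (r k) \<le> norm (r k - of_real (- x / 2 + e)) * norm (r k - of_real (- x / 2 - e))"
        using pos[of k] by (intro mult_mono) auto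
      also have "\<dots> \<le> y k" using Q[of k] unfolding fac norm_mult .
      finally show ?thesis using pos[of k] by (simp add: real_le_rsqrt power2_eq_square)
    qed
    have "(\<lambda>k. sqrt (y k)) \<longlonglongrightarrow> 0" using tendsto_real_sqrt[OF assms(2)] by simp
    then have "(\<lambda>k. Im (r k)) \<longlonglongrightarrow> 0" by (rule Lim_null_comparison[rotated]) (use bnd in simp)
    \<comment> \<open>At the two edges the indicator is 1 and it is the square root that
      vanishes.\<close>
    moreover have "semicircle_density x = 0"
    proof (cases "x = 2 \<or> x = -2")
      case True then show ?thesis unfolding semicircle_density_def by auto
    next
      case False2: False
      then have "x \<notin> {-2..2}" using False by auto
      then show ?thesis unfolding semicircle_density_def by simp
    qed
    ultimately show ?thesis by simp
  qed
  from tendsto_divide[OF this tendsto_const, of pi]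
  show ?thesis unfolding r_def by simp
qed

section \<open>The semicircle law as a probability measure\<close>

lemma semicircle_density_nonneg: "semicircle_density t \<ge> 0"
proof (cases "t \<in> {-2..2}")
  case True
  then have "t\<^sup>2 \<le> 2\<^sup>2" by (intro abs_le_square_iff[THEN iffD1]) auto
  then show ?thesis unfolding semicircle_density_def by simp
qed (simp add: semicircle_density_def)

lemma semicircle_density_measurable [measurable]: "semicircle_density \<in> borel_measurable borel"
  unfolding semicircle_density_def by measurable

lemma semicircle_law_density: "semicircle_law = density lborel (\<lambda>t. ennreal (semicircle_density t))"
  unfolding semicircle_law_def semicircle_density_def by simp

lemma nn_integral_semicircle_density: "(\<integral>\<^sup>+t. ennreal (semicircle_density t) \<partial>lborel) = 1"
proof -
  define F where "F t = (t / 2 * sqrt (4 - t\<^sup>2) + 2 * arcsin (t / 2)) / (2 * pi)" for t :: real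
  have der: "(F has_vector_derivative sqrt (4 - t\<^sup>2) / (2 * pi)) (at t)" if "t \<in> {-2<..<2}" for t
  proof -
    have t4: "t\<^sup>2 < 4" using that abs_square_less_1[of "t / 2"] by (auto simp: power_divide)
    define s where "s = sqrt (4 - t\<^sup>2)"
    have s: "s > 0" and s2: "s * s = 4 - t * t" unfolding s_def using t4
      by (auto simp: power2_eq_square)
    have s': "sqrt (1 - (t / 2)\<^sup>2) = s / 2"
    proof -
      have "1 - (t / 2)\<^sup>2 = (4 - t\<^sup>2) / 4" by (simp only: power_divide) simp
      then show ?thesis unfolding s_def by (simp only: real_sqrt_divide) simp
    qed
    have d1: "((\<lambda>t. sqrt (4 - t\<^sup>2)) has_real_derivative (inverse s / 2) * (- (2 * t))) (at t)"
      unfolding s_def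
      by (rule derivative_eq_intros refl | use t4 in simp)+
    have d2: "((\<lambda>t. arcsin (t / 2)) has_real_derivative inverse (s / 2) * (1 / 2)) (at t)"
      unfolding s'[symmetric]
      by (rule derivative_eq_intros refl | use that in simp)+
    have d3: "((\<lambda>t. t / 2) has_real_derivative 1 / 2) (at t)"
      by (rule derivative_eq_intros refl | simp)+
    have e: "(1 / 2 * s + (inverse s / 2) * (- (2 * t)) * (t / 2)) + 2 * (inverse (s / 2) * (1 / 2)) = s"
    proof -
      have "t * t = 4 - s * s" using s2 by simp
      then have "(1 / 2 * s + (inverse s / 2) * (- (2 * t)) * (t / 2)) + 2 * (inverse (s / 2) * (1 / 2))
          = (s * s / 2 - (4 - s * s) / 2 + 2) / s"
        using s by (simp add: divide_simps) (simp add: algebra_simps)?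
      also have "\<dots> = (s * s) / s" by (simp add: field_simps)
      also have "\<dots> = s" using s by simp
      finally show ?thesis .
    qed
    have "(F has_real_derivative s / (2 * pi)) (at t)"
      using DERIV_cdivide[OF DERIV_add[OF DERIV_mult[OF d3 d1] DERIV_cmult[OF d2, of 2]], of "2 * pi"]
      unfolding F_def s_def[symmetric] e .
    then show ?thesis unfolding s_def by (simp add: has_real_derivative_iff_has_vector_derivative)
  qed
  \<comment> \<open>Neither \<open>sqrt (4 - t\<^sup>2)\<close> nor \<open>arcsin (t / 2)\<close> is
    differentiable at the endpoints, hence the version of the fundamental theorem that asks for
    derivatives only in the interior.\<close>
  have "((\<lambda>t. sqrt (4 - t\<^sup>2) / (2 * pi)) has_integral (F 2 - F (-2))) {-2..2}"
    by (rule fundamental_theorem_of_calculus_interior[OF _ _ der])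
      (auto simp: F_def intro!: continuous_intros)
  also have "F 2 - F (-2) = 1" unfolding F_def by (simp add: field_simps)
  finally have "((\<lambda>t. if t \<in> {-2..2} then sqrt (4 - t\<^sup>2) / (2 * pi) else 0) has_integral 1) UNIV"
    by (simp only: has_integral_restrict_UNIV)
  also have "(\<lambda>t. if t \<in> {-2..2} then sqrt (4 - t\<^sup>2) / (2 * pi) else 0) = semicircle_density"
    unfolding semicircle_density_def by (auto simp: fun_eq_iff indicator_def)
  finally have "(semicircle_density has_integral 1) UNIV" .
  from nn_integral_has_integral_lborel[OF _ semicircle_density_nonneg this]
  show ?thesis by simp
qed

lemma prob_space_semicircle_law: "prob_space semicircle_law"
  unfolding semicircle_law_density
  by (rule prob_spaceI) (simp add: emeasure_density nn_integral_semicircle_density)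

lemma sets_semicircle_law [simp, measurable_cong]: "sets semicircle_law = sets borel"
  and space_semicircle_law [simp]: "space semicircle_law = UNIV"
  unfolding semicircle_law_density by simp_all

lemma integral_semicircle_law:
  fixes f :: "real \<Rightarrow> real"
  assumes [measurable]: "f \<in> borel_measurable borel"
  shows "(\<integral>t. f t \<partial>semicircle_law) = (\<integral>t. f t * semicircle_density t \<partial>lborel)"
  unfolding semicircle_law_density
  by (subst integral_density) (auto simp: semicircle_density_nonneg mult.commute)

lemma semicircle_law_lessThan_minus_2: "emeasure semicircle_law {..<-2} = 0"
  unfolding semicircle_law_density by (subst emeasure_density) (auto simp: semicircle_density_def
      intro!: nn_integral_0_iff_AE[THEN iffD2] AE_I2 split: split_indicator)

lemma semicircle_law_greaterThan_2: "emeasure semicircle_law {2<..} = 0"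
  unfolding semicircle_law_density by (subst emeasure_density) (auto simp: semicircle_density_def
      intro!: nn_integral_0_iff_AE[THEN iffD2] AE_I2 split: split_indicator)

section \<open>From Stieltjes transforms to distribution functions\<close>

definition empirical_stieltjes :: "nat \<Rightarrow> (nat \<Rightarrow> real) \<Rightarrow> complex \<Rightarrow> complex" where
  "empirical_stieltjes n lam z = (\<Sum>j<n. 1 / (of_real (lam j) - z)) / of_nat n"

lemma Im_le_norm_diff_of_real: "Im z \<le> norm (of_real l - z)"
  using abs_Im_le_cmod[of "of_real l - z"] by simp

lemma Im_inverse_of_real_diff:
  "Im (1 / (of_real l - Complex x y)) = y / ((l - x)\<^sup>2 + y\<^sup>2)"
proof -
  have "of_real l - Complex x y = Complex (l - x) (- y)" by (simp add: complex_eq_iff)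
  then show ?thesis by (simp add: Im_divide)
qed

text \<open>Each summand is a Poisson kernel of mass pi centred at \<open>lam j\<close>: the
  imaginary part is pi times the density of the empirical measure convolved with a Cauchy law of
  scale \<open>y\<close>.\<close>

lemma Im_empirical_stieltjes:
  "Im (empirical_stieltjes n lam (Complex x y)) = (\<Sum>j<n. y / ((lam j - x)\<^sup>2 + y\<^sup>2)) / real n"
proof -
  have "Im (c / of_nat n) = Im c / real n" for c
    by (metis Im_divide_of_real of_real_of_nat_eq)
  then show ?thesis
    unfolding empirical_stieltjes_def by (simp only: Im_sum Im_inverse_of_real_diff)
qed

text \<open>Nonnegativity of \<open>B\<close> covers n = 0, where the average is 0 by the convention
  for division.\<close>

lemma norm_average_le:
  fixes f :: "nat \<Rightarrow> 'a::real_normed_field"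
  assumes "\<And>j. j < n \<Longrightarrow> norm (f j) \<le> B" "B \<ge> 0"
  shows "norm ((\<Sum>j<n. f j) / of_nat n) \<le> B"
proof (cases "n = 0")
  case False
  have "norm (\<Sum>j<n. f j) \<le> (\<Sum>j<n. B)" by (rule sum_norm_le) (use assms in auto)
  then show ?thesis using False by (simp add: norm_divide field_simps)
qed (use assms in simp)

lemma norm_empirical_stieltjes_le:
  assumes "Im z > 0"
  shows "norm (empirical_stieltjes n lam z) \<le> 1 / Im z"
  unfolding empirical_stieltjes_def
proof (rule norm_average_le)
  fix j
  show "norm (1 / (of_real (lam j) - z)) \<le> 1 / Im z"
    using Im_le_norm_diff_of_real[of z "lam j"] assms
    by (simp add: norm_divide frac_le)
qed (use assms in simp)

lemma Im_empirical_stieltjes_nonneg: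
  assumes "Im z > 0"
  shows "Im (empirical_stieltjes n lam z) \<ge> 0"
  using Im_empirical_stieltjes[of n lam "Re z" "Im z"] assms
  by (simp add: sum_nonneg)

lemma empirical_stieltjes_lipschitz:
  assumes "Im z > 0" "Im w > 0"
  shows "norm (empirical_stieltjes n lam z - empirical_stieltjes n lam w) \<le> norm (z - w) / (Im z * Im w)"
proof -
  have "empirical_stieltjes n lam z - empirical_stieltjes n lam w
     = (\<Sum>j<n. 1 / (of_real (lam j) - z) - 1 / (of_real (lam j) - w)) / of_nat n"
    unfolding empirical_stieltjes_def by (simp add: sum_subtractf diff_divide_distrib)
  also have "norm \<dots> \<le> norm (z - w) / (Im z * Im w)"
  proof (rule norm_average_le)
    fix j
    let ?a = "of_real (lam j) - z" and ?b = "of_real (lam j) - w"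
    have a: "Im z \<le> norm ?a" and b: "Im w \<le> norm ?b" by (rule Im_le_norm_diff_of_real)+
    then have "?a \<noteq> 0" "?b \<noteq> 0" using assms by auto
    then have "1 / ?a - 1 / ?b = (z - w) / (?a * ?b)" by (simp add: field_simps)
    then have "norm (1 / ?a - 1 / ?b) = norm (z - w) / (norm ?a * norm ?b)"
      by (simp add: norm_divide norm_mult)
    also have "\<dots> \<le> norm (z - w) / (Im z * Im w)"
      using assms a b by (intro divide_left_mono mult_mono) (auto intro!: mult_pos_pos)
    finally show "norm (1 / ?a - 1 / ?b) \<le> norm (z - w) / (Im z * Im w)" .
  qed (use assms in simp)
  finally show ?thesis .
qed

section \<open>Poisson smoothing of Lipschitz test functions\<close>

lemma cauchy_density:
  "integrable lborel (\<lambda>s::real. inverse (1 + s\<^sup>2))" "(\<integral>s. inverse (1 + (s::real)\<^sup>2) \<partial>lborel) = pi"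
  using integrable_inverse_1_plus_square LBINT_inverse_1_plus_square
  by (simp_all add: set_integrable_def interval_lebesgue_integral_def set_lebesgue_integral_def)

lemma poisson_substitution:
  fixes f :: "real \<Rightarrow> real"
  assumes "y > 0"
  shows "(\<integral>x. f x * (y / ((l - x)\<^sup>2 + y\<^sup>2)) \<partial>lborel) = (\<integral>s. f (l + y * s) * inverse (1 + s\<^sup>2) \<partial>lborel)"
proof -
  have "y / ((l - (l + y * s))\<^sup>2 + y\<^sup>2) = inverse y * inverse (1 + s\<^sup>2)" for s
  proof -
    have "(l - (l + y * s))\<^sup>2 + y\<^sup>2 = y * (y * (1 + s\<^sup>2))" by (simp add: power2_eq_square algebra_simps)
    then show ?thesis using assms by (simp add: divide_inverse)
  qed
  then have "(\<integral>x. f x * (y / ((l - x)\<^sup>2 + y\<^sup>2)) \<partial>lborel)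
     = y * (\<integral>s. inverse y * (f (l + y * s) * inverse (1 + s\<^sup>2)) \<partial>lborel)"
    using assms by (subst lborel_integral_real_affine[where c = y and t = l]) (simp_all add: mult_ac)
  then show ?thesis using assms by simp
qed

lemma poisson_integrable:
  fixes y l :: real
  assumes "y > 0"
  shows "integrable lborel (\<lambda>x. y / ((l - x)\<^sup>2 + y\<^sup>2))"
proof -
  have "integrable lborel (\<lambda>s. inverse (1 + ((- l / y) + (1 / y) * s)\<^sup>2))"
    using assms by (intro lborel_integrable_real_affine cauchy_density) auto
  then have "integrable lborel (\<lambda>s. (1 / y) * inverse (1 + ((- l / y) + (1 / y) * s)\<^sup>2))"
    by (rule integrable_mult_right)
  moreover have "(1 / y) * inverse (1 + ((- l / y) + (1 / y) * s)\<^sup>2) = y / ((l - s)\<^sup>2 + y\<^sup>2)" for s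
  proof -
    have "(- l / y) + (1 / y) * s = (s - l) / y" by (simp add: diff_divide_distrib)
    then have "1 + ((- l / y) + (1 / y) * s)\<^sup>2 = ((l - s)\<^sup>2 + y\<^sup>2) / y\<^sup>2"
      using assms by (simp add: power_divide add_divide_distrib power2_commute)
    then show ?thesis using assms by (simp only: inverse_divide) (simp add: power2_eq_square)
  qed
  ultimately show ?thesis by simp
qed

text \<open>Error of smoothing at scale \<open>y\<close> a function with Lipschitz constant
  \<open>L\<close> and oscillation at most 1, uniformly in the centre. The cut-off at 1 is
  essential, since |s| is not integrable against the Cauchy density.\<close>

definition smoothing_error :: "real \<Rightarrow> real \<Rightarrow> real" where
  "smoothing_error L y = (\<integral>s. min 1 (L * (y * \<bar>s\<bar>)) * inverse (1 + s\<^sup>2) \<partial>lborel)"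

lemma smoothing_error_tendsto_0:
  assumes "L \<ge> 0" "\<And>k. y k > 0" "y \<longlonglongrightarrow> 0"
  shows "(\<lambda>k. smoothing_error L (y k)) \<longlonglongrightarrow> 0"
proof -
  have "(\<lambda>k. smoothing_error L (y k)) \<longlonglongrightarrow> (\<integral>s. 0 \<partial>(lborel :: real measure))"
    unfolding smoothing_error_def
  proof (rule integral_dominated_convergence[where w = "\<lambda>s. inverse (1 + s\<^sup>2)"])
    show "AE s in lborel. (\<lambda>k. min 1 (L * (y k * \<bar>s\<bar>)) * inverse (1 + s\<^sup>2)) \<longlonglongrightarrow> 0"
    proof (rule AE_I2)
      fix s :: real
      have "(\<lambda>k. min 1 (L * (y k * \<bar>s\<bar>)) * inverse (1 + s\<^sup>2)) \<longlonglongrightarrow> min 1 (L * (0 * \<bar>s\<bar>)) * inverse (1 + s\<^sup>2)"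
        by (intro tendsto_intros assms)
      then show "(\<lambda>k. min 1 (L * (y k * \<bar>s\<bar>)) * inverse (1 + s\<^sup>2)) \<longlonglongrightarrow> 0" by simp
    qed
    show "AE s in lborel. norm (min 1 (L * (y k * \<bar>s\<bar>)) * inverse (1 + s\<^sup>2)) \<le> inverse (1 + s\<^sup>2)" for k
    proof (rule AE_I2)
      fix s :: real
      have "L * (y k * \<bar>s\<bar>) \<ge> 0" using assms less_imp_le by (intro mult_nonneg_nonneg) auto
      then have "\<bar>min 1 (L * (y k * \<bar>s\<bar>))\<bar> \<le> 1" by auto
      then show "norm (min 1 (L * (y k * \<bar>s\<bar>)) * inverse (1 + s\<^sup>2)) \<le> inverse (1 + s\<^sup>2)"
        by (simp add: abs_mult mult_left_le_one_le)
    qed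
  qed (use cauchy_density in auto)
  then show ?thesis by simp
qed

lemma poisson_smoothing:
  fixes f :: "real \<Rightarrow> real"
  assumes [measurable]: "f \<in> borel_measurable borel"
    and bnd: "\<And>x. \<bar>f x\<bar> \<le> 1" and lip: "\<And>x x'. \<bar>f x - f x'\<bar> \<le> min 1 (L * \<bar>x - x'\<bar>)"
    and "y > 0"
  shows "\<bar>(\<integral>x. f x * (y / ((l - x)\<^sup>2 + y\<^sup>2)) \<partial>lborel) - pi * f l\<bar> \<le> smoothing_error L y"
proof -
  have int: "integrable lborel (\<lambda>s. f (l + y * s) * inverse (1 + s\<^sup>2))"
    by (rule Bochner_Integration.integrable_bound[OF cauchy_density(1)])
      (auto simp: abs_mult bnd intro!: mult_left_le_one_le)
  have intc: "integrable lborel (\<lambda>s. f l * inverse (1 + s\<^sup>2))" using cauchy_density by simp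
  have "pi * f l = (\<integral>s. f l * inverse (1 + s\<^sup>2) \<partial>lborel)" using cauchy_density by simp
  then have "(\<integral>x. f x * (y / ((l - x)\<^sup>2 + y\<^sup>2)) \<partial>lborel) - pi * f l
      = (\<integral>s. f (l + y * s) * inverse (1 + s\<^sup>2) - f l * inverse (1 + s\<^sup>2) \<partial>lborel)"
    unfolding poisson_substitution[OF \<open>y > 0\<close>] by (simp only: Bochner_Integration.integral_diff[OF int intc])
  moreover have "norm (\<integral>s. f (l + y * s) * inverse (1 + s\<^sup>2) - f l * inverse (1 + s\<^sup>2) \<partial>lborel)
    \<le> (\<integral>s. min 1 (L * (y * \<bar>s\<bar>)) * inverse (1 + s\<^sup>2) \<partial>lborel)"
  proof (rule order_trans[OF integral_norm_bound integral_mono])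
    show "integrable lborel (\<lambda>s. norm (f (l + y * s) * inverse (1 + s\<^sup>2) - f l * inverse (1 + s\<^sup>2)))"
      by (intro integrable_norm Bochner_Integration.integrable_diff int intc)
    fix s
    have "\<bar>f (l + y * s) - f l\<bar> \<le> min 1 (L * (y * \<bar>s\<bar>))"
      using lip[of "l + y * s" l] \<open>y > 0\<close> by (simp add: abs_mult)
    then have "\<bar>f (l + y * s) - f l\<bar> * inverse (1 + s\<^sup>2) \<le> min 1 (L * (y * \<bar>s\<bar>)) * inverse (1 + s\<^sup>2)"
      by (rule mult_right_mono) simp
    then show "norm (f (l + y * s) * inverse (1 + s\<^sup>2) - f l * inverse (1 + s\<^sup>2))
        \<le> min 1 (L * (y * \<bar>s\<bar>)) * inverse (1 + s\<^sup>2)"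
      by (simp add: left_diff_distrib[symmetric] abs_mult)
  next
    \<comment> \<open>The sign of \<open>L\<close> is not given here; it is read off the Lipschitz
      hypothesis at two points at distance \<open>y * \<bar>s\<bar>\<close>.\<close>
    have "0 \<le> min 1 (L * (y * \<bar>s\<bar>))" for s
      using order_trans[OF abs_ge_zero lip[of "y * \<bar>s\<bar>" 0]] \<open>y > 0\<close> by (simp add: abs_mult)
    then have "norm (min 1 (L * (y * \<bar>s\<bar>)) * inverse (1 + s\<^sup>2)) \<le> norm (inverse (1 + s\<^sup>2))" for s
      by (simp add: abs_mult mult_left_le_one_le)
    then show "integrable lborel (\<lambda>s. min 1 (L * (y * \<bar>s\<bar>)) * inverse (1 + s\<^sup>2))"
      by (intro Bochner_Integration.integrable_bound[OF cauchy_density(1)]) auto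
  qed
  ultimately show ?thesis unfolding smoothing_error_def by simp
qed

lemma empirical_smoothing:
  fixes f :: "real \<Rightarrow> real"
  assumes [measurable]: "f \<in> borel_measurable borel"
    and bnd: "\<And>x. \<bar>f x\<bar> \<le> 1" and lip: "\<And>x x'. \<bar>f x - f x'\<bar> \<le> min 1 (L * \<bar>x - x'\<bar>)"
    and "y > 0" "n > 0"
  shows "\<bar>(\<integral>x. f x * Im (empirical_stieltjes n lam (Complex x y)) \<partial>lborel) - pi * ((\<Sum>j<n. f (lam j)) / n)\<bar>
    \<le> smoothing_error L y"
proof -
  let ?P = "\<lambda>j x. f x * (y / ((lam j - x)\<^sup>2 + y\<^sup>2))"
  have int: "integrable lborel (?P j)" for j
  proof (rule Bochner_Integration.integrable_bound[OF poisson_integrable[OF \<open>y > 0\<close>, of "lam j"]])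
    have "norm (?P j x) \<le> norm (y / ((lam j - x)\<^sup>2 + y\<^sup>2))" for x
      unfolding norm_mult by (rule mult_left_le_one_le) (use bnd in auto)
    then show "AE x in lborel. norm (?P j x) \<le> norm (y / ((lam j - x)\<^sup>2 + y\<^sup>2))" by simp
  qed simp
  have "(\<integral>x. f x * Im (empirical_stieltjes n lam (Complex x y)) \<partial>lborel)
      = (\<integral>x. (\<Sum>j<n. ?P j x) / n \<partial>lborel)"
    unfolding Im_empirical_stieltjes by (simp add: sum_distrib_left)
  also have "\<dots> = (\<Sum>j<n. \<integral>x. ?P j x \<partial>lborel) / n"
    by (subst Bochner_Integration.integral_divide_zero, subst Bochner_Integration.integral_sum) (use int in auto)
  finally have "(\<integral>x. f x * Im (empirical_stieltjes n lam (Complex x y)) \<partial>lborel) - pi * ((\<Sum>j<n. f (lam j)) / n)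
      = (\<Sum>j<n. (\<integral>x. ?P j x \<partial>lborel) - pi * f (lam j)) / real n"
    by (simp add: sum_subtractf sum_distrib_left diff_divide_distrib)
  moreover have "norm ((\<Sum>j<n. (\<integral>x. ?P j x \<partial>lborel) - pi * f (lam j)) / real n) \<le> smoothing_error L y"
  proof (rule norm_average_le)
    show *: "norm ((\<integral>x. ?P j x \<partial>lborel) - pi * f (lam j)) \<le> smoothing_error L y" for j
      using poisson_smoothing[OF assms(1-4), of "lam j"] by simp
    show "0 \<le> smoothing_error L y" using order_trans[OF norm_ge_zero *[of 0]] .
  qed
  ultimately show ?thesis by simp
qed

text \<open>At a fixed height the defect of the equation is continuous in the abscissa with a
  modulus independent of n, so convergence at rational abscissae spreads to all real ones.\<close>

lemma semicircle_equation_all_abscissae: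
  fixes lam :: "nat \<Rightarrow> nat \<Rightarrow> real"
  assumes "y > 0"
    and lim: "\<And>p::rat. (\<lambda>n. 1 + Complex (of_rat p) y * empirical_stieltjes n (lam n) (Complex (of_rat p) y)
        + (empirical_stieltjes n (lam n) (Complex (of_rat p) y))\<^sup>2) \<longlonglongrightarrow> 0"
  shows "(\<lambda>n. 1 + Complex x y * empirical_stieltjes n (lam n) (Complex x y)
        + (empirical_stieltjes n (lam n) (Complex x y))\<^sup>2) \<longlonglongrightarrow> 0"
proof -
  define m where "m n t = empirical_stieltjes n (lam n) (Complex t y)" for n t
  define D where "D n t = 1 + Complex t y * m n t + (m n t)\<^sup>2" for n t
  \<comment> \<open>Three contributions: the change of the factor z with |m| \<le> 1 / y, the change
    of m in z m with Lipschitz constant 1 / y^2, and the change of m^2 as that constant times |m +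
    m'| \<le> 2 / y.\<close>
  define C where "C = 1 / y + cmod (Complex x y) / y\<^sup>2 + 2 / y ^ 3"
  have C0: "C > 0" unfolding C_def using \<open>y > 0\<close>
    by (intro add_pos_nonneg add_nonneg_nonneg) auto
  have mb: "norm (m n t) \<le> 1 / y" for n t
    unfolding m_def using norm_empirical_stieltjes_le[of "Complex t y"] \<open>y > 0\<close> by simp
  have ml: "norm (m n x - m n t) \<le> \<bar>x - t\<bar> / y\<^sup>2" for n t
  proof -
    have "Complex x y - Complex t y = of_real (x - t)" by (simp add: complex_eq_iff)
    then have "norm (Complex x y - Complex t y) = \<bar>x - t\<bar>" by (simp only: norm_of_real)
    then show ?thesis
      using empirical_stieltjes_lipschitz[of "Complex x y" "Complex t y" n "lam n"] \<open>y > 0\<close>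
      unfolding m_def by (simp add: power2_eq_square)
  qed
  have Dl: "norm (D n x) \<le> norm (D n t) + C * \<bar>x - t\<bar>" for n t
  proof -
    have "D n x - D n t = of_real (x - t) * m n t + Complex x y * (m n x - m n t)
        + (m n x - m n t) * (m n x + m n t)"
    proof -
      have "Complex t y = Complex x y - of_real (x - t)" by (simp add: complex_eq_iff)
      then show ?thesis unfolding D_def by (simp only:) (simp add: algebra_simps power2_eq_square)
    qed
    also have "norm \<dots> \<le> \<bar>x - t\<bar> * (1 / y) + cmod (Complex x y) * (\<bar>x - t\<bar> / y\<^sup>2)
        + \<bar>x - t\<bar> / y\<^sup>2 * (1 / y + 1 / y)"
    proof (intro order_trans[OF norm_triangle_ineq] add_mono)
      show "norm (of_real (x - t) * m n t) \<le> \<bar>x - t\<bar> * (1 / y)"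
        unfolding norm_mult norm_of_real using mb by (intro mult_left_mono) auto
      show "norm (Complex x y * (m n x - m n t)) \<le> cmod (Complex x y) * (\<bar>x - t\<bar> / y\<^sup>2)"
        unfolding norm_mult using ml by (intro mult_left_mono) auto
      show "norm ((m n x - m n t) * (m n x + m n t)) \<le> \<bar>x - t\<bar> / y\<^sup>2 * (1 / y + 1 / y)"
        unfolding norm_mult using ml order_trans[OF norm_triangle_ineq add_mono[OF mb mb]]
        by (intro mult_mono) auto
    qed
    also have "\<dots> = C * \<bar>x - t\<bar>" unfolding C_def using \<open>y > 0\<close>
      by (simp add: field_simps power2_eq_square power3_eq_cube)
    finally show ?thesis using norm_triangle_ineq2[of "D n x" "D n t"] by linarith
  qed
  have "(\<lambda>n. D n x) \<longlonglongrightarrow> 0"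
  proof (rule LIMSEQ_I)
    fix e :: real assume "e > 0"
    define d where "d = e / (2 * C)"
    have "d > 0" unfolding d_def using \<open>e > 0\<close> C0 by simp
    then obtain p where p: "x < of_rat p" "of_rat p < x + d" using of_rat_dense[of x "x + d"] by auto
    have "C * \<bar>x - of_rat p\<bar> \<le> C * d" using p C0 by (intro mult_left_mono) auto
    also have "C * d = e / 2" unfolding d_def using C0 by simp
    finally have Cp: "C * \<bar>x - of_rat p\<bar> \<le> e / 2" .
    have "(\<lambda>n. D n (of_rat p)) \<longlonglongrightarrow> 0" unfolding D_def m_def by (rule lim)
    from LIMSEQ_D[OF this, of "e / 2"] \<open>e > 0\<close>
    obtain N where N: "\<And>n. n \<ge> N \<Longrightarrow> norm (D n (of_rat p)) < e / 2" by auto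
    have "norm (D n x - 0) < e" if "n \<ge> N" for n
      using Dl[of n "of_rat p"] N[OF that] Cp by (simp add: algebra_simps)
    then show "\<exists>N. \<forall>n\<ge>N. norm (D n x - 0) < e" by blast
  qed
  then show ?thesis unfolding D_def m_def .
qed

lemma empirical_stieltjes_tendsto:
  assumes "Im z > 0"
    and "(\<lambda>n. 1 + z * empirical_stieltjes n (lam n) z + (empirical_stieltjes n (lam n) z)\<^sup>2) \<longlonglongrightarrow> 0"
  shows "(\<lambda>n. empirical_stieltjes n (lam n) z) \<longlonglongrightarrow> semicircle_stieltjes z"
proof -
  define D where "D n = 1 + z * empirical_stieltjes n (lam n) z + (empirical_stieltjes n (lam n) z)\<^sup>2" for n
  have "D \<longlonglongrightarrow> 0" unfolding D_def by (rule assms(2))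
  then have lim: "(\<lambda>n. norm (D n) / Im z) \<longlonglongrightarrow> 0"
    by (intro tendsto_divide_zero tendsto_norm_zero)
  have bound: "norm (empirical_stieltjes n (lam n) z - semicircle_stieltjes z) \<le> norm (D n) / Im z" for n
    using semicircle_stieltjes_stability[OF assms(1) Im_empirical_stieltjes_nonneg[OF assms(1)], of n "lam n"] assms(1)
    unfolding D_def by (simp only: pos_le_divide_eq)
  have "(\<lambda>n. empirical_stieltjes n (lam n) z - semicircle_stieltjes z) \<longlonglongrightarrow> 0"
    by (rule Lim_null_comparison[OF always_eventually[OF allI[OF bound]] lim])
  then show ?thesis by (rule LIM_zero_cancel)
qed

text \<open>Two limits in a fixed order: first n at fixed height, dominated by 1 / y on the support
  of f, then the height tends to 0, dominated through |s| \<le> 1. The smoothing error does not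
  depend on n or on the points, which is what permits choosing the height before n. Compact support
  of f makes both majorants integrable.\<close>

lemma empirical_average_tendsto_semicircle:
  fixes lam :: "nat \<Rightarrow> nat \<Rightarrow> real" and f :: "real \<Rightarrow> real"
  assumes lim: "\<And>(p::rat) k. (\<lambda>n. 1 + Complex (of_rat p) (inverse (Suc k)) * empirical_stieltjes n (lam n) (Complex (of_rat p) (inverse (Suc k)))
        + (empirical_stieltjes n (lam n) (Complex (of_rat p) (inverse (Suc k))))\<^sup>2) \<longlonglongrightarrow> 0"
    and f[measurable]: "f \<in> borel_measurable borel"
    and bnd: "\<And>x. \<bar>f x\<bar> \<le> indicator {a..b} x" and "L \<ge> 0"
    and lip: "\<And>x x'. \<bar>f x - f x'\<bar> \<le> min 1 (L * \<bar>x - x'\<bar>)"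
  shows "(\<lambda>n. (\<Sum>j<n. f (lam n j)) / n) \<longlonglongrightarrow> (\<integral>x. f x \<partial>semicircle_law)"
proof -
  define y where "y k = inverse (real (Suc k))" for k
  have y: "y k > 0" for k unfolding y_def by simp
  have y0: "y \<longlonglongrightarrow> 0" unfolding y_def by (rule LIMSEQ_inverse_real_of_nat)
  define s where "s k x = Im (semicircle_stieltjes (Complex x (y k)))" for k x
  define B where "B n k = (\<integral>x. f x * Im (empirical_stieltjes n (lam n) (Complex x (y k))) \<partial>lborel)" for n k
  define C where "C k = (\<integral>x. f x * s k x \<partial>lborel)" for k
  have fb: "\<bar>f x\<bar> \<le> 1" for x using order_trans[OF bnd indicator_le_1] .
  have pw: "(\<lambda>n. empirical_stieltjes n (lam n) (Complex x (y k))) \<longlonglongrightarrow> semicircle_stieltjes (Complex x (y k))" for x k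
  proof -
    have "(\<lambda>n. 1 + Complex (of_rat p) (y k) * empirical_stieltjes n (lam n) (Complex (of_rat p) (y k))
        + (empirical_stieltjes n (lam n) (Complex (of_rat p) (y k)))\<^sup>2) \<longlonglongrightarrow> 0" for p :: rat
      unfolding y_def by (rule lim)
    then show ?thesis
      by (intro empirical_stieltjes_tendsto[OF _ semicircle_equation_all_abscissae[OF y]]) (simp_all add: y)
  qed
  have meas_m[measurable]: "(\<lambda>x. Im (empirical_stieltjes n (lam n) (Complex x (y k)))) \<in> borel_measurable borel" for n k
    unfolding Im_empirical_stieltjes by measurable
  \<comment> \<open>The root is defined by a choice operator; measurability comes from its being a
    pointwise limit of empirical transforms.\<close>
  have meas_s[measurable]: "s k \<in> borel_measurable borel" for k
    unfolding s_def
  proof (rule borel_measurable_LIMSEQ_real)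
    show "(\<lambda>n. Im (empirical_stieltjes n (lam n) (Complex x (y k)))) \<longlonglongrightarrow> Im (semicircle_stieltjes (Complex x (y k)))" for x
      by (intro tendsto_Im pw)
  qed (rule meas_m)
  have ind: "integrable lborel (indicat_real {a..b})"
    by (rule integrable_real_indicator) (auto simp: emeasure_lborel_Icc_eq)
  have BC: "(\<lambda>n. B n k) \<longlonglongrightarrow> C k" for k
    unfolding B_def C_def
  proof (rule integral_dominated_convergence[where w = "\<lambda>x. 1 / y k * indicator {a..b} x"])
    show "AE x in lborel. (\<lambda>n. f x * Im (empirical_stieltjes n (lam n) (Complex x (y k)))) \<longlonglongrightarrow> f x * s k x"
      unfolding s_def by (intro AE_I2 tendsto_intros pw)
    show "AE x in lborel. norm (f x * Im (empirical_stieltjes n (lam n) (Complex x (y k)))) \<le> 1 / y k * indicator {a..b} x" for n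
    proof (rule AE_I2)
      fix x
      have "\<bar>Im (empirical_stieltjes n (lam n) (Complex x (y k)))\<bar> \<le> 1 / y k"
        using order_trans[OF abs_Im_le_cmod norm_empirical_stieltjes_le, of "Complex x (y k)"] y by simp
      then have "\<bar>f x\<bar> * \<bar>Im (empirical_stieltjes n (lam n) (Complex x (y k)))\<bar> \<le> indicator {a..b} x * (1 / y k)"
        by (intro mult_mono bnd) auto
      then show "norm (f x * Im (empirical_stieltjes n (lam n) (Complex x (y k)))) \<le> 1 / y k * indicator {a..b} x"
        by (simp add: abs_mult mult.commute)
    qed
  qed (use ind in simp_all)
  have C_lim: "(\<lambda>k. C k / pi) \<longlonglongrightarrow> (\<integral>x. f x \<partial>semicircle_law)"
  proof -
    have "(\<lambda>k. \<integral>x. f x * (s k x / pi) \<partial>lborel) \<longlonglongrightarrow> (\<integral>x. f x * semicircle_density x \<partial>lborel)"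
    proof (rule integral_dominated_convergence[where w = "\<lambda>x. 1 * indicator {a..b} x"])
      show "AE x in lborel. (\<lambda>k. f x * (s k x / pi)) \<longlonglongrightarrow> f x * semicircle_density x"
        unfolding s_def by (intro AE_I2 tendsto_intros Im_semicircle_stieltjes_boundary y y0)
      show "AE x in lborel. norm (f x * (s k x / pi)) \<le> 1 * indicator {a..b} x" for k
      proof (rule AE_I2)
        fix x
        have "\<bar>s k x\<bar> \<le> 1" unfolding s_def
          using order_trans[OF abs_Im_le_cmod norm_semicircle_stieltjes_le_1, of "Complex x (y k)"] y by simp
        then have "\<bar>s k x / pi\<bar> \<le> 1" using pi_gt3 by (simp add: field_simps)
        then have "\<bar>f x\<bar> * \<bar>s k x / pi\<bar> \<le> indicator {a..b} x * 1"
          by (intro mult_mono bnd) auto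
        then show "norm (f x * (s k x / pi)) \<le> 1 * indicator {a..b} x" by (simp only: real_norm_def abs_mult mult.commute)
      qed
    qed (use ind in simp_all)
    then show ?thesis unfolding C_def integral_semicircle_law[OF f] by simp
  qed
  define w where "w k = smoothing_error L (y k) / pi" for k
  have w0: "w \<longlonglongrightarrow> 0"
    unfolding w_def using tendsto_divide[OF smoothing_error_tendsto_0[OF \<open>L \<ge> 0\<close> y y0] tendsto_const, of pi] by simp
  have AB: "\<bar>(\<Sum>j<n. f (lam n j)) / n - B n k / pi\<bar> \<le> w k" if "n > 0" for n k
  proof -
    have "\<bar>B n k - pi * ((\<Sum>j<n. f (lam n j)) / n)\<bar> \<le> smoothing_error L (y k)"
      unfolding B_def by (rule empirical_smoothing[OF f fb lip y that])
    moreover have "\<bar>B n k - pi * ((\<Sum>j<n. f (lam n j)) / n)\<bar> = pi * \<bar>(\<Sum>j<n. f (lam n j)) / n - B n k / pi\<bar>"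
    proof -
      have "\<bar>u - pi * v\<bar> = pi * \<bar>v - u / pi\<bar>" for u v :: real
      proof -
        have "u - pi * v = pi * (u / pi - v)" by (simp add: right_diff_distrib)
        then show ?thesis by (simp only: abs_mult abs_minus_commute) simp
      qed
      then show ?thesis .
    qed
    ultimately have "\<bar>(\<Sum>j<n. f (lam n j)) / n - B n k / pi\<bar> \<le> smoothing_error L (y k) / pi"
      by (simp only: pos_le_divide_eq[OF pi_gt_zero] mult.commute)
    then show ?thesis unfolding w_def .
  qed
  let ?I = "\<integral>x. f x \<partial>semicircle_law"
  show ?thesis
  proof (rule LIMSEQ_I)
    fix e :: real assume "e > 0"
    from LIMSEQ_D[OF w0, of "e / 3"] \<open>e > 0\<close>
    obtain k1 where k1: "\<And>k. k \<ge> k1 \<Longrightarrow> \<bar>w k\<bar> < e / 3" by auto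
    from LIMSEQ_D[OF C_lim, of "e / 3"] \<open>e > 0\<close>
    obtain k2 where k2: "\<And>k. k \<ge> k2 \<Longrightarrow> \<bar>C k / pi - ?I\<bar> < e / 3" by auto
    define k where "k = max k1 k2"
    have k: "\<bar>w k\<bar> < e / 3" "\<bar>C k / pi - ?I\<bar> < e / 3" using k1 k2 unfolding k_def by auto
    have "(\<lambda>n. B n k / pi) \<longlonglongrightarrow> C k / pi" by (intro tendsto_intros BC) simp
    from LIMSEQ_D[OF this, of "e / 3"] \<open>e > 0\<close>
    obtain N where N: "\<And>n. n \<ge> N \<Longrightarrow> \<bar>B n k / pi - C k / pi\<bar> < e / 3" by auto
    have "norm ((\<Sum>j<n. f (lam n j)) / n - ?I) < e" if "n \<ge> max N 1" for n
      using AB[of n k] N[of n] k that unfolding real_norm_def by linarith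
    then show "\<exists>N. \<forall>n\<ge>N. norm ((\<Sum>j<n. f (lam n j)) / n - ?I) < e" by blast
  qed
qed

section \<open>Squeezing the distribution function between trapezoids\<close>

definition trapezoid :: "real \<Rightarrow> real \<Rightarrow> real \<Rightarrow> real \<Rightarrow> real" where
  "trapezoid e a b x = max 0 (min 1 (min ((x - a) / e) ((b - x) / e)))"

lemma trapezoid_measurable [measurable]: "trapezoid e a b \<in> borel_measurable borel"
  unfolding trapezoid_def by measurable

lemma trapezoid_nonneg: "trapezoid e a b x \<ge> 0"
  unfolding trapezoid_def by simp

lemma trapezoid_outside:
  assumes "e > 0" "x \<le> a \<or> b \<le> x"
  shows "trapezoid e a b x = 0"
proof -
  have "(x - a) / e \<le> 0 \<or> (b - x) / e \<le> 0"
    using assms by (auto intro: divide_nonpos_pos)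
  then have "min ((x - a) / e) ((b - x) / e) \<le> 0" by (simp only: min_le_iff_disj)
  then show ?thesis unfolding trapezoid_def by (simp only: max_def min_def split: if_split) auto
qed

lemma trapezoid_le_indicator:
  assumes "e > 0"
  shows "trapezoid e a b x \<le> indicator {a..b} x"
proof (cases "x \<in> {a..b}")
  case True
  then show ?thesis by (simp add: trapezoid_def)
next
  case False
  then have "trapezoid e a b x = 0" by (intro trapezoid_outside assms) auto
  then show ?thesis by simp
qed

lemma trapezoid_inside:
  assumes "e > 0" "a + e \<le> x" "x \<le> b - e"
  shows "trapezoid e a b x = 1"
proof -
  have "1 \<le> (x - a) / e" "1 \<le> (b - x) / e"
    using assms by (simp_all add: le_divide_eq)
  then show ?thesis unfolding trapezoid_def by (simp add: min_absorb1)
qed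

lemma trapezoid_lipschitz:
  assumes "e > 0"
  shows "\<bar>trapezoid e a b x - trapezoid e a b x'\<bar> \<le> min 1 (1 / e * \<bar>x - x'\<bar>)"
proof -
  define p q where "p t = (t - a) / e" and "q t = (b - t) / e" for t
  define d where "d = 1 / e * \<bar>x - x'\<bar>"
  have "p x - p x' = (x - x') / e" "q x - q x' = - ((x - x') / e)"
    unfolding p_def q_def by (simp_all add: diff_divide_distrib)
  then have p: "\<bar>p x - p x'\<bar> \<le> d" and q: "\<bar>q x - q x'\<bar> \<le> d"
    unfolding d_def using assms by (simp_all add: abs_divide)
  have minl: "\<bar>min s t - min s' t'\<bar> \<le> c" if "\<bar>s - s'\<bar> \<le> c" "\<bar>t - t'\<bar> \<le> c" for s s' t t' c :: real
    using that by (auto simp: min_def abs_le_iff)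
  have maxl: "\<bar>max 0 s - max 0 s'\<bar> \<le> c" if "\<bar>s - s'\<bar> \<le> c" for s s' c :: real
    using that by (auto simp: max_def abs_le_iff)
  have "d \<ge> 0" unfolding d_def using assms by simp
  then have "\<bar>max 0 (min 1 (min (p x) (q x))) - max 0 (min 1 (min (p x') (q x')))\<bar> \<le> d"
    by (intro maxl minl p q) simp
  moreover have "\<bar>max 0 (min 1 u) - max 0 (min 1 v)\<bar> \<le> 1" for u v :: real
  proof -
    have diff: "\<bar>A - B\<bar> \<le> 1" if "0 \<le> A" "A \<le> 1" "0 \<le> B" "B \<le> 1" for A B :: real
      using that by linarith
    show ?thesis by (rule diff) simp_all
  qed
  ultimately show ?thesis unfolding trapezoid_def p_def q_def d_def by (intro min.boundedI)
qed

text \<open>The test functions have compact support, so half-lines are not directly accessible. From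
  below, a trapezoid on [-2 - e, t] already sees all the limiting mass up to t - e. From above, the
  points beyond t are counted by a trapezoid on [t, 2 + e] and subtracted from the total mass 1;
  since the limit has full mass on [-2, 2], this takes the place of a tightness argument.\<close>

lemma esd_tendsto_semicircle:
  fixes lam :: "nat \<Rightarrow> nat \<Rightarrow> real"
  assumes lim: "\<And>(p::rat) k. (\<lambda>n. 1 + Complex (of_rat p) (inverse (Suc k)) * empirical_stieltjes n (lam n) (Complex (of_rat p) (inverse (Suc k)))
        + (empirical_stieltjes n (lam n) (Complex (of_rat p) (inverse (Suc k))))\<^sup>2) \<longlonglongrightarrow> 0"
    and cont: "isCont (cdf semicircle_law) t"
  shows "(\<lambda>n. real (card {j. j < n \<and> lam n j \<le> t}) / n) \<longlonglongrightarrow> cdf semicircle_law t"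
proof -
  interpret S: prob_space semicircle_law by (rule prob_space_semicircle_law)
  define F where "F n = real (card {j. j < n \<and> lam n j \<le> t}) / n" for n
  have F_sum: "F n = (\<Sum>j<n. indicator {..t} (lam n j)) / n" for n
  proof -
    have "(\<Sum>j<n. indicator {..t} (lam n j)) = (\<Sum>j\<in>{j. j < n \<and> lam n j \<le> t}. (1::real))"
      by (rule sum.mono_neutral_cong_right) (auto simp: indicator_def)
    then show ?thesis unfolding F_def by simp
  qed
  have conv: "(\<lambda>n. (\<Sum>j<n. trapezoid e a b (lam n j)) / n) \<longlonglongrightarrow> (\<integral>x. trapezoid e a b x \<partial>semicircle_law)"
    if "e > 0" for e a b
    using that by (intro empirical_average_tendsto_semicircle[where a = a and b = b and L = "1 / e"] lim trapezoid_lipschitz)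
      (auto simp: trapezoid_nonneg trapezoid_le_indicator abs_of_nonneg)
  have supp: "AE x in semicircle_law. -2 \<le> x \<and> x \<le> 2"
  proof -
    have "AE x in semicircle_law. x \<notin> {..<-2}" "AE x in semicircle_law. x \<notin> {2<..}"
      by (intro AE_not_in null_setsI semicircle_law_lessThan_minus_2 semicircle_law_greaterThan_2; simp)+
    then show ?thesis by eventually_elim auto
  qed
  have int: "integrable semicircle_law (trapezoid e a b)" if "e > 0" for e a b
    by (rule S.integrable_const_bound[where B = 1])
      (use trapezoid_nonneg[of e a b] order_trans[OF trapezoid_le_indicator[OF that] indicator_le_1] in \<open>auto simp: abs_of_nonneg\<close>)
  \<comment> \<open>For t near or below -2 the trapezoid loses its plateau or vanishes; the estimate
    persists because the indicator on the left is then 0 on the support of the law.\<close>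
  have lower: "cdf semicircle_law (t - e) \<le> (\<integral>x. trapezoid e (-2 - e) t x \<partial>semicircle_law)" if "e > 0" for e
  proof -
    have "cdf semicircle_law (t - e) = (\<integral>x. indicator {..t - e} x \<partial>semicircle_law)"
      unfolding cdf_def by simp
    also have "\<dots> \<le> (\<integral>x. trapezoid e (-2 - e) t x \<partial>semicircle_law)"
    proof (rule integral_mono_AE)
      show "AE x in semicircle_law. indicator {..t - e} x \<le> trapezoid e (-2 - e) t x"
        using supp by eventually_elim (use that in \<open>auto simp: indicator_def trapezoid_nonneg trapezoid_inside\<close>)
    qed (use int that in \<open>auto simp: S.emeasure_eq_measure\<close>)
    finally show ?thesis .
  qed
  have upper: "1 - (\<integral>x. trapezoid e t (2 + e) x \<partial>semicircle_law) \<le> cdf semicircle_law (t + e)" if "e > 0" for e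
  proof -
    have "1 - cdf semicircle_law (t + e) = (\<integral>x. 1 - indicator {..t + e} x \<partial>semicircle_law)"
      unfolding cdf_def by (subst Bochner_Integration.integral_diff) (use S.prob_space in \<open>auto simp: S.emeasure_eq_measure\<close>)
    also have "\<dots> \<le> (\<integral>x. trapezoid e t (2 + e) x \<partial>semicircle_law)"
    proof (rule integral_mono_AE)
      show "AE x in semicircle_law. 1 - indicator {..t + e} x \<le> trapezoid e t (2 + e) x"
        using supp by eventually_elim (use that in \<open>auto simp: indicator_def trapezoid_nonneg trapezoid_inside\<close>)
    qed (use int that in \<open>auto simp: S.emeasure_eq_measure\<close>)
    finally show ?thesis by simp
  qed
  have F_lower: "(\<Sum>j<n. trapezoid e (-2 - e) t (lam n j)) / n \<le> F n" if "e > 0" for n e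
    unfolding F_sum
  proof (intro divide_right_mono sum_mono)
    fix j show "trapezoid e (-2 - e) t (lam n j) \<le> indicator {..t} (lam n j)"
      using trapezoid_le_indicator[OF that, of "-2 - e" t "lam n j"]
        order_trans[OF trapezoid_le_indicator[OF that, of "-2 - e" t "lam n j"] indicator_le_1] by (auto simp: indicator_def split: if_splits)
  qed simp
  have F_upper: "F n \<le> 1 - (\<Sum>j<n. trapezoid e t (2 + e) (lam n j)) / n" if "e > 0" "n > 0" for n e
  proof -
    have "(\<Sum>j<n. indicator {..t} (lam n j)) \<le> (\<Sum>j<n. 1 - trapezoid e t (2 + e) (lam n j))"
    proof (rule sum_mono)
      fix j show "indicator {..t} (lam n j) \<le> 1 - trapezoid e t (2 + e) (lam n j)"
        using trapezoid_outside[OF that(1), of "lam n j" t "2 + e"]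
          order_trans[OF trapezoid_le_indicator[OF that(1)] indicator_le_1, of t "2 + e" "lam n j"]
        by (auto simp: indicator_def)
    qed
    then have "F n \<le> (\<Sum>j<n. 1 - trapezoid e t (2 + e) (lam n j)) / n"
      unfolding F_sum by (rule divide_right_mono) simp
    also have "\<dots> = 1 - (\<Sum>j<n. trapezoid e t (2 + e) (lam n j)) / n"
      using that by (simp add: sum_subtractf diff_divide_distrib)
    finally show ?thesis .
  qed
  have "F \<longlonglongrightarrow> cdf semicircle_law t"
  proof (rule LIMSEQ_I)
    fix r :: real assume "r > 0"
    have "r / 2 > 0" using \<open>r > 0\<close> by simp
    from LIM_D[OF cont[unfolded isCont_def] this]
    obtain d where "d > 0" and d: "\<And>u. u \<noteq> t \<Longrightarrow> norm (u - t) < d \<Longrightarrow>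
        norm (cdf semicircle_law u - cdf semicircle_law t) < r / 2"
      by blast
    define e where "e = d / 2"
    have e: "e > 0" unfolding e_def using \<open>d > 0\<close> by simp
    have c: "\<bar>cdf semicircle_law (t - e) - cdf semicircle_law t\<bar> < r / 2"
      "\<bar>cdf semicircle_law (t + e) - cdf semicircle_law t\<bar> < r / 2"
      using d[of "t - e"] d[of "t + e"] \<open>d > 0\<close> unfolding e_def by auto
    obtain N1 where N1: "\<And>n. n \<ge> N1 \<Longrightarrow> \<bar>(\<Sum>j<n. trapezoid e (-2 - e) t (lam n j)) / n - (\<integral>x. trapezoid e (-2 - e) t x \<partial>semicircle_law)\<bar> < r / 2"
      using LIMSEQ_D[OF conv[OF e, of "-2 - e" t], of "r / 2"] \<open>r > 0\<close> by auto
    obtain N2 where N2: "\<And>n. n \<ge> N2 \<Longrightarrow> \<bar>(\<Sum>j<n. trapezoid e t (2 + e) (lam n j)) / n - (\<integral>x. trapezoid e t (2 + e) x \<partial>semicircle_law)\<bar> < r / 2"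
      using LIMSEQ_D[OF conv[OF e, of t "2 + e"], of "r / 2"] \<open>r > 0\<close> by auto
    have squeeze: "\<bar>v - c\<bar> < r"
      if "\<bar>l - l'\<bar> < r / 2" "\<bar>u - u'\<bar> < r / 2" "\<bar>c1 - c\<bar> < r / 2" "\<bar>c2 - c\<bar> < r / 2"
        "c1 \<le> l'" "1 - u' \<le> c2" "l \<le> v" "v \<le> 1 - u" for v c l l' u u' c1 c2 :: real
      using that by linarith
    have "norm (F n - cdf semicircle_law t) < r" if "n \<ge> max (max N1 N2) 1" for n
      unfolding real_norm_def
      by (rule squeeze[OF N1 N2 c lower[OF e] upper[OF e] F_lower[OF e] F_upper[OF e]]) (use that in auto)
    then show "\<exists>N. \<forall>n\<ge>N. norm (F n - cdf semicircle_law t) < r" by blast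
  qed
  then show ?thesis unfolding F_def .
qed

section \<open>Resolvents of Hermitian matrices\<close>

text \<open>Matrices are functions of two indices of which only the values below \<open>n\<close>
  count. Changing one entry, summing and freezing variables then need no dimension bookkeeping;
  \<open>shifted_mat\<close> is the bridge to determinants.\<close>

definition hermitian_on :: "nat \<Rightarrow> (nat \<Rightarrow> nat \<Rightarrow> complex) \<Rightarrow> bool" where
  "hermitian_on n H \<longleftrightarrow> (\<forall>i<n. \<forall>j<n. H j i = cnj (H i j))"

definition shifted_mat :: "nat \<Rightarrow> (nat \<Rightarrow> nat \<Rightarrow> complex) \<Rightarrow> complex \<Rightarrow> complex mat" where
  "shifted_mat n H z = Matrix.mat n n (\<lambda>(i, j). H i j - (if i = j then z else 0))"

text \<open>Cramer's rule: every entry is a quotient of polynomials in the entries of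
  \<open>H\<close>, which makes measurability immediate. A vanishing determinant would give 0, but
  it cannot occur for Hermitian \<open>H\<close> and nonreal \<open>z\<close>.\<close>

definition resolvent :: "nat \<Rightarrow> (nat \<Rightarrow> nat \<Rightarrow> complex) \<Rightarrow> complex \<Rightarrow> nat \<Rightarrow> nat \<Rightarrow> complex" where
  "resolvent n H z i j = adj_mat (shifted_mat n H z) $$ (i, j) / Determinant.det (shifted_mat n H z)"

definition resolvent_trace :: "nat \<Rightarrow> (nat \<Rightarrow> nat \<Rightarrow> complex) \<Rightarrow> complex \<Rightarrow> complex" where
  "resolvent_trace n H z = (\<Sum>i<n. resolvent n H z i i)"

definition fun_norm :: "nat \<Rightarrow> (nat \<Rightarrow> complex) \<Rightarrow> real" where
  "fun_norm n v = L2_set (\<lambda>i. norm (v i)) {..<n}"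

lemma shifted_mat_carrier [simp]: "shifted_mat n H z \<in> carrier_mat n n"
  unfolding shifted_mat_def by simp

lemma shifted_mat_cong:
  assumes "\<And>i j. i < n \<Longrightarrow> j < n \<Longrightarrow> H i j = H' i j"
  shows "shifted_mat n H z = shifted_mat n H' z"
  unfolding shifted_mat_def using assms by (intro eq_matI) auto

lemma resolvent_cong:
  assumes "\<And>i j. i < n \<Longrightarrow> j < n \<Longrightarrow> H i j = H' i j"
  shows "resolvent n H z = resolvent n H' z"
  by (simp add: resolvent_def fun_eq_iff shifted_mat_cong[OF assms])

lemma fun_norm_nonneg: "fun_norm n v \<ge> 0"
  unfolding fun_norm_def by simp

lemma fun_norm_power2: "(fun_norm n v)\<^sup>2 = (\<Sum>i<n. (norm (v i))\<^sup>2)"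
  unfolding fun_norm_def L2_set_def by (simp add: sum_nonneg)

lemma fun_norm_eq_0_iff: "fun_norm n v = 0 \<longleftrightarrow> (\<forall>i<n. v i = 0)"
  unfolding fun_norm_def by (auto simp: L2_set_eq_0_iff)

lemma fun_norm_diff_le: "fun_norm n (\<lambda>i. v i - w i) \<le> fun_norm n v + fun_norm n w"
proof -
  have "fun_norm n (\<lambda>i. v i - w i) \<le> L2_set (\<lambda>i. norm (v i) + norm (w i)) {..<n}"
    unfolding fun_norm_def by (rule L2_set_mono) (auto simp: norm_triangle_ineq4)
  also have "\<dots> \<le> fun_norm n v + fun_norm n w"
    unfolding fun_norm_def by (rule L2_set_triangle_ineq)
  finally show ?thesis .
qed

lemma fun_norm_mult: "fun_norm n (\<lambda>i. c * v i) = norm c * fun_norm n v"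
  unfolding fun_norm_def by (simp add: norm_mult L2_set_right_distrib)

lemma cauchy_schwarz_fun: "norm (\<Sum>i<n. cnj (w i) * v i) \<le> fun_norm n w * fun_norm n v"
proof -
  have "norm (\<Sum>i<n. cnj (w i) * v i) \<le> (\<Sum>i<n. \<bar>norm (w i)\<bar> * \<bar>norm (v i)\<bar>)"
    by (rule order_trans[OF norm_sum]) (simp add: norm_mult)
  also have "\<dots> \<le> fun_norm n w * fun_norm n v"
    unfolding fun_norm_def by (rule L2_set_mult_ineq)
  finally show ?thesis .
qed

lemma hermitian_form_real:
  assumes "hermitian_on n H"
  shows "Im (\<Sum>i<n. cnj (w i) * (\<Sum>k<n. H i k * w k)) = 0"
proof -
  have real: "Im s = 0" if "cnj s = s" for s using that by (simp add: complex_eq_iff)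
  have herm: "cnj (H i k) = H k i" if "i < n" "k < n" for i k
    using assms that unfolding hermitian_on_def by metis
  let ?S = "\<Sum>i<n. cnj (w i) * (\<Sum>k<n. H i k * w k)"
  have "cnj ?S = (\<Sum>i<n. \<Sum>k<n. w i * (cnj (H i k) * cnj (w k)))"
    by (simp only: cnj_sum complex_cnj_mult complex_cnj_cnj sum_distrib_left)
  also have "\<dots> = (\<Sum>i<n. \<Sum>k<n. cnj (w k) * (H k i * w i))"
    by (intro sum.cong refl) (simp add: herm mult_ac)
  also have "\<dots> = (\<Sum>k<n. \<Sum>i<n. cnj (w k) * (H k i * w i))"
    by (rule sum.swap)
  also have "\<dots> = ?S" by (simp only: sum_distrib_left)
  finally show ?thesis by (rule real)
qed

text \<open>The quadratic form of \<open>H\<close> is real, so pairing \<open>v\<close> with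
  \<open>w\<close> has imaginary part - Im z |w|^2, and Cauchy-Schwarz finishes. Invertibility of
  the shift, the operator bound of the resolvent and the reality of the eigenvalues all rest on
  this.\<close>

lemma hermitian_shift_bound:
  assumes "hermitian_on n H" and eq: "\<And>i. i < n \<Longrightarrow> (\<Sum>k<n. H i k * w k) - z * w i = v i"
  shows "\<bar>Im z\<bar> * fun_norm n w \<le> fun_norm n v"
proof (cases "fun_norm n w = 0")
  case True then show ?thesis by (simp add: fun_norm_nonneg)
next
  case False
  then have pos: "fun_norm n w > 0" using fun_norm_nonneg[of n w] by simp
  let ?S = "\<Sum>i<n. cnj (w i) * (\<Sum>k<n. H i k * w k)"
  have "(\<Sum>i<n. cnj (w i) * v i) = ?S - (\<Sum>i<n. z * of_real ((norm (w i))\<^sup>2))"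
    unfolding sum_subtractf[symmetric]
  proof (rule sum.cong)
    fix i assume "i \<in> {..<n}"
    then have "v i = (\<Sum>k<n. H i k * w k) - z * w i" using eq by simp
    moreover have "of_real ((norm (w i))\<^sup>2) = cnj (w i) * w i"
      using complex_norm_square[of "w i"] by (simp only: mult.commute)
    ultimately show "cnj (w i) * v i = cnj (w i) * (\<Sum>k<n. H i k * w k) - z * of_real ((norm (w i))\<^sup>2)"
      by (simp only: right_diff_distrib mult_ac)
  qed simp
  also have "(\<Sum>i<n. z * of_real ((norm (w i))\<^sup>2)) = z * of_real ((fun_norm n w)\<^sup>2)"
    unfolding fun_norm_power2 by (simp add: sum_distrib_left)
  finally have "Im (\<Sum>i<n. cnj (w i) * v i) = - (Im z * (fun_norm n w)\<^sup>2)"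
    by (simp only: minus_complex.sel hermitian_form_real[OF assms(1)] Im_complex_of_real
        times_complex.sel Re_complex_of_real)
  then have "\<bar>Im z\<bar> * (fun_norm n w)\<^sup>2 \<le> norm (\<Sum>i<n. cnj (w i) * v i)"
    using abs_Im_le_cmod[of "\<Sum>i<n. cnj (w i) * v i"] by (simp only: abs_minus_cancel abs_mult) simp
  also have "\<dots> \<le> fun_norm n w * fun_norm n v" by (rule cauchy_schwarz_fun)
  finally have "fun_norm n w * (\<bar>Im z\<bar> * fun_norm n w) \<le> fun_norm n w * fun_norm n v"
    by (simp only: power2_eq_square mult_ac)
  then show ?thesis using pos by (simp only: mult_le_cancel_left_pos)
qed

lemma det_shifted_mat_nonzero:
  assumes "hermitian_on n H" "Im z \<noteq> 0"
  shows "Determinant.det (shifted_mat n H z) \<noteq> 0"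
proof
  assume "Determinant.det (shifted_mat n H z) = 0"
  then obtain v where v: "v \<in> carrier_vec n" "v \<noteq> 0\<^sub>v n" "shifted_mat n H z *\<^sub>v v = 0\<^sub>v n"
    using det_0_iff_vec_prod_zero_field[of "shifted_mat n H z" n] by auto
  have "(\<Sum>k<n. H i k * (v $ k)) - z * (v $ i) = 0" if i: "i < n" for i
  proof -
    have "(shifted_mat n H z *\<^sub>v v) $ i = (\<Sum>k<n. (H i k - (if i = k then z else 0)) * (v $ k))"
      using v(1) i unfolding shifted_mat_def by (auto simp: scalar_prod_def atLeast0LessThan intro!: sum.cong)
    also have "\<dots> = (\<Sum>k<n. H i k * (v $ k)) - (\<Sum>k<n. if k = i then z * (v $ k) else 0)"
      unfolding sum_subtractf[symmetric] by (intro sum.cong) (auto simp: algebra_simps)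
    also have "\<dots> = (\<Sum>k<n. H i k * (v $ k)) - z * (v $ i)" using i by simp
    finally show ?thesis using v(3) i by simp
  qed
  from hermitian_shift_bound[OF assms(1) this] have "\<bar>Im z\<bar> * fun_norm n (\<lambda>k. v $ k) \<le> fun_norm n (\<lambda>_. 0)"
    by simp
  also have "fun_norm n (\<lambda>_. 0) = 0" by (simp add: fun_norm_eq_0_iff)
  finally have "fun_norm n (\<lambda>k. v $ k) = 0"
    using assms(2) fun_norm_nonneg[of n "\<lambda>k. v $ k"] by (simp add: mult_le_0_iff)
  then have "v = 0\<^sub>v n" using v(1) by (intro eq_vecI) (auto simp: fun_norm_eq_0_iff)
  with v(2) show False by simp
qed

lemma resolvent_mat_inverse:
  assumes "hermitian_on n H" "Im z \<noteq> 0"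
  shows "shifted_mat n H z * Matrix.mat n n (\<lambda>(i, j). resolvent n H z i j) = 1\<^sub>m n"
    and "Matrix.mat n n (\<lambda>(i, j). resolvent n H z i j) * shifted_mat n H z = 1\<^sub>m n"
proof -
  let ?A = "shifted_mat n H z" and ?d = "Determinant.det (shifted_mat n H z)"
  note d = det_shifted_mat_nonzero[OF assms]
  have R: "Matrix.mat n n (\<lambda>(i, j). resolvent n H z i j) = (1 / ?d) \<cdot>\<^sub>m adj_mat ?A"
    using adj_mat(1)[OF shifted_mat_carrier, of n H z] unfolding resolvent_def
    by (intro eq_matI) auto
  show "?A * Matrix.mat n n (\<lambda>(i, j). resolvent n H z i j) = 1\<^sub>m n"
    "Matrix.mat n n (\<lambda>(i, j). resolvent n H z i j) * ?A = 1\<^sub>m n"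
    unfolding R
    using d adj_mat[OF shifted_mat_carrier, of n H z]
    by (auto simp: mult_smult_distrib[of _ n n _ n] mult_smult_assoc_mat[of _ n n _ n] intro!: eq_matI)
qed

lemma mat_mult_index_sum:
  assumes "A \<in> carrier_mat n n" "B \<in> carrier_mat n n" "i < n" "j < n"
  shows "(A * B) $$ (i, j) = (\<Sum>k<n. A $$ (i, k) * B $$ (k, j))"
  using assms by (auto simp: scalar_prod_def atLeast0LessThan intro!: sum.cong)

lemma
  assumes "hermitian_on n H" "Im z \<noteq> 0" "i < n" "j < n"
  shows resolvent_right: "(\<Sum>k<n. H i k * resolvent n H z k j) = (if i = j then 1 else 0) + z * resolvent n H z i j"
    and resolvent_left: "(\<Sum>k<n. resolvent n H z i k * H k j) = (if i = j then 1 else 0) + z * resolvent n H z i j"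
proof -
  let ?R = "resolvent n H z" and ?G = "Matrix.mat n n (\<lambda>(i, j). resolvent n H z i j)"
  have "(\<Sum>k<n. shifted_mat n H z $$ (i, k) * ?G $$ (k, j)) = 1\<^sub>m n $$ (i, j)"
    using assms by (subst mat_mult_index_sum[symmetric]) (auto simp: resolvent_mat_inverse)
  also have "(\<Sum>k<n. shifted_mat n H z $$ (i, k) * ?G $$ (k, j))
     = (\<Sum>k<n. H i k * ?R k j) - (\<Sum>k<n. if k = i then z * ?R k j else 0)"
    unfolding sum_subtractf[symmetric] shifted_mat_def using assms by (intro sum.cong) (auto simp: algebra_simps)
  finally show "(\<Sum>k<n. H i k * ?R k j) = (if i = j then 1 else 0) + z * ?R i j"
    using assms by (auto simp: diff_eq_eq)
  have "(\<Sum>k<n. ?G $$ (i, k) * shifted_mat n H z $$ (k, j)) = 1\<^sub>m n $$ (i, j)"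
    using assms by (subst mat_mult_index_sum[symmetric]) (auto simp: resolvent_mat_inverse)
  also have "(\<Sum>k<n. ?G $$ (i, k) * shifted_mat n H z $$ (k, j))
     = (\<Sum>k<n. ?R i k * H k j) - (\<Sum>k<n. if k = j then z * ?R i k else 0)"
    unfolding sum_subtractf[symmetric] shifted_mat_def using assms by (intro sum.cong) (auto simp: algebra_simps)
  finally show "(\<Sum>k<n. ?R i k * H k j) = (if i = j then 1 else 0) + z * ?R i j"
    using assms by (auto simp: diff_eq_eq)
qed

lemma resolvent_apply_norm_le:
  assumes "hermitian_on n H" "Im z > 0"
  shows "fun_norm n (\<lambda>i. \<Sum>j<n. resolvent n H z i j * v j) \<le> fun_norm n v / Im z"
proof -
  let ?R = "resolvent n H z"
  let ?w = "\<lambda>i. \<Sum>j<n. ?R i j * v j"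
  have "(\<Sum>k<n. H i k * ?w k) - z * ?w i = v i" if i: "i < n" for i
  proof -
    have "(\<Sum>k<n. H i k * ?w k) = (\<Sum>k<n. \<Sum>j<n. H i k * ?R k j * v j)"
      by (simp add: sum_distrib_left mult.assoc)
    also have "\<dots> = (\<Sum>j<n. (\<Sum>k<n. H i k * ?R k j) * v j)"
      unfolding sum_distrib_right by (rule sum.swap)
    also have "\<dots> = (\<Sum>j<n. (if j = i then v j else 0) + z * (?R i j * v j))"
      using assms i by (intro sum.cong) (auto simp: resolvent_right algebra_simps)
    also have "\<dots> = v i + z * ?w i" using i by (simp add: sum.distrib sum_distrib_left)
    finally show ?thesis by simp
  qed
  from hermitian_shift_bound[OF assms(1) this] assms(2)
  show ?thesis by (simp only: pos_le_divide_eq abs_of_pos mult.commute)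
qed

text \<open>The operator bound at the j-th unit vector. The column bound is the stronger half: it
  makes the sum of all n^2 squared entries O(n).\<close>

lemma
  assumes "hermitian_on n H" "Im z > 0" "j < n"
  shows resolvent_column_norm_le: "(\<Sum>i<n. (norm (resolvent n H z i j))\<^sup>2) \<le> 1 / (Im z)\<^sup>2"
    and resolvent_entry_norm_le: "i < n \<Longrightarrow> norm (resolvent n H z i j) \<le> 1 / Im z"
proof -
  let ?R = "resolvent n H z"
  have "(\<Sum>k<n. ?R i k * (if k = j then 1 else 0)) = ?R i j" for i
    using assms(3) by (simp add: if_distrib[of "\<lambda>x. _ * x"] cong: if_cong)
  moreover have "(fun_norm n (\<lambda>k. if k = j then 1 else 0))\<^sup>2 = 1"
    unfolding fun_norm_power2 using assms(3) by (simp add: if_distrib[of norm] if_distrib[of "\<lambda>x. x\<^sup>2"] cong: if_cong)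
  then have "fun_norm n (\<lambda>k. if k = j then 1 else 0) = 1"
    using fun_norm_nonneg by (simp add: power2_eq_1_iff) (metis neg_0_le_iff_le not_one_le_zero)
  ultimately have le: "fun_norm n (\<lambda>i. ?R i j) \<le> 1 / Im z"
    using resolvent_apply_norm_le[OF assms(1,2), of "\<lambda>k. if k = j then 1 else 0"] by simp
  then have "(fun_norm n (\<lambda>i. ?R i j))\<^sup>2 \<le> (1 / Im z)\<^sup>2"
    by (rule power_mono) (rule fun_norm_nonneg)
  then show col: "(\<Sum>i<n. (norm (?R i j))\<^sup>2) \<le> 1 / (Im z)\<^sup>2"
    unfolding fun_norm_power2 by (simp add: power_divide)
  show "norm (?R i j) \<le> 1 / Im z" if "i < n"
    using order_trans[OF member_le_L2_set[of "{..<n}" i "\<lambda>i. norm (?R i j)"] le[unfolded fun_norm_def]] that by simp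
qed

section \<open>Perturbation of the resolvent and of its trace\<close>

lemma resolvent_identity:
  assumes "hermitian_on n H" "hermitian_on n H'" "Im z \<noteq> 0" "i < n" "j < n"
  shows "resolvent n H z i j - resolvent n H' z i j
    = (\<Sum>k<n. \<Sum>l<n. resolvent n H z i k * (H' k l - H k l) * resolvent n H' z l j)"
proof -
  let ?G = "resolvent n H z" and ?G' = "resolvent n H' z"
  \<comment> \<open>The sum with \<open>H'\<close> is contracted on the right by
    \<open>H' G' = 1 + z G'\<close>, the one with \<open>H\<close> on the left by
    \<open>G H = 1 + z G\<close>. Both leave the same \<open>z G G'\<close>, which cancels.\<close>
  have "(\<Sum>k<n. \<Sum>l<n. ?G i k * H' k l * ?G' l j) = (\<Sum>k<n. ?G i k * (\<Sum>l<n. H' k l * ?G' l j))"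
    by (simp add: sum_distrib_left mult.assoc)
  also have "\<dots> = (\<Sum>k<n. (if k = j then ?G i k else 0) + z * (?G i k * ?G' k j))"
    using assms by (intro sum.cong) (auto simp: resolvent_right algebra_simps)
  also have "\<dots> = ?G i j + z * (\<Sum>k<n. ?G i k * ?G' k j)"
    using assms by (simp add: sum.distrib sum_distrib_left)
  finally have 1: "(\<Sum>k<n. \<Sum>l<n. ?G i k * H' k l * ?G' l j) = ?G i j + z * (\<Sum>k<n. ?G i k * ?G' k j)" .
  have "(\<Sum>k<n. \<Sum>l<n. ?G i k * H k l * ?G' l j) = (\<Sum>l<n. (\<Sum>k<n. ?G i k * H k l) * ?G' l j)"
    unfolding sum_distrib_right by (rule sum.swap)
  also have "\<dots> = (\<Sum>l<n. (if l = i then ?G' l j else 0) + z * (?G i l * ?G' l j))"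
    by (intro sum.cong refl) (subst resolvent_left[OF assms(1)]; (use assms in \<open>auto simp: algebra_simps\<close>))
  also have "\<dots> = ?G' i j + z * (\<Sum>k<n. ?G i k * ?G' k j)"
    using assms by (simp add: sum.distrib sum_distrib_left)
  finally have 2: "(\<Sum>k<n. \<Sum>l<n. ?G i k * H k l * ?G' l j) = ?G' i j + z * (\<Sum>k<n. ?G i k * ?G' k j)" .
  have "(\<Sum>k<n. \<Sum>l<n. ?G i k * (H' k l - H k l) * ?G' l j)
    = (\<Sum>k<n. \<Sum>l<n. ?G i k * H' k l * ?G' l j) - (\<Sum>k<n. \<Sum>l<n. ?G i k * H k l * ?G' l j)"
    unfolding sum_subtractf[symmetric] by (simp add: algebra_simps)
  then show ?thesis unfolding 1 2 by simp
qed

text \<open>The difference of the two resolvents has rank one, so its trace is an eigenvalue and is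
  controlled by the operator norm.\<close>

lemma resolvent_trace_rank_one:
  assumes H: "hermitian_on n H" and H': "hermitian_on n H'" and z: "Im z > 0"
    and pert: "\<And>i j. i < n \<Longrightarrow> j < n \<Longrightarrow> H' i j = H i j + c * p i * cnj (p j)"
  shows "norm (resolvent_trace n H z - resolvent_trace n H' z) \<le> 2 / Im z"
proof -
  let ?G = "resolvent n H z" and ?G' = "resolvent n H' z"
  define a where "a i = (\<Sum>k<n. ?G i k * p k)" for i
  define b where "b j = (\<Sum>l<n. cnj (p l) * ?G' l j)" for j
  have diff: "?G i j - ?G' i j = c * (a i * b j)" if ij: "i < n" "j < n" for i j
  proof -
    have "?G i j - ?G' i j = (\<Sum>k<n. \<Sum>l<n. ?G i k * (H' k l - H k l) * ?G' l j)"
      using z ij by (intro resolvent_identity H H') auto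
    also have "\<dots> = (\<Sum>k<n. \<Sum>l<n. c * ((?G i k * p k) * (cnj (p l) * ?G' l j)))"
      by (intro sum.cong) (auto simp: pert)
    also have "\<dots> = c * (a i * b j)"
    proof -
      have "a i * b j = (\<Sum>k<n. \<Sum>l<n. (?G i k * p k) * (cnj (p l) * ?G' l j))"
        unfolding a_def b_def by (rule sum_product)
      then show ?thesis by (simp only: sum_distrib_left)
    qed
    finally show ?thesis .
  qed
  define t where "t = resolvent_trace n H z - resolvent_trace n H' z"
  have t: "t = c * (\<Sum>i<n. a i * b i)"
    unfolding t_def resolvent_trace_def sum_subtractf[symmetric] by (simp add: diff sum_distrib_left)
  \<comment> \<open>The column factor \<open>a\<close> is itself the eigenvector, with the trace
    \<open>t\<close> as eigenvalue; applying both resolvents to \<open>a\<close> turns the operator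
    bounds into a bound on \<open>t\<close>.\<close>
  have eig: "(\<Sum>j<n. ?G i j * a j) - (\<Sum>j<n. ?G' i j * a j) = t * a i" if "i < n" for i
  proof -
    have "(\<Sum>j<n. ?G i j * a j) - (\<Sum>j<n. ?G' i j * a j) = (\<Sum>j<n. c * (a i * b j) * a j)"
      unfolding sum_subtractf[symmetric] left_diff_distrib[symmetric] using that by (simp add: diff)
    then show ?thesis unfolding t by (simp add: sum_distrib_left sum_distrib_right mult_ac)
  qed
  show ?thesis
  proof (cases "fun_norm n a = 0")
    case True
    then have "t = 0" unfolding t by (simp add: fun_norm_eq_0_iff)
    then show ?thesis unfolding t_def using z by simp
  next
    case False
    then have pos: "fun_norm n a > 0" using fun_norm_nonneg[of n a] by simp
    have "norm t * fun_norm n a = fun_norm n (\<lambda>i. t * a i)" by (simp add: fun_norm_mult)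
    also have "\<dots> = fun_norm n (\<lambda>i. (\<Sum>j<n. ?G i j * a j) - (\<Sum>j<n. ?G' i j * a j))"
      unfolding fun_norm_def by (intro L2_set_cong) (auto simp: eig)
    also have "\<dots> \<le> fun_norm n a / Im z + fun_norm n a / Im z"
      by (intro order_trans[OF fun_norm_diff_le] add_mono resolvent_apply_norm_le H H' z)
    also have "\<dots> = (2 / Im z) * fun_norm n a" by simp
    finally have "norm t \<le> 2 / Im z" using pos by (simp only: mult_le_cancel_right_pos)
    then show ?thesis unfolding t_def .
  qed
qed

text \<open>With u the change of column m and e the unit vector, the perturbation is e times
  conjugate u plus u times conjugate e; the diagonal entry fits because u vanishes at m.
  Polarization writes this as half the difference of the rank one forms of e + u and e - u, so the
  intermediate matrix \<open>H1\<close> splits the change into two rank one steps of cost 2 / Im z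
  each.\<close>

lemma resolvent_trace_row_change:
  assumes H: "hermitian_on n H" and H': "hermitian_on n H'" and z: "Im z > 0"
    and off: "\<And>i j. i < n \<Longrightarrow> j < n \<Longrightarrow> i \<noteq> m \<Longrightarrow> j \<noteq> m \<Longrightarrow> H' i j = H i j"
    and diag: "H' m m = H m m" and m: "m < n"
  shows "norm (resolvent_trace n H z - resolvent_trace n H' z) \<le> 4 / Im z"
proof -
  define u where "u i = H' i m - H i m" for i
  define e :: "nat \<Rightarrow> complex" where "e i = (if i = m then 1 else 0)" for i
  have um: "u m = 0" unfolding u_def diag by simp
  define H1 where "H1 i j = H i j + (1 / 2) * (e i + u i) * cnj (e j + u j)" for i j
  have H1: "hermitian_on n H1"
    unfolding hermitian_on_def
  proof (intro allI impI)
    fix i j assume "i < n" "j < n"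
    then have "H j i = cnj (H i j)" using H unfolding hermitian_on_def by blast
    then show "H1 j i = cnj (H1 i j)" unfolding H1_def by (simp add: mult_ac)
  qed
  have eq: "H' i j = H1 i j + (- 1 / 2) * (e i - u i) * cnj (e j - u j)" if ij: "i < n" "j < n" for i j
  proof -
    have polar: "h + 1 / 2 * (a + b) * (c + d) + - 1 / 2 * (a - b) * (c - d) = h + a * d + b * c"
      for h a b c d :: complex
      by (simp add: field_simps)
    have "H1 i j + (- 1 / 2) * (e i - u i) * cnj (e j - u j) = H i j + e i * cnj (u j) + u i * cnj (e j)"
      unfolding H1_def complex_cnj_add complex_cnj_diff by (rule polar)
    also have "\<dots> = H' i j"
    proof -
      have "H' j m = cnj (H' m j)" "H j m = cnj (H m j)"
        using H H' m ij unfolding hermitian_on_def by blast+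
      then have uj: "cnj (u j) = H' m j - H m j" unfolding u_def by simp
      show ?thesis
      proof (cases "i = m")
        case True
        then show ?thesis using um diag unfolding uj by (cases "j = m") (auto simp: e_def)
      next
        case False
        then show ?thesis using off[OF ij False] unfolding e_def u_def by (cases "j = m") auto
      qed
    qed
    finally show ?thesis ..
  qed
  have "norm (resolvent_trace n H z - resolvent_trace n H1 z) \<le> 2 / Im z"
    by (rule resolvent_trace_rank_one[OF H H1 z, of "1/2" "\<lambda>i. e i + u i"]) (simp add: H1_def)
  moreover have "norm (resolvent_trace n H1 z - resolvent_trace n H' z) \<le> 2 / Im z"
    by (rule resolvent_trace_rank_one[OF H1 H' z, of "-1/2" "\<lambda>i. e i - u i"]) (rule eq)
  ultimately show ?thesis
    using norm_triangle_ineq[of "resolvent_trace n H z - resolvent_trace n H1 z" "resolvent_trace n H1 z - resolvent_trace n H' z"]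
    by simp
qed

section \<open>The trace of the resolvent as a sum over eigenvalues\<close>

lemma shifted_mat_times:
  assumes "Ac \<in> carrier_mat n n" "\<And>i j. i < n \<Longrightarrow> j < n \<Longrightarrow> H i j = \<i> * (Ac $$ (i, j))"
  shows "shifted_mat n H z = \<i> \<cdot>\<^sub>m Ac - z \<cdot>\<^sub>m 1\<^sub>m n"
  using assms unfolding shifted_mat_def by (intro eq_matI) auto

text \<open>Row \<open>i\<close> of \<open>T * X = 1\<close> determines row \<open>i\<close> of \<open>X\<close> up to the diagonal from the later rows.\<close>

lemma upper_triangular_inverse_diag:
  fixes T X :: "'a::field mat"
  assumes T: "T \<in> carrier_mat n n" and X: "X \<in> carrier_mat n n" and "upper_triangular T"
    and TX: "T * X = 1\<^sub>m n" and "i < n"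
  shows "T $$ (i, i) * X $$ (i, i) = 1"
proof -
  have row: "T $$ (i, i) * X $$ (i, j) = (if i = j then 1 else 0)" if "i < n" "j \<le> i" for i j
    using that
  proof (induction "n - i" arbitrary: i j rule: less_induct)
    case less
    have "(\<Sum>k<n. T $$ (i, k) * X $$ (k, j)) = (T * X) $$ (i, j)"
      using less.prems T X by (auto simp: scalar_prod_def atLeast0LessThan intro!: sum.cong)
    also have "\<dots> = (if i = j then 1 else 0)" unfolding TX using less.prems by simp
    finally have eq: "(\<Sum>k<n. T $$ (i, k) * X $$ (k, j)) = (if i = j then 1 else 0)" .
    have "T $$ (i, k) * X $$ (k, j) = 0" if k: "k < n" "k \<noteq> i" for k
    proof (cases "k < i")
      case True
      then show ?thesis using upper_triangularD[OF \<open>upper_triangular T\<close> True] less.prems T by auto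
    next
      case False
      then have "i < k" using k by simp
      then have jk: "j \<le> k" "k \<noteq> j" and d: "n - k < n - i" using less.prems k by auto
      have "T $$ (k, k) * X $$ (k, k) = 1" "T $$ (k, k) * X $$ (k, j) = 0"
        using less.hyps[OF d k(1) le_refl] less.hyps[OF d k(1) jk(1)] jk by auto
      then have "X $$ (k, j) = 0" by auto
      then show ?thesis by simp
    qed
    then have "(\<Sum>k<n. T $$ (i, k) * X $$ (k, j)) = (\<Sum>k<n. if k = i then T $$ (i, i) * X $$ (i, j) else 0)"
      by (intro sum.cong) auto
    also have "\<dots> = T $$ (i, i) * X $$ (i, j)" using less.prems by simp
    finally show ?case using eq by simp
  qed
  show ?thesis using row[OF \<open>i < n\<close> le_refl] by simp
qed

lemma sum_diag_mult_commute:
  fixes X Y :: "'a::field mat"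
  assumes "X \<in> carrier_mat n n" "Y \<in> carrier_mat n n"
  shows "(\<Sum>i<n. (X * Y) $$ (i, i)) = (\<Sum>i<n. (Y * X) $$ (i, i))"
proof -
  have "(\<Sum>i<n. (X * Y) $$ (i, i)) = (\<Sum>i<n. \<Sum>k<n. X $$ (i, k) * Y $$ (k, i))"
    using assms by (auto simp: scalar_prod_def atLeast0LessThan intro!: sum.cong)
  also have "\<dots> = (\<Sum>k<n. \<Sum>i<n. Y $$ (k, i) * X $$ (i, k))"
    by (subst sum.swap) (simp add: mult.commute)
  also have "\<dots> = (\<Sum>i<n. (Y * X) $$ (i, i))"
    using assms by (auto simp: scalar_prod_def atLeast0LessThan intro!: sum.cong)
  finally show ?thesis .
qed

text \<open>Schur triangularization carries the shifted matrix to an upper triangular T with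
  diagonal entries \<open>\<i> * (es ! j) - z\<close>. The conjugated resolvent is a right inverse
  of T, so its diagonal consists of the reciprocals, and conjugation preserves the trace. The
  triangular form delivers eigenvalues with algebraic multiplicity, in the order of
  \<open>es\<close>.\<close>

lemma resolvent_trace_eigenvalues:
  fixes Ac :: "complex mat"
  assumes Ac: "Ac \<in> carrier_mat n n" and H: "\<And>i j. i < n \<Longrightarrow> j < n \<Longrightarrow> H i j = \<i> * (Ac $$ (i, j))"
    and herm: "hermitian_on n H" and es: "char_poly Ac = (\<Prod>e\<leftarrow>es. [:- e, 1:])"
    and z: "Im z > 0"
  shows "resolvent_trace n H z = (\<Sum>j<n. 1 / (\<i> * (es ! j) - z))"
proof -
  let ?G = "Matrix.mat n n (\<lambda>(i, j). resolvent n H z i j)"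
  obtain B P Q where BPQ: "schur_decomposition Ac es = (B, P, Q)" by (cases "schur_decomposition Ac es") auto
  from schur_decomposition[OF Ac es BPQ]
  have sim: "similar_mat_wit Ac B P Q" and ut: "upper_triangular B" and dB: "diag_mat B = es" by auto
  note w = similar_mat_witD2[OF Ac sim]
  define T where "T = \<i> \<cdot>\<^sub>m B - z \<cdot>\<^sub>m 1\<^sub>m n"
  have [simp]: "?G \<in> carrier_mat n n" "B \<in> carrier_mat n n" "P \<in> carrier_mat n n" "Q \<in> carrier_mat n n"
    using w by auto
  have dims [simp]: "dim_row B = n" "dim_col B = n" by (rule carrier_matD[OF w(5)])+
  have T: "T \<in> carrier_mat n n" unfolding T_def by (intro minus_carrier_mat) simp
  have utT: "upper_triangular T"
  proof (rule upper_triangularI)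
    fix i j assume "j < i" "i < dim_row T"
    then have "i < n" "j < n" using T by auto
    then show "T $$ (i, j) = 0" using upper_triangularD[OF ut \<open>j < i\<close>] \<open>j < i\<close> unfolding T_def by simp
  qed
  have SP: "shifted_mat n H z * P = P * T"
  proof -
    have "Ac * P = P * B * (Q * P)"
      unfolding w(3) by (rule assoc_mult_mat[OF mult_carrier_mat[OF w(6,5)] w(7,6)])
    then have AcP: "Ac * P = P * B"
      unfolding w(2) using right_mult_one_mat[OF mult_carrier_mat[OF w(6,5)]] by simp
    have "(\<i> \<cdot>\<^sub>m Ac) * P = P * (\<i> \<cdot>\<^sub>m B)"
      using AcP by (simp only: mult_smult_assoc_mat[OF Ac w(6)] mult_smult_distrib[OF w(6,5)])
    moreover have "(z \<cdot>\<^sub>m 1\<^sub>m n) * P = P * (z \<cdot>\<^sub>m 1\<^sub>m n)"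
      using w(6) by (simp only: mult_smult_assoc_mat[OF one_carrier_mat w(6)] mult_smult_distrib[OF w(6) one_carrier_mat]
          left_mult_one_mat right_mult_one_mat)
    moreover have "(\<i> \<cdot>\<^sub>m Ac - z \<cdot>\<^sub>m 1\<^sub>m n) * P = (\<i> \<cdot>\<^sub>m Ac) * P - (z \<cdot>\<^sub>m 1\<^sub>m n) * P"
      by (rule minus_mult_distrib_mat[OF smult_carrier_mat[OF Ac] smult_carrier_mat[OF one_carrier_mat] w(6)])
    moreover have "P * (\<i> \<cdot>\<^sub>m B - z \<cdot>\<^sub>m 1\<^sub>m n) = P * (\<i> \<cdot>\<^sub>m B) - P * (z \<cdot>\<^sub>m 1\<^sub>m n)"
      by (rule mult_minus_distrib_mat[OF w(6) smult_carrier_mat[OF w(5)] smult_carrier_mat[OF one_carrier_mat]])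
    moreover have "shifted_mat n H z = \<i> \<cdot>\<^sub>m Ac - z \<cdot>\<^sub>m 1\<^sub>m n"
      by (rule shifted_mat_times[OF Ac]) (rule H)
    ultimately show ?thesis
      unfolding T_def by simp
  qed
  have "T * (Q * ?G * P) = 1\<^sub>m n"
  proof -
    have "T = Q * P * T" using w T by simp
    also have "\<dots> = Q * (shifted_mat n H z * P)" unfolding SP using T by (simp add: assoc_mult_mat[of _ n n _ n _ n])
    finally have TQ: "T = Q * (shifted_mat n H z * P)" .
    have "T * (Q * ?G * P) = Q * shifted_mat n H z * (P * Q) * ?G * P"
      unfolding TQ by (simp add: assoc_mult_mat[of _ n n _ n _ n] mult_carrier_mat[of _ n n _ n])
    also have "\<dots> = Q * (shifted_mat n H z * ?G) * P"
      using w by (simp add: assoc_mult_mat[of _ n n _ n _ n] mult_carrier_mat[of _ n n _ n] right_mult_one_mat[of _ n n])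
    also have "\<dots> = 1\<^sub>m n"
      using resolvent_mat_inverse(1)[OF herm, of z] z w(2) by (simp add: right_mult_one_mat[OF w(7)])
    finally show ?thesis .
  qed
  then have diag: "T $$ (i, i) * (Q * ?G * P) $$ (i, i) = 1" if "i < n" for i
    using upper_triangular_inverse_diag[OF T _ utT _ that] by (simp add: mult_carrier_mat[of _ n n _ n])
  have Tii: "T $$ (i, i) = \<i> * (es ! i) - z" if "i < n" for i
    using that dB unfolding T_def by (auto simp: diag_mat_def)
  have "resolvent_trace n H z = (\<Sum>i<n. ?G $$ (i, i))" unfolding resolvent_trace_def by simp
  also have "\<dots> = (\<Sum>i<n. ((P * Q) * ?G) $$ (i, i))" using w by simp
  also have "\<dots> = (\<Sum>i<n. (P * (Q * ?G)) $$ (i, i))" by (simp add: assoc_mult_mat[of _ n n _ n _ n])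
  also have "\<dots> = (\<Sum>i<n. (Q * ?G * P) $$ (i, i))"
    by (rule sum_diag_mult_commute) (auto intro: mult_carrier_mat[of _ n n _ n])
  also have "\<dots> = (\<Sum>i<n. 1 / (\<i> * (es ! i) - z))"
  proof (rule sum.cong)
    fix i assume "i \<in> {..<n}"
    then have "T $$ (i, i) * (Q * ?G * P) $$ (i, i) = 1" using diag by simp
    then have "(Q * ?G * P) $$ (i, i) = 1 / (T $$ (i, i))" by (metis mult_zero_left nonzero_mult_div_cancel_left zero_neq_one)
    then show "(Q * ?G * P) $$ (i, i) = 1 / (\<i> * (es ! i) - z)" using Tii \<open>i \<in> {..<n}\<close> by simp
  qed simp
  finally show ?thesis .
qed

lemma hermitian_eigenvalue_real:
  assumes Ac: "Ac \<in> carrier_mat n n" and H: "\<And>i j. i < n \<Longrightarrow> j < n \<Longrightarrow> H i j = \<i> * (Ac $$ (i, j))"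
    and herm: "hermitian_on n H" and root: "poly (char_poly Ac) e = 0"
  shows "Im (\<i> * e) = 0"
proof (rule ccontr)
  assume "Im (\<i> * e) \<noteq> 0"
  from root obtain v where v: "v \<in> carrier_vec n" "v \<noteq> 0\<^sub>v n" "Ac *\<^sub>v v = e \<cdot>\<^sub>v v"
    using eigenvalue_root_char_poly[OF Ac] Ac unfolding eigenvalue_def eigenvector_def by auto
  have "(\<Sum>k<n. H i k * (v $ k)) - (\<i> * e) * (v $ i) = 0" if i: "i < n" for i
  proof -
    have "(\<Sum>k<n. Ac $$ (i, k) * (v $ k)) = (Ac *\<^sub>v v) $ i"
      using Ac v(1) i by (auto simp: scalar_prod_def atLeast0LessThan intro!: sum.cong)
    also have "\<dots> = e * (v $ i)" unfolding v(3) using v(1) i by simp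
    finally have "\<i> * (\<Sum>k<n. Ac $$ (i, k) * (v $ k)) = \<i> * (e * (v $ i))" by simp
    then show ?thesis using H i by (simp add: sum_distrib_left mult.assoc)
  qed
  from hermitian_shift_bound[OF herm this] have "\<bar>Im (\<i> * e)\<bar> * fun_norm n (\<lambda>k. v $ k) \<le> fun_norm n (\<lambda>_. 0)"
    by simp
  also have "fun_norm n (\<lambda>_. 0) = 0" by (simp add: fun_norm_eq_0_iff)
  finally have "fun_norm n (\<lambda>k. v $ k) = 0"
    using \<open>Im (\<i> * e) \<noteq> 0\<close> fun_norm_nonneg[of n "\<lambda>k. v $ k"] by (simp add: mult_le_0_iff)
  then have "v = 0\<^sub>v n" using v(1) by (intro eq_vecI) (auto simp: fun_norm_eq_0_iff)
  with v(2) show False by simp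
qed

text \<open>One list of linear factors of the characteristic polynomial serves twice: as the
  multiset of roots counted by \<open>skew_esd\<close> and as the enumeration in the resolvent
  trace. This ties counting and transform to the same points.\<close>

lemma skew_esd_resolvent:
  fixes A :: "real mat"
  assumes A: "A \<in> carrier_mat n n" and skew: "\<And>i j. i < n \<Longrightarrow> j < n \<Longrightarrow> A $$ (j, i) = - (A $$ (i, j))"
    and H: "\<And>i j. i < n \<Longrightarrow> j < n \<Longrightarrow> H i j = \<i> * of_real (A $$ (i, j))"
  shows "\<exists>lam. (\<forall>t. skew_esd A t = real (card {j. j < n \<and> lam j \<le> t}) / real n) \<and>
    (\<forall>z. Im z > 0 \<longrightarrow> empirical_stieltjes n lam z = resolvent_trace n H z / of_nat n)"
proof -
  define Ac where "Ac = map_mat complex_of_real A"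
  have Ac: "Ac \<in> carrier_mat n n" using A unfolding Ac_def by simp
  have HAc: "H i j = \<i> * (Ac $$ (i, j))" if "i < n" "j < n" for i j
    using H that A unfolding Ac_def by simp
  have herm: "hermitian_on n H"
    unfolding hermitian_on_def
  proof (intro allI impI)
    fix i j assume "i < n" "j < n"
    then show "H j i = cnj (H i j)" using H[of i j] H[of j i] skew[of i j] by simp
  qed
  obtain es where es: "char_poly Ac = (\<Prod>e\<leftarrow>es. [:- e, 1:])" and len: "length es = n"
    using char_poly_factorized[OF Ac] by auto
  define lam where "lam j = Re (\<i> * (es ! j))" for j
  have eig: "complex_eigenvalues A = mset es"
  proof -
    have "proots (\<Prod>e\<leftarrow>es. [:- e, 1:]) = mset es" for es :: "complex list"
    proof (induction es)
      case (Cons e es)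
      have "[:- e, 1:] \<noteq> 0" "(\<Prod>e\<leftarrow>es. [:- e, 1:]) \<noteq> 0" by (auto simp: prod_list_zero_iff)
      then have "proots ([:- e, 1:] * (\<Prod>e\<leftarrow>es. [:- e, 1:])) = proots [:- e, 1:] + proots (\<Prod>e\<leftarrow>es. [:- e, 1:])"
        by (intro proots_mult) auto
      then show ?case using Cons by simp
    qed simp
    then show ?thesis unfolding complex_eigenvalues_def Ac_def[symmetric] es .
  qed
  \<comment> \<open>Each \<open>\<i> * (es ! j)\<close> is real, so the \<open>Re\<close> in
    \<open>skew_esd\<close> loses nothing.\<close>
  have lam: "of_real (lam j) = \<i> * (es ! j)" if "j < n" for j
  proof -
    have "poly (char_poly Ac) (es ! j) = 0"
      unfolding es poly_prod_list prod_list_zero_iff using that len by (auto simp: image_iff intro!: bexI[of _ "es ! j"])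
    from hermitian_eigenvalue_real[OF Ac HAc herm this]
    show ?thesis unfolding lam_def by (simp add: complex_eq_iff)
  qed
  have "skew_esd A t = real (card {j. j < n \<and> lam j \<le> t}) / real n" for t
    using A unfolding skew_esd_def eig
    by (simp only: mset_filter[symmetric] size_mset length_filter_conv_card len lam_def carrier_matD)
  moreover have "empirical_stieltjes n lam z = resolvent_trace n H z / of_nat n" if "Im z > 0" for z
  proof -
    have "(\<Sum>j<n. 1 / (of_real (lam j) - z)) = (\<Sum>j<n. 1 / (\<i> * (es ! j) - z))"
      by (intro sum.cong refl) (simp only: lam lessThan_iff)
    also have "\<dots> = resolvent_trace n H z"
      by (rule resolvent_trace_eigenvalues[OF Ac HAc herm es that, symmetric])
    finally show ?thesis unfolding empirical_stieltjes_def by simp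
  qed
  ultimately show ?thesis by blast
qed

section \<open>Measurability of the resolvent\<close>

lemma det_measurable:
  fixes A :: "'b \<Rightarrow> complex mat"
  assumes "\<And>x. A x \<in> carrier_mat n n"
    and "\<And>i j. i < n \<Longrightarrow> j < n \<Longrightarrow> (\<lambda>x. A x $$ (i, j)) \<in> borel_measurable N"
  shows "(\<lambda>x. Determinant.det (A x)) \<in> borel_measurable N"
proof -
  have "(\<lambda>x. Determinant.det (A x)) = (\<lambda>x. \<Sum>p\<in>{p. p permutes {0..<n}}. signof p * (\<Prod>i = 0..<n. A x $$ (i, p i)))"
    using det_def'[OF assms(1)] by (intro ext)
  moreover have "(\<lambda>x. A x $$ (i, p i)) \<in> borel_measurable N" if "p permutes {0..<n}" "i \<in> {0..<n}" for p i
    using that permutes_in_image[OF that(1), of i] by (intro assms(2)) auto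
  ultimately show ?thesis
    by (auto intro!: borel_measurable_sum borel_measurable_times borel_measurable_prod)
qed

lemma resolvent_measurable:
  assumes "\<And>i j. i < n \<Longrightarrow> j < n \<Longrightarrow> (\<lambda>x. H x i j) \<in> borel_measurable N" and ij: "i < n" "j < n"
  shows "(\<lambda>x. resolvent n (H x) z i j) \<in> borel_measurable N"
proof -
  have S: "(\<lambda>x. shifted_mat n (H x) z $$ (k, l)) \<in> borel_measurable N" if "k < n" "l < n" for k l
    using assms(1)[OF that] that unfolding shifted_mat_def by auto
  have "(\<lambda>x. adj_mat (shifted_mat n (H x) z) $$ (i, j)) = (\<lambda>x. (-1) ^ (j + i) * Determinant.det (mat_delete (shifted_mat n (H x) z) j i))"
    using ij unfolding adj_mat_def cofactor_def shifted_mat_def by simp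
  moreover have "(\<lambda>x. Determinant.det (mat_delete (shifted_mat n (H x) z) j i)) \<in> borel_measurable N"
  proof (rule det_measurable[of _ "n - 1"])
    show "mat_delete (shifted_mat n (H x) z) j i \<in> carrier_mat (n - 1) (n - 1)" for x
      by (rule mat_delete_carrier) simp
    show "(\<lambda>x. mat_delete (shifted_mat n (H x) z) j i $$ (k, l)) \<in> borel_measurable N"
      if "k < n - 1" "l < n - 1" for k l
    proof -
      \<comment> \<open>Deleting row j and column i shifts the later indices by one.\<close>
      have "mat_delete (shifted_mat n (H x) z) j i $$ (k, l)
          = shifted_mat n (H x) z $$ (if k < j then k else Suc k, if l < i then l else Suc l)" for x
        using that by (simp add: mat_delete_def shifted_mat_def)
      then show ?thesis using that by (simp only:) (intro S; auto)
    qed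
  qed
  ultimately show ?thesis
    unfolding resolvent_def
    by (intro borel_measurable_divide det_measurable[of _ n] S) (simp_all add: borel_measurable_times)
qed

section \<open>Concentration for functions with bounded differences\<close>

lemma (in prob_space) norm_expectation_le:
  fixes f :: "'a \<Rightarrow> 'b::{banach, second_countable_topology}"
  assumes "integrable M f" and "\<And>x. x \<in> space M \<Longrightarrow> norm (f x) \<le> B"
  shows "norm (expectation f) \<le> B"
proof -
  have "norm (expectation f) \<le> expectation (\<lambda>x. norm (f x))" by (rule integral_norm_bound)
  also have "\<dots> \<le> expectation (\<lambda>x. B)"
    by (rule integral_mono) (use assms in auto)
  finally show ?thesis by (simp add: prob_space)
qed

text \<open>Hoeffding's lemma wants an interval containing the values. With other coordinates frozen
  only the oscillation is controlled, not the location of the range, so the interval is taken from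
  the infimum to the supremum.\<close>

lemma (in prob_space) hoeffding_lemma_oscillation:
  fixes f :: "'a \<Rightarrow> real"
  assumes meas: "random_variable borel f"
    and osc: "\<And>x y. x \<in> space M \<Longrightarrow> y \<in> space M \<Longrightarrow> \<bar>f x - f y\<bar> \<le> c" and l: "l > 0"
  shows "expectation (\<lambda>x. exp (l * (f x - expectation f))) \<le> exp (l\<^sup>2 * c\<^sup>2 / 8)"
proof -
  define a b where "a = Inf (f ` space M)" and "b = Sup (f ` space M)"
  obtain x0 where x0: "x0 \<in> space M" using not_empty by auto
  have bdd: "bdd_above (f ` space M)" "bdd_below (f ` space M)"
    using osc[OF _ x0] by (auto simp: abs_le_iff algebra_simps intro!: bdd_aboveI2[of _ _ "f x0 + c"] bdd_belowI2[of _ "f x0 - c"])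
  have ab: "a \<le> f x" "f x \<le> b" if "x \<in> space M" for x
    unfolding a_def b_def using that bdd by (auto intro: cInf_lower cSup_upper)
  have "b \<le> f x + c" if "x \<in> space M" for x
    unfolding b_def using not_empty osc[OF _ that] by (intro cSup_least) (auto simp: abs_le_iff algebra_simps)
  then have "b - c \<le> a"
    unfolding a_def using not_empty by (intro cInf_greatest) (auto simp: algebra_simps)
  moreover have "a \<le> b" using ab[OF x0] by linarith
  ultimately have sq: "(b - a)\<^sup>2 \<le> c\<^sup>2" by (intro power_mono) auto
  interpret interval_bounded_random_variable M f a b
    by unfold_locales (use meas ab in auto)
  have "expectation (\<lambda>x. exp (l * (f x - expectation f))) \<le> exp (l\<^sup>2 * (b - a)\<^sup>2 / 8)"
    using Hoeffdings_lemma_nn_integral[OF l] by (intro integral_real_bounded) auto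
  also have "\<dots> \<le> exp (l\<^sup>2 * c\<^sup>2 / 8)" using sq by (simp add: mult_left_mono divide_right_mono)
  finally show ?thesis .
qed

text \<open>McDiarmid's argument as an induction over blocks. Given the earlier blocks, the last one
  contributes a factor \<open>exp (l\<^sup>2 * c\<^sup>2 / 8)\<close> by Hoeffding's lemma;
  averaging over it leaves a function of the earlier blocks with the same mean, the same bound and
  the same differences.\<close>

lemma bounded_differences_mgf:
  fixes M :: "'i \<Rightarrow> 'b measure" and f :: "('i \<Rightarrow> 'b) \<Rightarrow> real" and J :: "nat \<Rightarrow> 'i set"
  assumes M: "\<And>i. prob_space (M i)" and fin: "\<And>k. finite (J k)" and disj: "disjoint_family J" and l: "l > 0"
    and "f \<in> borel_measurable (PiM (\<Union>k<m. J k) M)"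
    and "\<And>x. x \<in> space (PiM (\<Union>k<m. J k) M) \<Longrightarrow> \<bar>f x\<bar> \<le> B"
    and "\<And>k x y. k < m \<Longrightarrow> x \<in> space (PiM (\<Union>k<m. J k) M) \<Longrightarrow> y \<in> space (PiM (\<Union>k<m. J k) M) \<Longrightarrow>
      (\<And>i. i \<notin> J k \<Longrightarrow> x i = y i) \<Longrightarrow> \<bar>f x - f y\<bar> \<le> c"
  shows "(\<integral>x. exp (l * (f x - (\<integral>x. f x \<partial>PiM (\<Union>k<m. J k) M))) \<partial>PiM (\<Union>k<m. J k) M) \<le> exp (m * (l\<^sup>2 * c\<^sup>2 / 8))"
  using assms(5-7)
proof (induction m arbitrary: f)
  case 0
  \<comment> \<open>A product over no coordinates is a point mass at the everywhere undefined
    function, so \<open>f\<close> equals its mean.\<close>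
  have "(\<integral>x. g x \<partial>PiM {} M) = g (\<lambda>_. undefined)" for g :: "('i \<Rightarrow> 'b) \<Rightarrow> real"
    by (simp add: PiM_empty lebesgue_integral_count_space_finite)
  then show ?case by simp
next
  case (Suc m)
  define I where "I = (\<Union>k<m. J k)"
  define K where "K = J m"
  have finI: "finite I" and finK: "finite K" unfolding I_def K_def using fin by auto
  have "J k \<inter> J m = {}" if "k < m" for k
    using disjoint_family_onD[OF disj, of k m] that by simp
  then have IK: "I \<inter> K = {}" unfolding I_def K_def by blast
  have un: "(\<Union>k<Suc m. J k) = I \<union> K" unfolding I_def K_def by (auto simp: less_Suc_eq)
  interpret S: product_sigma_finite M
    unfolding product_sigma_finite_def by (intro allI prob_space_imp_sigma_finite M)
  interpret PI: prob_space "PiM I M" by (intro prob_space_PiM M)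
  interpret PK: prob_space "PiM K M" by (intro prob_space_PiM M)
  interpret PIK: prob_space "PiM (I \<union> K) M" by (intro prob_space_PiM M)
  note f = Suc.prems[unfolded un]
  have mg: "merge I K (x, y) \<in> space (PiM (I \<union> K) M)" if "x \<in> space (PiM I M)" "y \<in> space (PiM K M)" for x y
    using that by (auto simp: space_PiM PiE_iff merge_def extensional_def)
  have fmeas: "(\<lambda>(x, y). f (merge I K (x, y))) \<in> borel_measurable (PiM I M \<Otimes>\<^sub>M PiM K M)"
    using measurable_comp[OF measurable_merge f(1)] by (simp add: comp_def case_prod_unfold)
  have fx: "(\<lambda>y. f (merge I K (x, y))) \<in> borel_measurable (PiM K M)" if "x \<in> space (PiM I M)" for x
    using measurable_Pair2[OF fmeas that] by simp
  \<comment> \<open>The conditional expectation of \<open>f\<close> given the first m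
    blocks.\<close>
  define g where "g x = (\<integral>y. f (merge I K (x, y)) \<partial>PiM K M)" for x
  have intf: "integrable (PiM (I \<union> K) M) f"
    by (rule PIK.integrable_const_bound[of _ B]) (use f in auto)
  have intfx: "integrable (PiM K M) (\<lambda>y. f (merge I K (x, y)))" if "x \<in> space (PiM I M)" for x
    by (rule PK.integrable_const_bound[of _ B]) (use f(2) mg that fx in auto)
  have gmeas: "g \<in> borel_measurable (PiM I M)"
    unfolding g_def by (rule PK.borel_measurable_lebesgue_integral[OF fmeas])
  have gB: "\<bar>g x\<bar> \<le> B" if x: "x \<in> space (PiM I M)" for x
    using PK.norm_expectation_le[OF intfx[OF x], of B] f(2) mg[OF x] unfolding g_def by simp
  have gc: "\<bar>g x - g x'\<bar> \<le> c"
    if k: "k < m" and x: "x \<in> space (PiM I M)" "x' \<in> space (PiM I M)" and eq: "\<And>i. i \<notin> J k \<Longrightarrow> x i = x' i" for k x x'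
  proof -
    have "g x - g x' = (\<integral>y. f (merge I K (x, y)) - f (merge I K (x', y)) \<partial>PiM K M)"
      unfolding g_def using intfx x by simp
    also have "\<bar>\<dots>\<bar> \<le> (\<integral>y. \<bar>f (merge I K (x, y)) - f (merge I K (x', y))\<bar> \<partial>PiM K M)" by (rule integral_abs_bound)
    also have "\<dots> \<le> (\<integral>y. c \<partial>PiM K M)"
    proof (rule integral_mono)
      show "integrable (PiM K M) (\<lambda>y. \<bar>f (merge I K (x, y)) - f (merge I K (x', y))\<bar>)"
        using intfx x by auto
      fix y assume y: "y \<in> space (PiM K M)"
      show "\<bar>f (merge I K (x, y)) - f (merge I K (x', y))\<bar> \<le> c"
        using k eq by (intro f(3)[of k] mg x y) (auto simp: merge_def)
    qed simp
    finally show ?thesis by (simp add: PK.prob_space)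
  qed
  let ?E = "\<integral>x. f x \<partial>PiM (I \<union> K) M"
  have Eg: "?E = (\<integral>x. g x \<partial>PiM I M)"
    unfolding g_def by (rule S.product_integral_fold[OF IK finI finK intf])
  have Eb: "\<bar>?E\<bar> \<le> B"
    using PIK.norm_expectation_le[OF intf, of B] f(2) by simp
  have expb: "\<bar>exp (l * (u - ?E))\<bar> \<le> exp (l * (2 * B))" if "\<bar>u\<bar> \<le> B" for u
    using that Eb l by (auto intro!: mult_left_mono)
  have intexp: "integrable (PiM (I \<union> K) M) (\<lambda>x. exp (l * (f x - ?E)))"
    by (rule PIK.integrable_const_bound[of _ "exp (l * (2 * B))"]) (use f expb in auto)
  have intexpg: "integrable (PiM I M) (\<lambda>x. exp (l * (g x - ?E)))"
    by (rule PI.integrable_const_bound[of _ "exp (l * (2 * B))"]) (use gmeas gB expb in auto)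
  have inner: "(\<integral>y. exp (l * (f (merge I K (x, y)) - ?E)) \<partial>PiM K M) \<le> exp (l * (g x - ?E)) * exp (l\<^sup>2 * c\<^sup>2 / 8)"
    if x: "x \<in> space (PiM I M)" for x
  proof -
    have "exp (l * (f (merge I K (x, y)) - ?E)) = exp (l * (g x - ?E)) * exp (l * (f (merge I K (x, y)) - g x))" for y
      by (simp add: exp_add[symmetric] algebra_simps)
    then have "(\<integral>y. exp (l * (f (merge I K (x, y)) - ?E)) \<partial>PiM K M)
        = exp (l * (g x - ?E)) * (\<integral>y. exp (l * (f (merge I K (x, y)) - g x)) \<partial>PiM K M)" by simp
    also have "\<dots> \<le> exp (l * (g x - ?E)) * exp (l\<^sup>2 * c\<^sup>2 / 8)"
    proof (rule mult_left_mono)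
      show "(\<integral>y. exp (l * (f (merge I K (x, y)) - g x)) \<partial>PiM K M) \<le> exp (l\<^sup>2 * c\<^sup>2 / 8)"
        unfolding g_def
      proof (rule PK.hoeffding_lemma_oscillation[OF fx[OF x] _ l])
        \<comment> \<open>A merge is undefined outside both index sets, so two merges with the same
          \<open>x\<close> agree off the last block.\<close>
        fix y y' assume y: "y \<in> space (PiM K M)" "y' \<in> space (PiM K M)"
        show "\<bar>f (merge I K (x, y)) - f (merge I K (x, y'))\<bar> \<le> c"
          using y by (intro f(3)[of m] mg x) (auto simp: merge_def K_def space_PiM PiE_iff extensional_def)
      qed
    qed simp
    finally show ?thesis .
  qed
  have "(\<integral>x. exp (l * (f x - ?E)) \<partial>PiM (I \<union> K) M)
      = (\<integral>x. (\<integral>y. exp (l * (f (merge I K (x, y)) - ?E)) \<partial>PiM K M) \<partial>PiM I M)"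
    by (rule S.product_integral_fold[OF IK finI finK intexp])
  also have "\<dots> \<le> (\<integral>x. exp (l * (g x - ?E)) * exp (l\<^sup>2 * c\<^sup>2 / 8) \<partial>PiM I M)"
  proof (rule integral_mono_AE')
    show "AE x in PiM I M. (\<integral>y. exp (l * (f (merge I K (x, y)) - ?E)) \<partial>PiM K M) \<le> exp (l * (g x - ?E)) * exp (l\<^sup>2 * c\<^sup>2 / 8)"
      using inner by auto
  qed (use intexpg in auto)
  also have "\<dots> = (\<integral>x. exp (l * (g x - ?E)) \<partial>PiM I M) * exp (l\<^sup>2 * c\<^sup>2 / 8)" by simp
  also have "\<dots> \<le> exp (m * (l\<^sup>2 * c\<^sup>2 / 8)) * exp (l\<^sup>2 * c\<^sup>2 / 8)"
    unfolding Eg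
  proof (rule mult_right_mono)
    show "(\<integral>x. exp (l * (g x - (\<integral>x. g x \<partial>PiM I M))) \<partial>PiM I M) \<le> exp (m * (l\<^sup>2 * c\<^sup>2 / 8))"
      unfolding I_def by (rule Suc.IH) (use gmeas gB gc in \<open>auto simp: I_def\<close>)
  qed simp
  also have "\<dots> = exp (real (Suc m) * (l\<^sup>2 * c\<^sup>2 / 8))"
    by (simp add: exp_add[symmetric] algebra_simps)
  finally show ?case unfolding un .
qed

text \<open>The constant is 4^4: raise y / 4 \<le> exp (y / 4) to the fourth power.\<close>

lemma power4_le_exp: "(x::real) ^ 4 \<le> 256 * (exp x + exp (- x))"
proof -
  have pos: "y ^ 4 \<le> 256 * exp y" if "y \<ge> 0" for y :: real
  proof -
    have "y / 4 \<le> exp (y / 4)" using exp_ge_add_one_self[of "y / 4"] by linarith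
    then have "(y / 4) ^ 4 \<le> exp (y / 4) ^ 4" using that by (intro power_mono) auto
    also have "\<dots> = exp y" by (simp add: exp_of_nat_mult[symmetric])
    finally show ?thesis by (simp add: power_divide)
  qed
  show ?thesis
  proof (cases "x \<ge> 0")
    case True
    then show ?thesis using pos[of x] by (simp add: add_increasing2)
  next
    case False
    then have "(- x) ^ 4 \<le> 256 * exp (- x)" by (intro pos) simp
    moreover have "(- x) ^ 4 = x ^ 4" by (rule power_minus_even) simp
    ultimately show ?thesis by (simp add: add_increasing)
  qed
qed

lemma bounded_differences_fourth_moment:
  fixes M :: "'i \<Rightarrow> 'b measure" and f :: "('i \<Rightarrow> 'b) \<Rightarrow> real" and J :: "nat \<Rightarrow> 'i set"
  assumes M: "\<And>i. prob_space (M i)" and fin: "\<And>k. finite (J k)" and disj: "disjoint_family J"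
    and m: "m > 0" and c: "c > 0"
    and f: "f \<in> borel_measurable (PiM (\<Union>k<m. J k) M)"
      "\<And>x. x \<in> space (PiM (\<Union>k<m. J k) M) \<Longrightarrow> \<bar>f x\<bar> \<le> B"
      "\<And>k x y. k < m \<Longrightarrow> x \<in> space (PiM (\<Union>k<m. J k) M) \<Longrightarrow> y \<in> space (PiM (\<Union>k<m. J k) M) \<Longrightarrow>
      (\<And>i. i \<notin> J k \<Longrightarrow> x i = y i) \<Longrightarrow> \<bar>f x - f y\<bar> \<le> c"
  shows "(\<integral>x. (f x - (\<integral>x. f x \<partial>PiM (\<Union>k<m. J k) M)) ^ 4 \<partial>PiM (\<Union>k<m. J k) M) \<le> 1536 * (real m)\<^sup>2 * c ^ 4"
proof -
  let ?P = "PiM (\<Union>k<m. J k) M"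
  interpret P: prob_space ?P by (intro prob_space_PiM M)
  define E where "E = (\<integral>x. f x \<partial>?P)"
  \<comment> \<open>The scale of the fluctuations: with this \<open>l\<close> the exponent m l^2 c^2
    / 8 becomes 1 / 8, independent of m and c.\<close>
  define l where "l = 1 / (sqrt (real m) * c)"
  have l: "l > 0" unfolding l_def using m c by simp
  have lc: "real m * (l\<^sup>2 * c\<^sup>2 / 8) = 1 / 8"
    unfolding l_def using m c by (simp add: power_divide power_mult_distrib)
  have intf: "integrable ?P f" by (rule P.integrable_const_bound[of _ B]) (use f in auto)
  have Eb: "\<bar>E\<bar> \<le> B"
    using P.norm_expectation_le[OF intf, of B] f(2) unfolding E_def by simp
  have fE: "\<bar>f x - E\<bar> \<le> 2 * B" if "x \<in> space ?P" for x using f(2)[OF that] Eb by linarith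
  have expb: "\<bar>exp (l * (f x - E))\<bar> \<le> exp (l * (2 * B))" "\<bar>exp (- (l * (f x - E)))\<bar> \<le> exp (l * (2 * B))"
    if "x \<in> space ?P" for x
  proof -
    have "l * \<bar>f x - E\<bar> \<le> l * (2 * B)" using fE[OF that] l by (intro mult_left_mono) auto
    then have "\<bar>l * (f x - E)\<bar> \<le> l * (2 * B)" using l by (simp add: abs_mult)
    then show "\<bar>exp (l * (f x - E))\<bar> \<le> exp (l * (2 * B))" "\<bar>exp (- (l * (f x - E)))\<bar> \<le> exp (l * (2 * B))"
      by (simp_all only: abs_exp_cancel exp_le_cancel_iff abs_le_iff)
  qed
  have int: "integrable ?P (\<lambda>x. exp (l * (f x - E)))" "integrable ?P (\<lambda>x. exp (- (l * (f x - E))))"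
  proof -
    show "integrable ?P (\<lambda>x. exp (l * (f x - E)))"
    proof (rule P.integrable_const_bound)
      show "AE x in ?P. norm (exp (l * (f x - E))) \<le> exp (l * (2 * B))"
        unfolding real_norm_def by (rule AE_I2) (rule expb(1))
    qed (use f(1) in simp)
    show "integrable ?P (\<lambda>x. exp (- (l * (f x - E))))"
    proof (rule P.integrable_const_bound)
      show "AE x in ?P. norm (exp (- (l * (f x - E)))) \<le> exp (l * (2 * B))"
        unfolding real_norm_def by (rule AE_I2) (rule expb(2))
    qed (use f(1) in simp)
  qed
  have e1: "(\<integral>x. exp (l * (f x - E)) \<partial>?P) \<le> exp (1 / 8)"
    unfolding E_def lc[symmetric] by (rule bounded_differences_mgf[OF M fin disj l f])
  have "(\<integral>x. exp (l * (- f x - (\<integral>x. - f x \<partial>?P))) \<partial>?P) \<le> exp (m * (l\<^sup>2 * c\<^sup>2 / 8))"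
    by (rule bounded_differences_mgf[OF M fin disj l, where B = B])
      (use f in \<open>auto simp: abs_minus_commute\<close>)
  moreover have "exp (l * (- f x - (\<integral>x. - f x \<partial>?P))) = exp (- (l * (f x - E)))" for x
    unfolding E_def by (simp add: algebra_simps)
  ultimately have e2: "(\<integral>x. exp (- (l * (f x - E))) \<partial>?P) \<le> exp (1 / 8)" unfolding lc by simp
  have "l ^ 4 * (\<integral>x. (f x - E) ^ 4 \<partial>?P) = (\<integral>x. (l * (f x - E)) ^ 4 \<partial>?P)"
    by (simp add: power_mult_distrib)
  also have "\<dots> \<le> (\<integral>x. 256 * (exp (l * (f x - E)) + exp (- (l * (f x - E)))) \<partial>?P)"
    by (rule integral_mono_AE') (use int power4_le_exp in auto)
  also have "\<dots> \<le> 256 * (exp (1 / 8) + exp (1 / 8))"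
    using int e1 e2 by simp
  \<comment> \<open>1536 = 256 (3 + 3), from exp (1 / 8) \<le> exp 1 \<le> 3.\<close>
  also have "\<dots> \<le> 1536"
    using exp_le order_trans[of "exp (1 / 8 :: real)" "exp 1" 3] by simp
  finally have le: "l ^ 4 * (\<integral>x. (f x - E) ^ 4 \<partial>?P) \<le> 1536" .
  have "l ^ 4 * ((real m)\<^sup>2 * c ^ 4) = 1"
  proof -
    have "sqrt (real m) ^ 4 = ((sqrt (real m))\<^sup>2)\<^sup>2" by (simp only: power_mult[symmetric]) simp
    then have "sqrt (real m) ^ 4 = (real m)\<^sup>2" by simp
    then show ?thesis unfolding l_def using m c by (simp add: power_divide power_mult_distrib)
  qed
  then have "(\<integral>x. (f x - E) ^ 4 \<partial>?P) = ((real m)\<^sup>2 * c ^ 4) * (l ^ 4 * (\<integral>x. (f x - E) ^ 4 \<partial>?P))"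
    by (simp only: mult.assoc[symmetric] mult.commute[of "(real m)\<^sup>2 * c ^ 4" "l ^ 4"])
  also have "\<dots> \<le> ((real m)\<^sup>2 * c ^ 4) * 1536" using le c by (intro mult_left_mono) auto
  finally show ?thesis unfolding E_def by (simp add: mult_ac)
qed

text \<open>The series of the fourth powers has finite expectation, hence is almost surely finite,
  hence its terms tend to 0.\<close>

lemma (in prob_space) AE_tendsto_0_fourth_moment:
  fixes X :: "nat \<Rightarrow> 'a \<Rightarrow> complex"
  assumes int: "\<And>n. integrable M (\<lambda>\<omega>. norm (X n \<omega>) ^ 4)"
    and le: "\<And>n. expectation (\<lambda>\<omega>. norm (X n \<omega>) ^ 4) \<le> b n" and sum: "summable b"
  shows "AE \<omega> in M. (\<lambda>n. X n \<omega>) \<longlonglongrightarrow> 0"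
proof -
  have b0: "b n \<ge> 0" for n using order_trans[OF integral_nonneg_AE le[of n]] by simp
  have each: "(\<integral>\<^sup>+\<omega>. ennreal (norm (X n \<omega>) ^ 4) \<partial>M) \<le> ennreal (b n)" for n
  proof -
    have "(\<integral>\<^sup>+\<omega>. ennreal (norm (X n \<omega>) ^ 4) \<partial>M) = ennreal (expectation (\<lambda>\<omega>. norm (X n \<omega>) ^ 4))"
      by (rule nn_integral_eq_integral[OF int]) simp
    then show ?thesis using le[of n] by (simp only: ennreal_leI)
  qed
  have meas: "(\<lambda>\<omega>. ennreal (norm (X n \<omega>) ^ 4)) \<in> borel_measurable M" for n
    by (rule measurable_compose[OF borel_measurable_integrable[OF int] measurable_ennreal])
  have swap: "(\<integral>\<^sup>+\<omega>. (\<Sum>n. ennreal (norm (X n \<omega>) ^ 4)) \<partial>M) = (\<Sum>n. \<integral>\<^sup>+\<omega>. ennreal (norm (X n \<omega>) ^ 4) \<partial>M)"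
    by (intro nn_integral_suminf meas)
  have total: "(\<Sum>n. ennreal (b n)) = ennreal (\<Sum>n. b n)"
    by (rule suminf_ennreal2[OF b0 sum])
  have "(\<Sum>n. \<integral>\<^sup>+\<omega>. ennreal (norm (X n \<omega>) ^ 4) \<partial>M) \<le> (\<Sum>n. ennreal (b n))"
    by (intro suminf_le each summableI)
  then have "(\<integral>\<^sup>+\<omega>. (\<Sum>n. ennreal (norm (X n \<omega>) ^ 4)) \<partial>M) \<le> ennreal (\<Sum>n. b n)"
    unfolding swap total .
  then have "(\<integral>\<^sup>+\<omega>. (\<Sum>n. ennreal (norm (X n \<omega>) ^ 4)) \<partial>M) \<noteq> \<infinity>"
    by (rule neq_top_trans[OF ennreal_neq_top, unfolded infinity_ennreal_def[symmetric]])
  then have "AE \<omega> in M. (\<Sum>n. ennreal (norm (X n \<omega>) ^ 4)) \<noteq> \<infinity>"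
    by (intro nn_integral_PInf_AE borel_measurable_suminf_order meas)
  then show ?thesis
  proof eventually_elim
    case (elim \<omega>)
    then have "summable (\<lambda>n. norm (X n \<omega>) ^ 4)"
      by (intro summable_suminf_not_top) auto
    then have "(\<lambda>n. norm (X n \<omega>) ^ 4) \<longlonglongrightarrow> 0" by (rule summable_LIMSEQ_zero)
    then show ?case by (simp add: power_tendsto_0_iff tendsto_norm_zero_iff)
  qed
qed

section \<open>Dependence of the resolvent on a single entry\<close>

lemma double_sum_delta:
  fixes F :: "nat \<Rightarrow> nat \<Rightarrow> 'a::comm_monoid_add"
  assumes "i < n" "j < n"
  shows "(\<Sum>k<n. \<Sum>l<n. if k = i \<and> l = j then F k l else 0) = F i j"
proof -
  have "(\<Sum>l<n. if k = i \<and> l = j then F k l else 0) = (if k = i then F i j else 0)" for k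
    using assms by (cases "k = i") simp_all
  then show ?thesis using assms by simp
qed

text \<open>The resolvent identity for a perturbation with two nonzero entries. It is exact, with
  the perturbed resolvent still on the right; inserting it into itself produces the second-order
  expansion.\<close>

lemma resolvent_entry_change:
  assumes H0: "hermitian_on n H0" and H: "hermitian_on n H" and z: "Im z \<noteq> 0"
    and ij: "i < n" "j < n" "i \<noteq> j"
    and diff: "\<And>k l. k < n \<Longrightarrow> l < n \<Longrightarrow> H k l - H0 k l = (if k = i \<and> l = j then h else if k = j \<and> l = i then - h else 0)"
    and ab: "a < n" "b < n"
  shows "resolvent n H z a b = resolvent n H0 z a b
    - h * (resolvent n H0 z a i * resolvent n H z j b - resolvent n H0 z a j * resolvent n H z i b)"
proof -
  let ?G = "resolvent n H z" and ?R = "resolvent n H0 z"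
  have "?R a b - ?G a b = (\<Sum>k<n. \<Sum>l<n. ?R a k * (H k l - H0 k l) * ?G l b)"
    by (rule resolvent_identity[OF H0 H z ab])
  also have "\<dots> = (\<Sum>k<n. \<Sum>l<n. (if k = i \<and> l = j then ?R a k * h * ?G l b else 0)
      + (if k = j \<and> l = i then - (?R a k * h * ?G l b) else 0))"
    using ij by (intro sum.cong refl) (auto simp: diff)
  also have "\<dots> = ?R a i * h * ?G j b + - (?R a j * h * ?G i b)"
    unfolding sum.distrib double_sum_delta[OF ij(1,2)] double_sum_delta[OF ij(2,1)] ..
  finally show ?thesis by (simp add: algebra_simps)
qed

text \<open>Putting h at (i, j) and - h at (j, i) changes \<open>G j i\<close> to first order by - h
  times this quantity. The first term is a square and not \<open>G j i * G i j\<close>, so this is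
  not the genuine two by two minor.\<close>

definition resolvent_minor :: "(nat \<Rightarrow> nat \<Rightarrow> complex) \<Rightarrow> nat \<Rightarrow> nat \<Rightarrow> complex" where
  "resolvent_minor G i j = (G j i)\<^sup>2 - G j j * G i i"

text \<open>Second-order expansion in the entry \<open>h = \<i> * t\<close> around \<open>t = 0\<close>: the main term is a polynomial in
  \<open>t\<close> whose coefficients do not depend on \<open>t\<close>.\<close>

lemma resolvent_entry_expansion:
  assumes H0: "hermitian_on n H0" and H: "hermitian_on n H" and z: "Im z > 0"
    and ij: "i < n" "j < n" "i \<noteq> j"
    and diff: "\<And>k l. k < n \<Longrightarrow> l < n \<Longrightarrow> H k l - H0 k l
      = (if k = i \<and> l = j then \<i> * of_real t else if k = j \<and> l = i then - (\<i> * of_real t) else 0)"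
  shows "norm (\<i> * of_real t * resolvent n H z j i - resolvent_minor (resolvent n H z) i j / of_nat n
      - (\<i> * of_real t * resolvent n H0 z j i + of_real (t\<^sup>2 - 1 / n) * resolvent_minor (resolvent n H0 z) i j))
    \<le> (8 / (Im z)\<^sup>2 + 8 / (Im z) ^ 3) * (t\<^sup>2 * min 1 \<bar>t\<bar> + \<bar>t\<bar> / n)"
proof -
  let ?G = "resolvent n H z" and ?R = "resolvent n H0 z"
  define y where "y = Im z"
  have y: "y > 0" unfolding y_def by (rule z)
  have z0: "Im z \<noteq> 0" using z by simp
  have nG: "norm (?G a b) \<le> 1 / y" and nG0: "norm (?R a b) \<le> 1 / y" if "a < n" "b < n" for a b
    unfolding y_def by (rule resolvent_entry_norm_le[OF H z that(2,1)])
      (rule resolvent_entry_norm_le[OF H0 z that(2,1)])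
  have change: "?G a b = ?R a b - \<i> * of_real t * (?R a i * ?G j b - ?R a j * ?G i b)" if "a < n" "b < n" for a b
    by (rule resolvent_entry_change[OF H0 H z0 ij diff that])
  have d1: "norm (?G a b - ?R a b) \<le> 2 / y\<^sup>2 * \<bar>t\<bar>" if "a < n" "b < n" for a b
  proof -
    have "norm (?R a i * ?G j b - ?R a j * ?G i b) \<le> 1 / y * (1 / y) + 1 / y * (1 / y)"
      by (intro order_trans[OF norm_triangle_ineq4] add_mono)
        (unfold norm_mult, (intro mult_mono nG nG0 that ij; use y in simp)+)
    then have "\<bar>t\<bar> * norm (?R a i * ?G j b - ?R a j * ?G i b) \<le> \<bar>t\<bar> * (2 / y\<^sup>2)"
      by (intro mult_left_mono) (simp_all add: power2_eq_square)
    moreover have "?G a b - ?R a b = - (\<i> * of_real t * (?R a i * ?G j b - ?R a j * ?G i b))"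
      using change[OF that] by simp
    ultimately show ?thesis by (simp add: norm_mult mult.commute)
  qed
  have d2: "norm (?G a b - ?R a b) \<le> 2 / y" if "a < n" "b < n" for a b
    using norm_triangle_ineq4[of "?G a b" "?R a b"] nG[OF that] nG0[OF that] by simp
  \<comment> \<open>One constant for both regimes: the Lipschitz bound \<open>d1\<close> for |t|
    \<le> 1, the trivial bound \<open>d2\<close> beyond. The resulting factor
    \<open>min 1 \<bar>t\<bar>\<close> is what lets second moments suffice.\<close>
  define K where "K = 2 / y + 2 / y\<^sup>2"
  have K: "K > 0" unfolding K_def using y by (simp add: add_pos_pos)
  have d: "norm (?G a b - ?R a b) \<le> K * min 1 \<bar>t\<bar>" if "a < n" "b < n" for a b
  proof (cases "\<bar>t\<bar> \<le> 1")
    case True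
    have "2 / y\<^sup>2 * \<bar>t\<bar> \<le> K * \<bar>t\<bar>" unfolding K_def using y by (intro mult_right_mono) auto
    then have "norm (?G a b - ?R a b) \<le> K * \<bar>t\<bar>" by (rule order_trans[OF d1[OF that]])
    then show ?thesis using True by (simp only: min_absorb2)
  next
    case False
    have "2 / y \<le> K" unfolding K_def by simp
    then have "norm (?G a b - ?R a b) \<le> K" by (rule order_trans[OF d2[OF that]])
    moreover have "min 1 \<bar>t\<bar> = 1" using False by simp
    ultimately show ?thesis by simp
  qed
  define Q0 where "Q0 = resolvent_minor ?R i j"
  define Q where "Q = resolvent_minor ?G i j"
  define Q1 where "Q1 = ?R j i * ?G j i - ?R j j * ?G i i"
  have Gji: "?G j i = ?R j i - \<i> * of_real t * Q1"
    unfolding Q1_def by (rule change[OF ij(2,1)])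
  have "\<i> * of_real t * ?G j i = \<i> * of_real t * ?R j i + of_real (t\<^sup>2) * Q1"
    by (subst Gji) (simp add: algebra_simps power2_eq_square)
  \<comment> \<open>Subtracting 1 / n from t^2 centres the main term: in the application t has mean
    0 and t^2 has mean 1 / n.\<close>
  then have split: "\<i> * of_real t * ?G j i - Q / of_nat n - (\<i> * of_real t * ?R j i + of_real (t\<^sup>2 - 1 / n) * Q0)
      = of_real (t\<^sup>2) * (Q1 - Q0) - (Q - Q0) / of_nat n"
    by (simp add: algebra_simps diff_divide_distrib)
  have two: "norm (p * (u - u') - q * (v - v')) \<le> 2 / y * D"
    if "norm p \<le> 1 / y" "norm q \<le> 1 / y" "norm (u - u') \<le> D" "norm (v - v') \<le> D" for p q u u' v v' :: complex and D
  proof -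
    have "D \<ge> 0" using order_trans[OF norm_ge_zero that(3)] .
    then have "norm (p * (u - u')) \<le> 1 / y * D" "norm (q * (v - v')) \<le> 1 / y * D"
      unfolding norm_mult using that y by (intro mult_mono; simp)+
    then show ?thesis using norm_triangle_ineq4[of "p * (u - u')" "q * (v - v')"] by simp
  qed
  have Q10: "norm (Q1 - Q0) \<le> 2 / y * (K * min 1 \<bar>t\<bar>)"
  proof -
    have "Q1 - Q0 = ?R j i * (?G j i - ?R j i) - ?R j j * (?G i i - ?R i i)"
      unfolding Q1_def Q0_def resolvent_minor_def by (simp add: algebra_simps power2_eq_square)
    then show ?thesis using two[OF nG0 nG0 d d] ij by simp
  qed
  have Q20: "norm (Q - Q0) \<le> 4 / y * (2 / y\<^sup>2 * \<bar>t\<bar>)"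
  proof -
    have e: "Q - Q0 = (?G j i * (?G j i - ?R j i) - ?G j j * (?G i i - ?R i i))
        + (?R j i * (?G j i - ?R j i) - ?R i i * (?G j j - ?R j j))"
      unfolding Q_def Q0_def resolvent_minor_def by (simp add: algebra_simps power2_eq_square)
    have "norm (?G j i * (?G j i - ?R j i) - ?G j j * (?G i i - ?R i i)) \<le> 2 / y * (2 / y\<^sup>2 * \<bar>t\<bar>)"
      by (rule two) (use nG d1 ij in auto)
    moreover have "norm (?R j i * (?G j i - ?R j i) - ?R i i * (?G j j - ?R j j)) \<le> 2 / y * (2 / y\<^sup>2 * \<bar>t\<bar>)"
      by (rule two) (use nG0 d1 ij in auto)
    ultimately have "norm (Q - Q0) \<le> 2 / y * (2 / y\<^sup>2 * \<bar>t\<bar>) + 2 / y * (2 / y\<^sup>2 * \<bar>t\<bar>)"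
      unfolding e by (rule order_trans[OF norm_triangle_ineq add_mono])
    then show ?thesis by simp
  qed
  \<comment> \<open>Large enough for both error coefficients, 2 / y times K = 4 / y^2 + 4 / y^3 and
    8 / y^3.\<close>
  define C where "C = 8 / y\<^sup>2 + 8 / y ^ 3"
  have C1: "2 / y * K \<le> C" 
  proof -
    have "2 / y * K = 4 / y\<^sup>2 + 4 / y ^ 3"
      unfolding K_def by (simp add: distrib_left power2_eq_square power3_eq_cube)
    also have "\<dots> \<le> C" unfolding C_def using y by (intro add_mono divide_right_mono) auto
    finally show ?thesis .
  qed
  have C2: "8 / y ^ 3 \<le> C" unfolding C_def using y by simp
  have "norm (of_real (t\<^sup>2) * (Q1 - Q0) - (Q - Q0) / of_nat n)
      \<le> norm (of_real (t\<^sup>2) * (Q1 - Q0)) + norm ((Q - Q0) / of_nat n)"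
    by (rule norm_triangle_ineq4)
  also have "\<dots> \<le> t\<^sup>2 * (C * min 1 \<bar>t\<bar>) + C * \<bar>t\<bar> / n"
  proof (rule add_mono)
    have "norm (Q1 - Q0) \<le> C * min 1 \<bar>t\<bar>"
      using Q10 mult_right_mono[OF C1, of "min 1 \<bar>t\<bar>"] by (simp only: mult.assoc) simp
    then show "norm (of_real (t\<^sup>2) * (Q1 - Q0)) \<le> t\<^sup>2 * (C * min 1 \<bar>t\<bar>)"
      unfolding norm_mult norm_of_real by (simp add: mult_left_mono)
    have "4 / y * (2 / y\<^sup>2 * \<bar>t\<bar>) = 8 / y ^ 3 * \<bar>t\<bar>"
      by (simp only: power2_eq_square power3_eq_cube times_divide_eq_left times_divide_eq_right
          divide_divide_eq_left mult.assoc)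
    then have "norm (Q - Q0) \<le> C * \<bar>t\<bar>"
      using order_trans[OF Q20] mult_right_mono[OF C2, of "\<bar>t\<bar>"] by (simp only: abs_ge_zero)
    then show "norm ((Q - Q0) / of_nat n) \<le> C * \<bar>t\<bar> / n"
      by (simp add: norm_divide divide_right_mono)
  qed
  also have "\<dots> = C * (t\<^sup>2 * min 1 \<bar>t\<bar> + \<bar>t\<bar> / n)" by (simp add: algebra_simps)
  finally show ?thesis
    unfolding Q_def[symmetric] Q0_def[symmetric] split C_def y_def .
qed

section \<open>The normalized Hermitian matrix of an input array\<close>

definition input_upto :: "nat \<Rightarrow> (nat \<times> nat) set" where
  "input_upto n = {(a, b). 1 \<le> a \<and> a \<le> b \<and> b \<le> n}"

text \<open>An input array is a single function on index pairs, hence a point of a product space,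
  and \<open>w(e := r)\<close> varies one input with the others frozen. The \<open>Suc\<close>
  passes from matrix indices to input indices.\<close>

definition wigner_entry :: "nat \<Rightarrow> (nat \<times> nat \<Rightarrow> real) \<Rightarrow> nat \<Rightarrow> nat \<Rightarrow> real" where
  "wigner_entry n w k l = (if k < l then 1 else if k = l then 0 else - 1)
    * w (Suc (min k l), Suc (max k l)) / sqrt (real n)"

definition wigner_hermitian :: "nat \<Rightarrow> (nat \<times> nat \<Rightarrow> real) \<Rightarrow> nat \<Rightarrow> nat \<Rightarrow> complex" where
  "wigner_hermitian n w k l = \<i> * of_real (wigner_entry n w k l)"

definition wigner_stieltjes :: "nat \<Rightarrow> complex \<Rightarrow> (nat \<times> nat \<Rightarrow> real) \<Rightarrow> complex" where
  "wigner_stieltjes n z w = resolvent_trace n (wigner_hermitian n w) z / of_nat n"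

lemma wigner_entry_skew: "wigner_entry n w l k = - wigner_entry n w k l"
  unfolding wigner_entry_def by (auto simp: min.commute max.commute)

lemma wigner_entry_diag [simp]: "wigner_entry n w k k = 0"
  unfolding wigner_entry_def by simp

lemma hermitian_wigner: "hermitian_on n (wigner_hermitian n w)"
  unfolding hermitian_on_def wigner_hermitian_def
proof (intro allI impI)
  fix i j
  show "\<i> * of_real (wigner_entry n w j i) = cnj (\<i> * of_real (wigner_entry n w i j))"
    by (subst wigner_entry_skew) simp
qed

lemma finite_input_upto: "finite (input_upto n)"
  by (rule finite_subset[of _ "{..n} \<times> {..n}"]) (auto simp: input_upto_def)

lemma input_upto_mem: "k < n \<Longrightarrow> l < n \<Longrightarrow> (Suc (min k l), Suc (max k l)) \<in> input_upto n"
  unfolding input_upto_def by auto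

lemma wigner_hermitian_cong:
  assumes "\<And>e. e \<in> input_upto n \<Longrightarrow> w e = w' e" "k < n" "l < n"
  shows "wigner_hermitian n w k l = wigner_hermitian n w' k l"
  unfolding wigner_hermitian_def wigner_entry_def assms(1)[OF input_upto_mem[OF assms(2,3)]] ..

lemma wigner_stieltjes_cong:
  assumes "\<And>e. e \<in> input_upto n \<Longrightarrow> w e = w' e"
  shows "wigner_stieltjes n z w = wigner_stieltjes n z w'"
proof -
  have "resolvent n (wigner_hermitian n w) z = resolvent n (wigner_hermitian n w') z"
    by (intro resolvent_cong wigner_hermitian_cong assms)
  then show ?thesis unfolding wigner_stieltjes_def resolvent_trace_def by simp
qed

lemma norm_wigner_stieltjes_le:
  assumes "Im z > 0"
  shows "norm (wigner_stieltjes n z w) \<le> 1 / Im z"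
  unfolding wigner_stieltjes_def resolvent_trace_def
  by (rule norm_average_le) (use assms in \<open>auto intro: resolvent_entry_norm_le[OF hermitian_wigner]\<close>)

lemma min_max_eq_cases:
  fixes k l i j :: nat
  assumes "min k l = min i j" "max k l = max i j"
  shows "(k = i \<and> l = j) \<or> (k = j \<and> l = i)"
  using assms by (auto simp: min_def max_def split: if_splits)

text \<open>One input occupies both (i, j) and (j, i), with opposite signs. The reference matrix has
  it set to 0, and the sign in \<open>t\<close> treats i < j and j < i alike.\<close>

lemma wigner_hermitian_update:
  assumes "i \<noteq> j" and e: "e = (Suc (min i j), Suc (max i j))"
    and t: "t = (if i < j then 1 else - 1) * r / sqrt (real n)"
  shows "wigner_hermitian n (w(e := r)) i j = \<i> * of_real t"
    and "wigner_hermitian n (w(e := r)) k l - wigner_hermitian n (w(e := 0)) k l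
      = (if k = i \<and> l = j then \<i> * of_real t else if k = j \<and> l = i then - (\<i> * of_real t) else 0)"
proof -
  show "wigner_hermitian n (w(e := r)) i j = \<i> * of_real t"
    unfolding wigner_hermitian_def wigner_entry_def e t using assms(1) by simp
  show "wigner_hermitian n (w(e := r)) k l - wigner_hermitian n (w(e := 0)) k l
      = (if k = i \<and> l = j then \<i> * of_real t else if k = j \<and> l = i then - (\<i> * of_real t) else 0)"
  proof (cases "(k = i \<and> l = j) \<or> (k = j \<and> l = i)")
    case True
    then show ?thesis using assms(1)
      unfolding wigner_hermitian_def wigner_entry_def e t by (auto simp: min.commute max.commute)
  next
    case False
    then have "(Suc (min k l), Suc (max k l)) \<noteq> e" unfolding e using min_max_eq_cases[of k l i j] by auto
    then have "wigner_hermitian n (w(e := r)) k l = wigner_hermitian n (w(e := 0)) k l"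
      unfolding wigner_hermitian_def wigner_entry_def by simp
    then show ?thesis using False by auto
  qed
qed

section \<open>The loop equation in expectation\<close>

lemma resolvent_minor_bound:
  assumes "hermitian_on n H" "Im z > 0" "i < n" "j < n"
  shows "norm (resolvent_minor (resolvent n H z) i j) \<le> 2 / (Im z)\<^sup>2"
proof -
  let ?G = "resolvent n H z"
  have b: "norm (?G a b) \<le> 1 / Im z" if "a < n" "b < n" for a b
    by (rule resolvent_entry_norm_le[OF assms(1,2) that(2,1)])
  have "norm (?G j i * ?G j i) \<le> 1 / Im z * (1 / Im z)" "norm (?G j j * ?G i i) \<le> 1 / Im z * (1 / Im z)"
    unfolding norm_mult using assms by (intro mult_mono b; simp)+
  then have "norm (?G j i * ?G j i - ?G j j * ?G i i) \<le> 1 / Im z * (1 / Im z) + 1 / Im z * (1 / Im z)"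
    by (intro order_trans[OF norm_triangle_ineq4] add_mono)
  then show ?thesis unfolding resolvent_minor_def power2_eq_square by simp
qed

text \<open>The estimates are made on the canonical product space, where one coordinate or one block
  can be integrated out by Fubini.\<close>

locale independent_inputs =
  fixes \<mu> :: "nat \<times> nat \<Rightarrow> real measure"
  assumes prob: "prob_space (\<mu> e)" and sets_borel: "sets (\<mu> e) = sets borel"
begin

text \<open>The last integral is n times the mean of t^2 min(1, |t|) at t = r / sqrt n, the error
  term of the entry expansion.\<close>

definition standardized_upto :: "nat \<Rightarrow> real \<Rightarrow> bool" where
  "standardized_upto n \<beta> \<longleftrightarrow> (\<forall>e\<in>input_upto n. integrable (\<mu> e) (\<lambda>r. r) \<and> integrable (\<mu> e) (\<lambda>r. r\<^sup>2) \<and>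
    (\<integral>r. r \<partial>\<mu> e) = 0 \<and> (\<integral>r. r\<^sup>2 \<partial>\<mu> e) = 1 \<and> (\<integral>r. r\<^sup>2 * min 1 (\<bar>r\<bar> / sqrt n) \<partial>\<mu> e) \<le> \<beta>)"

abbreviation law :: "nat \<Rightarrow> (nat \<times> nat \<Rightarrow> real) measure" where
  "law n \<equiv> PiM (input_upto n) \<mu>"

lemma prob_space_law: "prob_space (law n)"
  by (intro prob_space_PiM prob)

lemma measurable_mu: "borel_measurable (\<mu> e) = borel_measurable borel"
  by (rule measurable_cong_sets[OF sets_borel refl])

lemma coordinate_measurable: "e \<in> input_upto n \<Longrightarrow> (\<lambda>w. w e) \<in> borel_measurable (law n)"
  using measurable_component_singleton[of e "input_upto n" \<mu>]
  by (simp add: measurable_cong_sets[OF refl sets_borel])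

lemma wigner_hermitian_measurable:
  assumes "i < n" "j < n"
  shows "(\<lambda>w. wigner_hermitian n w i j) \<in> borel_measurable (law n)"
  unfolding wigner_hermitian_def wigner_entry_def
  using coordinate_measurable[OF input_upto_mem[OF assms]] by measurable

lemma resolvent_wigner_measurable:
  assumes "i < n" "j < n"
  shows "(\<lambda>w. resolvent n (wigner_hermitian n w) z i j) \<in> borel_measurable (law n)"
  by (rule resolvent_measurable[OF wigner_hermitian_measurable assms])

lemma wigner_stieltjes_measurable: "wigner_stieltjes n z \<in> borel_measurable (law n)"
  unfolding wigner_stieltjes_def[abs_def] resolvent_trace_def
  by (intro borel_measurable_divide borel_measurable_sum resolvent_wigner_measurable borel_measurable_const) auto

text \<open>Summed over all i and j this is n (1 + z m + m^2) minus the sum of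
  \<open>(G j i)\<^sup>2 / n\<close>, while each single term has mean o(1 / n).\<close>

definition loop_entry :: "nat \<Rightarrow> complex \<Rightarrow> nat \<Rightarrow> nat \<Rightarrow> (nat \<times> nat \<Rightarrow> real) \<Rightarrow> complex" where
  "loop_entry n z i j w = wigner_hermitian n w i j * resolvent n (wigner_hermitian n w) z j i
    - resolvent_minor (resolvent n (wigner_hermitian n w) z) i j / of_nat n"

lemma loop_entry_measurable:
  assumes "i < n" "j < n"
  shows "loop_entry n z i j \<in> borel_measurable (law n)"
  unfolding loop_entry_def[abs_def] resolvent_minor_def
  by (intro borel_measurable_diff borel_measurable_divide borel_measurable_times borel_measurable_power
      wigner_hermitian_measurable resolvent_wigner_measurable borel_measurable_const assms)

lemma coordinate_integrable:
  assumes "e \<in> input_upto n" "integrable (\<mu> e) (\<lambda>r. r)"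
  shows "integrable (law n) (\<lambda>w. w e)"
proof -
  have d: "distr (law n) (\<mu> e) (\<lambda>w. w e) = \<mu> e"
    by (rule distr_PiM_component[OF prob assms(1)])
  have "integrable (distr (law n) (\<mu> e) (\<lambda>w. w e)) (\<lambda>r. r)" unfolding d by (rule assms(2))
  then show ?thesis
    by (subst (asm) integrable_distr_eq) (auto simp: measurable_mu intro: measurable_component_singleton assms)
qed

lemma loop_entry_integrable:
  assumes "standardized_upto n \<beta>" "i < n" "j < n" and z: "Im z > 0"
  shows "integrable (law n) (loop_entry n z i j)"
proof -
  interpret P: prob_space "law n" by (rule prob_space_law)
  let ?e = "(Suc (min i j), Suc (max i j))"
  have e: "?e \<in> input_upto n" by (rule input_upto_mem[OF assms(2,3)])
  then have "integrable (\<mu> ?e) (\<lambda>r. r)" using assms(1) unfolding standardized_upto_def by blast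
  then have int: "integrable (law n) (\<lambda>w. norm (w ?e))" by (intro integrable_norm coordinate_integrable[OF e])
  define B where "B w = norm (w ?e) * (1 / Im z / sqrt n) + 2 / (Im z)\<^sup>2 / n" for w :: "nat \<times> nat \<Rightarrow> real"
  have intB: "integrable (law n) B"
    unfolding B_def by (intro Bochner_Integration.integrable_add integrable_mult_left int P.integrable_const)
  have "norm (loop_entry n z i j w) \<le> B w" for w
  proof -
    have h: "norm (wigner_hermitian n w i j) \<le> norm (w ?e) / sqrt n"
      unfolding wigner_hermitian_def wigner_entry_def by (simp add: norm_mult norm_divide)
    have "norm (wigner_hermitian n w i j * resolvent n (wigner_hermitian n w) z j i) \<le> norm (w ?e) / sqrt n * (1 / Im z)"
      unfolding norm_mult using z
      by (intro mult_mono h resolvent_entry_norm_le[OF hermitian_wigner z assms(2,3)]) auto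
    moreover have "norm (resolvent_minor (resolvent n (wigner_hermitian n w) z) i j / of_nat n) \<le> 2 / (Im z)\<^sup>2 / n"
      unfolding norm_divide norm_of_nat
      by (intro divide_right_mono resolvent_minor_bound[OF hermitian_wigner z assms(2,3)]) auto
    ultimately have "norm (loop_entry n z i j w) \<le> norm (w ?e) / sqrt n * (1 / Im z) + 2 / (Im z)\<^sup>2 / n"
      unfolding loop_entry_def by (rule order_trans[OF norm_triangle_ineq4 add_mono])
    then show ?thesis unfolding B_def by (simp add: mult.commute)
  qed
  then show ?thesis
    by (intro Bochner_Integration.integrable_bound[OF intB loop_entry_measurable[OF assms(2,3)]])
      (auto intro: order_trans[OF _ abs_ge_self])
qed

text \<open>Only the input \<open>e\<close> is integrated. In the main term it appears linearly and
  through r^2 - 1, with coefficients computed from the resolvent at r = 0; mean 0 removes the first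
  part and variance 1 the second, leaving only the expansion error.\<close>

lemma loop_entry_conditional_bound:
  assumes std: "standardized_upto n \<beta>" and ij: "i < n" "j < n" "i \<noteq> j" and z: "Im z > 0"
    and e: "e = (Suc (min i j), Suc (max i j))"
  shows "norm (\<integral>r. loop_entry n z i j (w(e := r)) \<partial>\<mu> e) \<le> (8 / (Im z)\<^sup>2 + 8 / (Im z) ^ 3) * (\<beta> + 1 / sqrt n) / n"
proof -
  interpret E: prob_space "\<mu> e" by (rule prob)
  have n: "n > 0" using ij by simp
  define N where "N = real n"
  have N: "N > 0" unfolding N_def using n by simp
  have "e \<in> input_upto n" unfolding e by (rule input_upto_mem[OF ij(1,2)])
  then have int1: "integrable (\<mu> e) (\<lambda>r. r)" and int2: "integrable (\<mu> e) (\<lambda>r. r\<^sup>2)"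
    and m1: "(\<integral>r. r \<partial>\<mu> e) = 0" and m2: "(\<integral>r. r\<^sup>2 \<partial>\<mu> e) = 1"
    and \<beta>: "(\<integral>r. r\<^sup>2 * min 1 (\<bar>r\<bar> / sqrt N) \<partial>\<mu> e) \<le> \<beta>"
    using std unfolding standardized_upto_def N_def by auto
  define C where "C = 8 / (Im z)\<^sup>2 + 8 / (Im z) ^ 3"
  have C: "C > 0" unfolding C_def using z by (simp add: add_pos_pos)
  define s :: real where "s = (if i < j then 1 else - 1)"
  have s: "\<bar>s\<bar> = 1" "s\<^sup>2 = 1" unfolding s_def by auto
  define R where "R = resolvent n (wigner_hermitian n (w(e := 0))) z"
  define F where "F r = loop_entry n z i j (w(e := r))" for r
  define A where "A r = of_real r * (\<i> * of_real (s / sqrt N) * R j i) + of_real (r\<^sup>2 - 1) * (of_real (1 / N) * resolvent_minor R i j)" for r :: real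
  have FA: "norm (F r - A r) \<le> C * (r\<^sup>2 * min 1 (\<bar>r\<bar> / sqrt N) / N + \<bar>r\<bar> / (sqrt N * N))" for r
  proof -
    define t where "t = s * r / sqrt N"
    have t2: "t\<^sup>2 = r\<^sup>2 / N" and ta: "\<bar>t\<bar> = \<bar>r\<bar> / sqrt N"
      unfolding t_def using s N by (simp_all add: power_divide power_mult_distrib abs_mult)
    have up: "wigner_hermitian n (w(e := r)) i j = \<i> * of_real t"
      "wigner_hermitian n (w(e := r)) k l - wigner_hermitian n (w(e := 0)) k l
      = (if k = i \<and> l = j then \<i> * of_real t else if k = j \<and> l = i then - (\<i> * of_real t) else 0)" for k l
      by (rule wigner_hermitian_update[OF ij(3) e]; simp add: t_def s_def N_def)+
    have F: "F r = \<i> * of_real t * resolvent n (wigner_hermitian n (w(e := r))) z j i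
        - resolvent_minor (resolvent n (wigner_hermitian n (w(e := r))) z) i j / of_nat n"
      unfolding F_def loop_entry_def up(1) ..
    have "A r = \<i> * of_real t * R j i + of_real (t\<^sup>2 - 1 / n) * resolvent_minor R i j"
      unfolding A_def t2 unfolding t_def N_def by (simp add: diff_divide_distrib algebra_simps)
    then have "norm (F r - A r) \<le> C * (t\<^sup>2 * min 1 \<bar>t\<bar> + \<bar>t\<bar> / n)"
      using resolvent_entry_expansion[OF hermitian_wigner[of n "w(e := 0)"] hermitian_wigner[of n "w(e := r)"] z ij up(2)]
      unfolding F R_def C_def by simp
    then show ?thesis unfolding t2 ta N_def by (simp add: mult.commute)
  qed
  have Fmeas: "F \<in> borel_measurable (\<mu> e)"
  proof -
    have w: "(\<lambda>r. wigner_hermitian n (w(e := r)) k l) \<in> borel_measurable (\<mu> e)" for k l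
    proof -
      have "(\<lambda>r. (w(e := r)) e') \<in> borel_measurable (\<mu> e)" for e'
        by (cases "e' = e") (simp_all add: measurable_mu)
      then show ?thesis unfolding wigner_hermitian_def wigner_entry_def by measurable
    qed
    show ?thesis unfolding F_def[abs_def] loop_entry_def[abs_def] resolvent_minor_def
      by (intro borel_measurable_diff borel_measurable_divide borel_measurable_times borel_measurable_power
          w resolvent_measurable borel_measurable_const ij)
  qed
  have intA: "integrable (\<mu> e) A"
    unfolding A_def
    by (intro Bochner_Integration.integrable_add integrable_mult_left integrable_of_real
        Bochner_Integration.integrable_diff int1 int2 E.integrable_const)
  have A0: "(\<integral>r. A r \<partial>\<mu> e) = 0"
  proof -
    have o1: "(\<integral>r. complex_of_real r \<partial>\<mu> e) = 0"
      using integral_of_real[of "\<mu> e" "\<lambda>r. r"] m1 by simp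
    have "(\<integral>r. r\<^sup>2 - 1 \<partial>\<mu> e) = 0"
      using int2 m2 by (simp add: E.prob_space)
    then have o2: "(\<integral>r. complex_of_real (r\<^sup>2 - 1) \<partial>\<mu> e) = 0"
      by (simp only: integral_complex_of_real of_real_0)
    have "(\<integral>r. A r \<partial>\<mu> e) = (\<integral>r. of_real r * (\<i> * of_real (s / sqrt N) * R j i) \<partial>\<mu> e)
        + (\<integral>r. of_real (r\<^sup>2 - 1) * (of_real (1 / N) * resolvent_minor R i j) \<partial>\<mu> e)"
      unfolding A_def
      by (intro Bochner_Integration.integral_add integrable_mult_left integrable_of_real
          Bochner_Integration.integrable_diff int1 int2 E.integrable_const)
    then show ?thesis by (simp only: integral_mult_left_zero o1 o2 mult_zero_left add_0)
  qed
  define D where "D r = C * (r\<^sup>2 * min 1 (\<bar>r\<bar> / sqrt N) / N + \<bar>r\<bar> / (sqrt N * N))" for r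
  have intmin: "integrable (\<mu> e) (\<lambda>r. r\<^sup>2 * min 1 (\<bar>r\<bar> / sqrt N))"
  proof (rule Bochner_Integration.integrable_bound[OF int2])
    show "AE r in \<mu> e. norm (r\<^sup>2 * min 1 (\<bar>r\<bar> / sqrt N)) \<le> norm (r\<^sup>2)"
      using N by (intro AE_I2) (simp add: abs_mult mult_left_le)
  qed (simp add: measurable_mu)
  have intabs: "integrable (\<mu> e) (\<lambda>r. \<bar>r\<bar>)" using integrable_norm[OF int1] by simp
  have intD: "integrable (\<mu> e) D"
    unfolding D_def by (intro integrable_mult_right Bochner_Integration.integrable_add integrable_divide intmin intabs)
  have intFA: "integrable (\<mu> e) (\<lambda>r. F r - A r)"
  proof (rule Bochner_Integration.integrable_bound[OF intD])
    show "AE r in \<mu> e. norm (F r - A r) \<le> norm (D r)"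
      using FA unfolding D_def by (intro AE_I2) (auto intro: order_trans[OF _ abs_ge_self])
  qed (intro borel_measurable_diff Fmeas borel_measurable_integrable[OF intA])
  have "(\<integral>r. F r - A r \<partial>\<mu> e) = (\<integral>r. F r \<partial>\<mu> e)"
  proof -
    \<comment> \<open>Integrability of \<open>F\<close> is gained from that of the error and of the
      main term.\<close>
    have "integrable (\<mu> e) (\<lambda>r. (F r - A r) + A r)" by (rule Bochner_Integration.integrable_add[OF intFA intA])
    then have "integrable (\<mu> e) F" by simp
    then show ?thesis using intA A0 by simp
  qed
  then have "norm (\<integral>r. F r \<partial>\<mu> e) \<le> (\<integral>r. D r \<partial>\<mu> e)"
    using order_trans[OF integral_norm_bound integral_mono[OF integrable_norm[OF intFA] intD]] FA
    unfolding D_def by metis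
  also have "\<dots> = C * ((\<integral>r. r\<^sup>2 * min 1 (\<bar>r\<bar> / sqrt N) \<partial>\<mu> e) / N + (\<integral>r. \<bar>r\<bar> \<partial>\<mu> e) / (sqrt N * N))"
    unfolding D_def using intmin intabs by simp
  also have "\<dots> \<le> C * (\<beta> / N + 1 / (sqrt N * N))"
  proof -
    have "(\<integral>r. \<bar>r\<bar> \<partial>\<mu> e) \<le> (\<integral>r. (1 + r\<^sup>2) / 2 \<partial>\<mu> e)"
    proof (rule integral_mono[OF intabs])
      show "integrable (\<mu> e) (\<lambda>r. (1 + r\<^sup>2) / 2)"
        by (intro integrable_divide Bochner_Integration.integrable_add int2 E.integrable_const)
      show "\<bar>r\<bar> \<le> (1 + r\<^sup>2) / 2" for r :: real
        using sum_squares_bound[of 1 "\<bar>r\<bar>"] by simp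
    qed
    also have "\<dots> = 1" using int2 m2 by (simp add: E.prob_space)
    finally have "(\<integral>r. \<bar>r\<bar> \<partial>\<mu> e) \<le> 1" .
    then show ?thesis using \<beta> N C by (intro mult_left_mono add_mono divide_right_mono) auto
  qed
  also have "\<dots> = C * (\<beta> + 1 / sqrt N) / N" using N by (simp add: field_simps)
  finally show ?thesis unfolding F_def C_def N_def .
qed

lemma loop_entry_expectation_bound:
  assumes std: "standardized_upto n \<beta>" and ij: "i < n" "j < n" and z: "Im z > 0" and "\<beta> \<ge> 0"
  shows "norm (\<integral>w. loop_entry n z i j w \<partial>law n) \<le> (8 / (Im z)\<^sup>2 + 8 / (Im z) ^ 3) * (\<beta> + 1 / sqrt n) / n"
proof (cases "i = j")
  case True
  \<comment> \<open>On the diagonal the matrix entry is 0 and the two terms of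
    \<open>resolvent_minor\<close> coincide.\<close>
  have "loop_entry n z i j w = 0" for w
    unfolding loop_entry_def True resolvent_minor_def wigner_hermitian_def by (simp add: power2_eq_square)
  then show ?thesis using z \<open>\<beta> \<ge> 0\<close> by simp
next
  case False
  define e where "e = (Suc (min i j), Suc (max i j))"
  define I where "I = input_upto n - {e}"
  have e: "e \<in> input_upto n" unfolding e_def by (rule input_upto_mem[OF ij])
  have ins: "input_upto n = insert e I" and eI: "e \<notin> I" and fin: "finite I"
    unfolding I_def using e finite_input_upto by auto
  interpret S: product_sigma_finite \<mu>
    unfolding product_sigma_finite_def by (intro allI prob_space_imp_sigma_finite prob)
  interpret PI: prob_space "PiM I \<mu>" by (intro prob_space_PiM prob)
  let ?K = "(8 / (Im z)\<^sup>2 + 8 / (Im z) ^ 3) * (\<beta> + 1 / sqrt n) / n"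
  have "(\<integral>w. loop_entry n z i j w \<partial>law n) = (\<integral>w. (\<integral>r. loop_entry n z i j (w(e := r)) \<partial>\<mu> e) \<partial>PiM I \<mu>)"
    unfolding ins
    by (rule S.product_integral_insert[OF fin eI]) (use loop_entry_integrable[OF std ij z] ins in simp)
  also have "norm \<dots> \<le> (\<integral>w. norm (\<integral>r. loop_entry n z i j (w(e := r)) \<partial>\<mu> e) \<partial>PiM I \<mu>)"
    by (rule integral_norm_bound)
  also have "\<dots> \<le> (\<integral>w. ?K \<partial>PiM I \<mu>)"
  proof (rule integral_mono_AE')
    show "AE w in PiM I \<mu>. norm (\<integral>r. loop_entry n z i j (w(e := r)) \<partial>\<mu> e) \<le> ?K"
      by (intro AE_I2 loop_entry_conditional_bound[OF std ij False z e_def])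
  qed (use z \<open>\<beta> \<ge> 0\<close> in auto)
  also have "\<dots> = ?K" by (simp add: PI.prob_space)
  finally show ?thesis .
qed

text \<open>The trace of \<open>H G = 1 + z G\<close> supplies the linear part; the products
  \<open>G i i * G j j\<close> in the minors sum to the square of the trace.\<close>

lemma loop_identity:
  assumes z: "Im z > 0" and n: "n > 0"
  shows "1 + z * wigner_stieltjes n z w + (wigner_stieltjes n z w)\<^sup>2
    = (\<Sum>i<n. \<Sum>j<n. loop_entry n z i j w) / of_nat n
      + (\<Sum>i<n. \<Sum>j<n. (resolvent n (wigner_hermitian n w) z j i)\<^sup>2) / (of_nat n)\<^sup>2"
proof -
  define G where "G = resolvent n (wigner_hermitian n w) z"
  define T where "T = (\<Sum>i<n. G i i)"
  define N where "N = (of_nat n :: complex)"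
  have N: "N \<noteq> 0" unfolding N_def using n by simp
  have s: "wigner_stieltjes n z w = T / N"
    unfolding wigner_stieltjes_def resolvent_trace_def T_def G_def N_def ..
  define S where "S = (\<Sum>i<n. \<Sum>j<n. (G j i)\<^sup>2)"
  have "(\<Sum>i<n. \<Sum>j<n. loop_entry n z i j w)
      = (\<Sum>i<n. \<Sum>j<n. wigner_hermitian n w i j * G j i) - (\<Sum>i<n. \<Sum>j<n. resolvent_minor G i j) / N"
    unfolding loop_entry_def G_def[symmetric] N_def by (simp add: sum_subtractf sum_divide_distrib)
  also have "(\<Sum>i<n. \<Sum>j<n. wigner_hermitian n w i j * G j i) = (\<Sum>i<n. 1 + z * G i i)"
    unfolding G_def using z by (intro sum.cong refl) (simp add: resolvent_right[OF hermitian_wigner])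
  also have "\<dots> = N + z * T" unfolding T_def N_def by (simp add: sum.distrib sum_distrib_left)
  also have "(\<Sum>i<n. \<Sum>j<n. resolvent_minor G i j) = S - (\<Sum>i<n. \<Sum>j<n. G i i * G j j)"
    unfolding resolvent_minor_def S_def by (simp add: sum_subtractf mult.commute)
  also have "(\<Sum>i<n. \<Sum>j<n. G i i * G j j) = T * T" unfolding T_def by (simp only: sum_product)
  finally have L: "(\<Sum>i<n. \<Sum>j<n. loop_entry n z i j w) = N + z * T - (S - T * T) / N" .
  have "1 + z * (T / N) + (T / N)\<^sup>2 = (N + z * T - (S - T * T) / N) / N + S / N\<^sup>2"
    using N by (simp add: field_simps power2_eq_square)
  then show ?thesis unfolding s L S_def G_def N_def .
qed

text \<open>Averaging the pointwise identity produces E m^2, not yet (E m)^2. The squared entries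
  cost only 1 / (n (Im z)^2), because each column of the resolvent has bounded Euclidean
  norm.\<close>

lemma loop_equation_second_moment:
  assumes std: "standardized_upto n \<beta>" and z: "Im z > 0" and n: "n > 0" and "\<beta> \<ge> 0"
  shows "norm (1 + z * (\<integral>w. wigner_stieltjes n z w \<partial>law n) + (\<integral>w. (wigner_stieltjes n z w)\<^sup>2 \<partial>law n))
    \<le> (8 / (Im z)\<^sup>2 + 8 / (Im z) ^ 3) * (\<beta> + 1 / sqrt n) + 1 / (n * (Im z)\<^sup>2)"
proof -
  interpret P: prob_space "law n" by (rule prob_space_law)
  define C where "C = (8 / (Im z)\<^sup>2 + 8 / (Im z) ^ 3) * (\<beta> + 1 / sqrt n)"
  define Z where "Z w = (\<Sum>i<n. \<Sum>j<n. (resolvent n (wigner_hermitian n w) z j i)\<^sup>2) / (of_nat n)\<^sup>2" for w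
  define L where "L w = (\<Sum>i<n. \<Sum>j<n. loop_entry n z i j w) / of_nat n" for w
  have int1: "integrable (law n) (wigner_stieltjes n z)"
    by (rule P.integrable_const_bound[where B = "1 / Im z"])
      (auto simp: norm_wigner_stieltjes_le[OF z] wigner_stieltjes_measurable)
  have int2: "integrable (law n) (\<lambda>w. (wigner_stieltjes n z w)\<^sup>2)"
    by (rule P.integrable_const_bound[where B = "(1 / Im z)\<^sup>2"])
      (auto simp: norm_power intro!: power_mono norm_wigner_stieltjes_le[OF z] borel_measurable_power wigner_stieltjes_measurable)
  have Zb: "norm (Z w) \<le> 1 / (n * (Im z)\<^sup>2)" for w
  proof -
    have "norm (\<Sum>i<n. \<Sum>j<n. (resolvent n (wigner_hermitian n w) z j i)\<^sup>2)
        \<le> (\<Sum>i<n. \<Sum>j<n. (norm (resolvent n (wigner_hermitian n w) z j i))\<^sup>2)"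
      by (intro order_trans[OF norm_sum] sum_mono) (simp add: norm_power)
    also have "\<dots> \<le> (\<Sum>i<n. 1 / (Im z)\<^sup>2)"
      by (intro sum_mono resolvent_column_norm_le[OF hermitian_wigner z]) simp
    finally have "norm (\<Sum>i<n. \<Sum>j<n. (resolvent n (wigner_hermitian n w) z j i)\<^sup>2) \<le> n / (Im z)\<^sup>2" by simp
    then have "norm (Z w) \<le> n / (Im z)\<^sup>2 / (real n)\<^sup>2"
      unfolding Z_def norm_divide norm_power norm_of_nat by (rule divide_right_mono) simp
    then show ?thesis using n by (simp add: power2_eq_square mult_ac)
  qed
  have Zmeas: "Z \<in> borel_measurable (law n)"
    unfolding Z_def[abs_def]
    by (intro borel_measurable_divide borel_measurable_sum borel_measurable_power resolvent_wigner_measurable borel_measurable_const) auto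
  have intZ: "integrable (law n) Z"
    by (rule P.integrable_const_bound[where B = "1 / (n * (Im z)\<^sup>2)"]) (use Zb Zmeas in auto)
  have intL: "integrable (law n) L"
    unfolding L_def by (intro integrable_divide Bochner_Integration.integrable_sum loop_entry_integrable[OF std _ _ z]) auto
  have "1 + z * (\<integral>w. wigner_stieltjes n z w \<partial>law n) + (\<integral>w. (wigner_stieltjes n z w)\<^sup>2 \<partial>law n)
      = (\<integral>w. 1 + z * wigner_stieltjes n z w + (wigner_stieltjes n z w)\<^sup>2 \<partial>law n)"
    using int1 int2 by (simp add: P.prob_space)
  also have "\<dots> = (\<integral>w. L w + Z w \<partial>law n)"
    unfolding loop_identity[OF z n] L_def Z_def ..
  also have "\<dots> = (\<integral>w. L w \<partial>law n) + (\<integral>w. Z w \<partial>law n)"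
    by (rule Bochner_Integration.integral_add[OF intL intZ])
  also have "norm \<dots> \<le> C + 1 / (n * (Im z)\<^sup>2)"
  proof (intro order_trans[OF norm_triangle_ineq] add_mono)
    have "(\<integral>w. L w \<partial>law n) = (\<Sum>i<n. \<Sum>j<n. \<integral>w. loop_entry n z i j w \<partial>law n) / of_nat n"
    proof -
      note li = loop_entry_integrable[OF std _ _ z]
      have "(\<integral>w. (\<Sum>i<n. \<Sum>j<n. loop_entry n z i j w) \<partial>law n) = (\<Sum>i<n. \<integral>w. (\<Sum>j<n. loop_entry n z i j w) \<partial>law n)"
        by (intro Bochner_Integration.integral_sum Bochner_Integration.integrable_sum li) auto
      also have "\<dots> = (\<Sum>i<n. \<Sum>j<n. \<integral>w. loop_entry n z i j w \<partial>law n)"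
        by (intro sum.cong refl Bochner_Integration.integral_sum li) auto
      finally show ?thesis unfolding L_def by simp
    qed
    moreover have "norm (\<Sum>i<n. \<Sum>j<n. \<integral>w. loop_entry n z i j w \<partial>law n) \<le> (\<Sum>i<n. \<Sum>j<n. C / n)"
      by (intro order_trans[OF norm_sum] sum_mono)
        (use loop_entry_expectation_bound[OF std _ _ z \<open>\<beta> \<ge> 0\<close>] in \<open>auto simp: C_def\<close>)
    then have "norm (\<Sum>i<n. \<Sum>j<n. \<integral>w. loop_entry n z i j w \<partial>law n) / n \<le> C"
      using n by (simp add: field_simps)
    ultimately show "norm (\<integral>w. L w \<partial>law n) \<le> C" by (simp add: norm_divide)
    show "norm (\<integral>w. Z w \<partial>law n) \<le> 1 / (n * (Im z)\<^sup>2)"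
      by (rule P.norm_expectation_le[OF intZ Zb])
  qed
  finally show ?thesis unfolding C_def .
qed

section \<open>Concentration of the Stieltjes transform\<close>

text \<open>The exempted block holds the inputs with larger index \<open>Suc k\<close>. They sit in
  row and column \<open>k\<close> of the matrix, whose diagonal is 0 whatever the input, so the rank
  two estimate applies.\<close>

lemma wigner_stieltjes_row_change:
  assumes z: "Im z > 0" and k: "k < n" and eq: "\<And>e. e \<notin> {1..Suc k} \<times> {Suc k} \<Longrightarrow> w e = w' e"
  shows "norm (wigner_stieltjes n z w - wigner_stieltjes n z w') \<le> 4 / (Im z * n)"
proof -
  have off: "wigner_hermitian n w' p q = wigner_hermitian n w p q" if "p \<noteq> k" "q \<noteq> k" for p q
    using that eq unfolding wigner_hermitian_def wigner_entry_def by (auto simp: max_def)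
  have "norm (resolvent_trace n (wigner_hermitian n w) z - resolvent_trace n (wigner_hermitian n w') z) \<le> 4 / Im z"
    by (rule resolvent_trace_row_change[OF hermitian_wigner hermitian_wigner z _ _ k])
      (auto simp: off wigner_hermitian_def[of n _ k k])
  then show ?thesis
    unfolding wigner_stieltjes_def diff_divide_distrib[symmetric] norm_divide norm_of_nat
    using k by (simp add: field_simps)
qed

lemma input_upto_Union: "input_upto n = (\<Union>k<n. {1..Suc k} \<times> {Suc k})"
proof (intro equalityI subsetI)
  fix e assume "e \<in> input_upto n"
  then obtain a b where e: "e = (a, b)" "1 \<le> a" "a \<le> b" "b \<le> n" unfolding input_upto_def by auto
  then show "e \<in> (\<Union>k<n. {1..Suc k} \<times> {Suc k})" by (intro UN_I[of "b - 1"]) auto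
qed (auto simp: input_upto_def)

text \<open>With c = 4 / (n Im z) the quantity n^2 c^4 is 256 / (n^2 (Im z)^4). Of the factor 4, one
  2 comes from |u + iv|^4 \<le> 2 (u^4 + v^4), the other from adding the bounds for real and
  imaginary part.\<close>

lemma wigner_stieltjes_fourth_moment:
  assumes z: "Im z > 0" and n: "n > 0"
  shows "(\<integral>w. norm (wigner_stieltjes n z w - (\<integral>w. wigner_stieltjes n z w \<partial>law n)) ^ 4 \<partial>law n)
    \<le> 4 * 1536 * 256 / (Im z ^ 4 * (real n)\<^sup>2)"
proof -
  interpret P: prob_space "law n" by (rule prob_space_law)
  define J :: "nat \<Rightarrow> (nat \<times> nat) set" where "J k = {1..Suc k} \<times> {Suc k}" for k
  have J: "finite (J k)" "disjoint_family J" for k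
    unfolding J_def disjoint_family_on_def by auto
  have law: "law n = PiM (\<Union>k<n. J k) \<mu>" unfolding J_def input_upto_Union ..
  define X where "X = wigner_stieltjes n z"
  define E where "E = (\<integral>w. X w \<partial>law n)"
  define c where "c = 4 / (Im z * n)"
  have c: "c > 0" unfolding c_def using z n by simp
  have Xm: "X \<in> borel_measurable (law n)" unfolding X_def by (rule wigner_stieltjes_measurable)
  have Xb: "norm (X w) \<le> 1 / Im z" for w unfolding X_def by (rule norm_wigner_stieltjes_le[OF z])
  have intX: "integrable (law n) X"
    by (rule P.integrable_const_bound[where B = "1 / Im z"]) (use Xb Xm in auto)
  have Xc: "norm (X w - X w') \<le> c" if "k < n" "\<And>e. e \<notin> J k \<Longrightarrow> w e = w' e" for k w w'
    unfolding X_def c_def by (rule wigner_stieltjes_row_change[OF z that[unfolded J_def]])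
  have re: "(\<integral>w. (Re (X w) - Re E) ^ 4 \<partial>law n) \<le> 1536 * (real n)\<^sup>2 * c ^ 4"
  proof -
    have ER: "Re E = (\<integral>w. Re (X w) \<partial>law n)" unfolding E_def using integral_Re[OF intX] by simp
    show ?thesis unfolding ER law
    proof (rule bounded_differences_fourth_moment[OF prob J n c, where B = "1 / Im z"])
      show "(\<lambda>w. Re (X w)) \<in> borel_measurable (PiM (\<Union>k<n. J k) \<mu>)" using Xm unfolding law by simp
      show "\<bar>Re (X w)\<bar> \<le> 1 / Im z" for w by (rule order_trans[OF abs_Re_le_cmod Xb])
      show "\<bar>Re (X x) - Re (X y)\<bar> \<le> c" if "k < n" "\<And>i. i \<notin> J k \<Longrightarrow> x i = y i" for k x y
        using order_trans[OF abs_Re_le_cmod Xc[OF that]] by simp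
    qed
  qed
  have im: "(\<integral>w. (Im (X w) - Im E) ^ 4 \<partial>law n) \<le> 1536 * (real n)\<^sup>2 * c ^ 4"
  proof -
    have EI: "Im E = (\<integral>w. Im (X w) \<partial>law n)" unfolding E_def using integral_Im[OF intX] by simp
    show ?thesis unfolding EI law
    proof (rule bounded_differences_fourth_moment[OF prob J n c, where B = "1 / Im z"])
      show "(\<lambda>w. Im (X w)) \<in> borel_measurable (PiM (\<Union>k<n. J k) \<mu>)" using Xm unfolding law by simp
      show "\<bar>Im (X w)\<bar> \<le> 1 / Im z" for w by (rule order_trans[OF abs_Im_le_cmod Xb])
      show "\<bar>Im (X x) - Im (X y)\<bar> \<le> c" if "k < n" "\<And>i. i \<notin> J k \<Longrightarrow> x i = y i" for k x y
        using order_trans[OF abs_Im_le_cmod Xc[OF that]] by simp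
    qed
  qed
  have Eb: "norm E \<le> 1 / Im z"
    unfolding E_def by (rule P.norm_expectation_le[OF intX Xb])
  have intpow: "integrable (law n) (\<lambda>w. f (X w - E) ^ 4)"
    if f: "\<And>v. \<bar>f v\<bar> \<le> norm v" "f \<in> borel_measurable borel" for f :: "complex \<Rightarrow> real"
  proof (rule P.integrable_const_bound)
    show "AE w in law n. norm (f (X w - E) ^ 4) \<le> (2 / Im z) ^ 4"
    proof (rule AE_I2)
      fix w
      have "\<bar>f (X w - E)\<bar> \<le> 2 / Im z"
        using order_trans[OF f(1) norm_triangle_ineq4[of "X w" E]] Xb[of w] Eb by simp
      then show "norm (f (X w - E) ^ 4) \<le> (2 / Im z) ^ 4"
        unfolding real_norm_def power_abs by (intro power_mono) auto
    qed
    show "(\<lambda>w. f (X w - E) ^ 4) \<in> borel_measurable (law n)"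
      by (intro borel_measurable_power measurable_compose[OF borel_measurable_diff[OF Xm borel_measurable_const] f(2)])
  qed
  have intR: "integrable (law n) (\<lambda>w. (Re (X w) - Re E) ^ 4)"
    and intI: "integrable (law n) (\<lambda>w. (Im (X w) - Im E) ^ 4)"
    using intpow[of Re] intpow[of Im] by (simp_all add: abs_Re_le_cmod abs_Im_le_cmod)
  have "(\<integral>w. norm (X w - E) ^ 4 \<partial>law n) \<le> (\<integral>w. 2 * ((Re (X w) - Re E) ^ 4 + (Im (X w) - Im E) ^ 4) \<partial>law n)"
  proof (rule integral_mono)
    show "integrable (law n) (\<lambda>w. norm (X w - E) ^ 4)" by (rule intpow) auto
    show "integrable (law n) (\<lambda>w. 2 * ((Re (X w) - Re E) ^ 4 + (Im (X w) - Im E) ^ 4))"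
      using intR intI by simp
    fix w
    have "norm (X w - E) ^ 4 = ((Re (X w) - Re E)\<^sup>2 + (Im (X w) - Im E)\<^sup>2)\<^sup>2"
    proof -
      have "norm (X w - E) ^ 4 = ((norm (X w - E))\<^sup>2)\<^sup>2" by (simp only: power_mult[symmetric]) simp
      then show ?thesis by (simp add: cmod_power2)
    qed
    also have "\<dots> \<le> 2 * (((Re (X w) - Re E)\<^sup>2)\<^sup>2 + ((Im (X w) - Im E)\<^sup>2)\<^sup>2)"
      using sum_squares_bound[of "(Re (X w) - Re E)\<^sup>2" "(Im (X w) - Im E)\<^sup>2"] by (simp add: power2_sum)
    also have "\<dots> = 2 * ((Re (X w) - Re E) ^ 4 + (Im (X w) - Im E) ^ 4)"
      by (simp only: power_mult[symmetric]) simp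
    finally show "norm (X w - E) ^ 4 \<le> 2 * ((Re (X w) - Re E) ^ 4 + (Im (X w) - Im E) ^ 4)" .
  qed
  also have "\<dots> = 2 * ((\<integral>w. (Re (X w) - Re E) ^ 4 \<partial>law n) + (\<integral>w. (Im (X w) - Im E) ^ 4 \<partial>law n))"
    using intR intI by simp
  also have "\<dots> \<le> 2 * (1536 * (real n)\<^sup>2 * c ^ 4 + 1536 * (real n)\<^sup>2 * c ^ 4)"
    using re im by (intro mult_left_mono add_mono) auto
  also have "\<dots> = 4 * 1536 * ((real n)\<^sup>2 * c ^ 4)" by simp
  also have "(real n)\<^sup>2 * c ^ 4 = 256 / (Im z ^ 4 * (real n)\<^sup>2)"
  proof -
    have "real n ^ 4 = (real n)\<^sup>2 * (real n)\<^sup>2" by (simp only: power_add[symmetric]) simp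
    then have "c ^ 4 = 256 / (Im z ^ 4 * ((real n)\<^sup>2 * (real n)\<^sup>2))"
      unfolding c_def power_divide power_mult_distrib by simp
    moreover have cancel: "m * (256 / (u * (m * m))) = 256 / (u * m)" if "m > 0" for m u :: real
      using that by simp
    have "(real n)\<^sup>2 * (256 / (Im z ^ 4 * ((real n)\<^sup>2 * (real n)\<^sup>2))) = 256 / (Im z ^ 4 * (real n)\<^sup>2)"
      by (rule cancel) (use n in simp)
    ultimately show ?thesis by (simp only:)
  qed
  finally show ?thesis unfolding X_def E_def by simp
qed

text \<open>Passing from E m^2 to (E m)^2 costs the unconjugated variance E (m - E m)^2, whose
  modulus is controlled by the fourth moment.\<close>

lemma loop_equation:
  assumes std: "standardized_upto n \<beta>" and z: "Im z > 0" and n: "n > 0" and "\<beta> \<ge> 0"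
  shows "norm (1 + z * (\<integral>w. wigner_stieltjes n z w \<partial>law n) + (\<integral>w. wigner_stieltjes n z w \<partial>law n)\<^sup>2)
    \<le> (8 / (Im z)\<^sup>2 + 8 / (Im z) ^ 3) * (\<beta> + 1 / sqrt n) + 1 / (n * (Im z)\<^sup>2)
      + (1 + 4 * 1536 * 256 / Im z ^ 4) / n"
proof -
  interpret P: prob_space "law n" by (rule prob_space_law)
  define X where "X = wigner_stieltjes n z"
  define E where "E = (\<integral>w. X w \<partial>law n)"
  define K where "K = 4 * 1536 * 256 / Im z ^ 4"
  have Xm: "X \<in> borel_measurable (law n)" unfolding X_def by (rule wigner_stieltjes_measurable)
  have Xb: "norm (X w) \<le> 1 / Im z" for w unfolding X_def by (rule norm_wigner_stieltjes_le[OF z])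
  have intX: "integrable (law n) X"
    by (rule P.integrable_const_bound[where B = "1 / Im z"]) (use Xb Xm in auto)
  have intX2: "integrable (law n) (\<lambda>w. (X w)\<^sup>2)"
    by (rule P.integrable_const_bound[where B = "(1 / Im z)\<^sup>2"])
      (auto simp: norm_power intro!: power_mono Xb borel_measurable_power Xm)
  have var: "(\<integral>w. (X w)\<^sup>2 \<partial>law n) - E\<^sup>2 = (\<integral>w. (X w - E)\<^sup>2 \<partial>law n)"
  proof -
    have "(X w - E)\<^sup>2 = (X w)\<^sup>2 - 2 * E * X w + E\<^sup>2" for w by (simp add: power2_diff)
    then have "(\<integral>w. (X w - E)\<^sup>2 \<partial>law n) = (\<integral>w. (X w)\<^sup>2 \<partial>law n) - 2 * E * E + E\<^sup>2"
      using intX intX2 by (simp add: P.prob_space E_def)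
    then show ?thesis by (simp add: power2_eq_square)
  qed
  have Eb: "norm E \<le> 1 / Im z"
    unfolding E_def by (rule P.norm_expectation_le[OF intX Xb])
  have XE: "norm (X w - E) \<le> 2 / Im z" for w
    using norm_triangle_ineq4[of "X w" E] Xb[of w] Eb by simp
  have int4: "integrable (law n) (\<lambda>w. norm (X w - E) ^ 4)"
  proof (rule P.integrable_const_bound[where B = "(2 / Im z) ^ 4"])
    show "AE w in law n. norm (norm (X w - E) ^ 4) \<le> (2 / Im z) ^ 4"
      by (auto intro!: power_mono XE)
  qed (intro borel_measurable_power measurable_compose[OF _ borel_measurable_norm] borel_measurable_diff Xm borel_measurable_const)
  have "norm (\<integral>w. (X w - E)\<^sup>2 \<partial>law n) \<le> (\<integral>w. norm ((X w - E)\<^sup>2) \<partial>law n)"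
    by (rule integral_norm_bound)
  also have "\<dots> \<le> (\<integral>w. 1 / n + n * norm (X w - E) ^ 4 \<partial>law n)"
  proof (rule integral_mono_AE')
    show "integrable (law n) (\<lambda>w. 1 / n + n * norm (X w - E) ^ 4)" using int4 by simp
    show "AE w in law n. norm ((X w - E)\<^sup>2) \<le> 1 / n + n * norm (X w - E) ^ 4"
    proof (rule AE_I2)
      fix w
      \<comment> \<open>Applied to u = |X - E|^2. With a fourth moment of order 1 / n^2 both terms
        on the right average to order 1 / n.\<close>
      have amgm: "u \<le> 1 / real n + real n * u\<^sup>2" if "u \<ge> 0" for u :: real
      proof (cases "u \<le> 1 / real n")
        case True then show ?thesis by (simp add: add_increasing2)
      next
        case False
        then have "1 \<le> real n * u" using n by (simp add: field_simps)
        then have "u \<le> real n * u * u" using that mult_right_mono[of 1 "real n * u" u] by simp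
        then show ?thesis by (simp add: power2_eq_square add_increasing mult.assoc)
      qed
      have "((norm (X w - E))\<^sup>2)\<^sup>2 = norm (X w - E) ^ 4" by (simp only: power_mult[symmetric]) simp
      then show "norm ((X w - E)\<^sup>2) \<le> 1 / n + n * norm (X w - E) ^ 4"
        using amgm[of "(norm (X w - E))\<^sup>2"] by (simp add: norm_power)
    qed
  qed (use n in simp)
  also have "\<dots> = 1 / n + n * (\<integral>w. norm (X w - E) ^ 4 \<partial>law n)"
    using int4 by (simp add: P.prob_space)
  also have "\<dots> \<le> 1 / n + n * (K / (real n)\<^sup>2)"
    using wigner_stieltjes_fourth_moment[OF z n] unfolding K_def X_def E_def
    by (intro add_left_mono mult_left_mono) auto
  also have "\<dots> = (1 + K) / n" using n by (simp add: field_simps power2_eq_square)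
  finally have v: "norm (E\<^sup>2 - (\<integral>w. (X w)\<^sup>2 \<partial>law n)) \<le> (1 + K) / n"
    unfolding var[symmetric] norm_minus_commute[of "E\<^sup>2"] .
  have "1 + z * E + E\<^sup>2 = (1 + z * E + (\<integral>w. (X w)\<^sup>2 \<partial>law n)) + (E\<^sup>2 - (\<integral>w. (X w)\<^sup>2 \<partial>law n))" by simp
  also have "norm \<dots> \<le> ((8 / (Im z)\<^sup>2 + 8 / (Im z) ^ 3) * (\<beta> + 1 / sqrt n) + 1 / (n * (Im z)\<^sup>2)) + (1 + K) / n"
    using loop_equation_second_moment[OF std z n \<open>\<beta> \<ge> 0\<close>] v unfolding X_def E_def
    by (rule order_trans[OF norm_triangle_ineq add_mono])
  finally show ?thesis unfolding E_def X_def K_def .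
qed

end

section \<open>Uniform integrability of the squared inputs\<close>

context prob_space
begin

text \<open>The common consequence of (A1), (A2) and (A3) on which the limit depends: a
  Lindeberg-type quantity, small uniformly over the inputs. At n = 0 the quotient is 0 by the
  convention for division.\<close>

definition lindeberg_bounded :: "(nat \<Rightarrow> nat \<Rightarrow> 'a \<Rightarrow> real) \<Rightarrow> (nat \<Rightarrow> real) \<Rightarrow> bool" where
  "lindeberg_bounded x \<beta> \<longleftrightarrow> (\<forall>n. \<beta> n \<ge> 0) \<and> \<beta> \<longlonglongrightarrow> 0 \<and>
    (\<forall>n. \<forall>(a, b)\<in>input_index. expectation (\<lambda>\<omega>. (x a b \<omega>)\<^sup>2 * min 1 (\<bar>x a b \<omega>\<bar> / sqrt (real n))) \<le> \<beta> n)"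

lemma standardized_inputD:
  assumes "standardized_input x" "(a, b) \<in> input_index"
  shows "integrable M (x a b)" "integrable M (\<lambda>\<omega>. (x a b \<omega>)\<^sup>2)" "expectation (x a b) = 0"
    "expectation (\<lambda>\<omega>. (x a b \<omega>)\<^sup>2) = 1" "x a b \<in> borel_measurable M"
proof -
  have *: "integrable M (x a b)" "integrable M (\<lambda>\<omega>. (x a b \<omega>)\<^sup>2)" "expectation (x a b) = 0" "variance (x a b) = 1"
    using assms unfolding standardized_input_def by auto
  then show "integrable M (x a b)" "integrable M (\<lambda>\<omega>. (x a b \<omega>)\<^sup>2)" "expectation (x a b) = 0"
    "x a b \<in> borel_measurable M" by auto
  show "expectation (\<lambda>\<omega>. (x a b \<omega>)\<^sup>2) = 1" using *(3,4) by simp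
qed

lemma inverse_sqrt_tendsto_0: "(\<lambda>n. c / sqrt (real n)) \<longlonglongrightarrow> 0"
proof -
  have "(\<lambda>n. sqrt (inverse (real n))) \<longlonglongrightarrow> sqrt 0"
    by (intro tendsto_real_sqrt lim_inverse_n)
  then have "(\<lambda>n. c * sqrt (inverse (real n))) \<longlonglongrightarrow> c * 0" by (intro tendsto_mult tendsto_const) simp
  then show ?thesis by (simp add: real_sqrt_inverse divide_inverse)
qed

lemma lindeberg_bounded_A1:
  assumes "assumption_A1 x"
  shows "\<exists>\<beta>. lindeberg_bounded x \<beta>"
proof -
  have std: "standardized_input x" using assms unfolding assumption_A1_def by simp
  obtain C where C: "\<And>a b. (a, b) \<in> input_index \<Longrightarrow> AE \<omega> in M. \<bar>x a b \<omega>\<bar> \<le> C"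
    using assms unfolding assumption_A1_def by auto
  \<comment> \<open>The absolute value makes the bound nonnegative without a discussion of the sign
    of \<open>C\<close>.\<close>
  have "expectation (\<lambda>\<omega>. (x a b \<omega>)\<^sup>2 * min 1 (\<bar>x a b \<omega>\<bar> / sqrt (real n))) \<le> \<bar>C\<bar> / sqrt (real n)"
    if ab: "(a, b) \<in> input_index" for a b n
  proof -
    note s = standardized_inputD[OF std ab]
    have "expectation (\<lambda>\<omega>. (x a b \<omega>)\<^sup>2 * min 1 (\<bar>x a b \<omega>\<bar> / sqrt (real n)))
        \<le> expectation (\<lambda>\<omega>. (x a b \<omega>)\<^sup>2 * (\<bar>C\<bar> / sqrt (real n)))"
    proof (rule integral_mono_AE')
      show "integrable M (\<lambda>\<omega>. (x a b \<omega>)\<^sup>2 * (\<bar>C\<bar> / sqrt (real n)))" by (rule integrable_mult_left) (rule s(2))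
      show "AE \<omega> in M. (x a b \<omega>)\<^sup>2 * min 1 (\<bar>x a b \<omega>\<bar> / sqrt (real n)) \<le> (x a b \<omega>)\<^sup>2 * (\<bar>C\<bar> / sqrt (real n))"
        using C[OF ab]
      proof eventually_elim
        case (elim \<omega>)
        then have "\<bar>x a b \<omega>\<bar> / sqrt (real n) \<le> \<bar>C\<bar> / sqrt (real n)" by (intro divide_right_mono) auto
        then show ?case by (intro mult_left_mono) (auto intro: min.coboundedI2)
      qed
    qed simp
    also have "\<dots> = \<bar>C\<bar> / sqrt (real n)" using s(4) by simp
    finally show ?thesis .
  qed
  then have "lindeberg_bounded x (\<lambda>n. \<bar>C\<bar> / sqrt (real n))"
    unfolding lindeberg_bounded_def using inverse_sqrt_tendsto_0 by auto
  then show ?thesis by blast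
qed

text \<open>Replacing the minimum by its second argument leaves |x|^3 / sqrt n, so the uniform bound
  on third absolute moments applies.\<close>

lemma lindeberg_bounded_A3:
  assumes "assumption_A3 x"
  shows "\<exists>\<beta>. lindeberg_bounded x \<beta>"
proof -
  have "\<forall>k. \<exists>C. \<forall>(a, b)\<in>input_index. integrable M (\<lambda>\<omega>. \<bar>x a b \<omega>\<bar> ^ k) \<and> expectation (\<lambda>\<omega>. \<bar>x a b \<omega>\<bar> ^ k) \<le> C"
    using assms unfolding assumption_A3_def by (elim conjE)
  from spec[OF this, of 3] obtain C where C': "\<forall>(a, b)\<in>input_index.
      integrable M (\<lambda>\<omega>. \<bar>x a b \<omega>\<bar> ^ 3) \<and> expectation (\<lambda>\<omega>. \<bar>x a b \<omega>\<bar> ^ 3) \<le> C" ..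
  have C: "integrable M (\<lambda>\<omega>. \<bar>x a b \<omega>\<bar> ^ 3)" "expectation (\<lambda>\<omega>. \<bar>x a b \<omega>\<bar> ^ 3) \<le> C"
    if "(a, b) \<in> input_index" for a b
    using bspec[OF C' that] by simp_all
  have "expectation (\<lambda>\<omega>. (x a b \<omega>)\<^sup>2 * min 1 (\<bar>x a b \<omega>\<bar> / sqrt (real n))) \<le> \<bar>C\<bar> / sqrt (real n)"
    if ab: "(a, b) \<in> input_index" for a b n
  proof -
    have "expectation (\<lambda>\<omega>. (x a b \<omega>)\<^sup>2 * min 1 (\<bar>x a b \<omega>\<bar> / sqrt (real n)))
        \<le> expectation (\<lambda>\<omega>. \<bar>x a b \<omega>\<bar> ^ 3 / sqrt (real n))"
    proof (rule integral_mono_AE')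
      show "integrable M (\<lambda>\<omega>. \<bar>x a b \<omega>\<bar> ^ 3 / sqrt (real n))" using C[OF ab] by simp
      show "AE \<omega> in M. (x a b \<omega>)\<^sup>2 * min 1 (\<bar>x a b \<omega>\<bar> / sqrt (real n)) \<le> \<bar>x a b \<omega>\<bar> ^ 3 / sqrt (real n)"
      proof (rule AE_I2)
        fix \<omega>
        have "(x a b \<omega>)\<^sup>2 * min 1 (\<bar>x a b \<omega>\<bar> / sqrt (real n)) \<le> (x a b \<omega>)\<^sup>2 * (\<bar>x a b \<omega>\<bar> / sqrt (real n))"
          by (intro mult_left_mono) auto
        also have "(x a b \<omega>)\<^sup>2 * (\<bar>x a b \<omega>\<bar> / sqrt (real n)) = \<bar>x a b \<omega>\<bar> ^ 3 / sqrt (real n)"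
          by (simp add: power3_eq_cube power2_eq_square abs_mult_self_eq)
        finally show "(x a b \<omega>)\<^sup>2 * min 1 (\<bar>x a b \<omega>\<bar> / sqrt (real n)) \<le> \<bar>x a b \<omega>\<bar> ^ 3 / sqrt (real n)" .
      qed
    qed simp
    also have "\<dots> = expectation (\<lambda>\<omega>. \<bar>x a b \<omega>\<bar> ^ 3) / sqrt (real n)" by simp
    also have "\<dots> \<le> \<bar>C\<bar> / sqrt (real n)" using C[OF ab] by (intro divide_right_mono) auto
    finally show ?thesis .
  qed
  then have "lindeberg_bounded x (\<lambda>n. \<bar>C\<bar> / sqrt (real n))"
    unfolding lindeberg_bounded_def using inverse_sqrt_tendsto_0 by auto
  then show ?thesis by blast
qed

text \<open>Identical distribution makes the expectation the same for every index pair, so one null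
  sequence serves all of them. It comes from dominated convergence under x^2 and carries no
  rate.\<close>

lemma lindeberg_bounded_A2:
  assumes "assumption_A2 x"
  shows "\<exists>\<beta>. lindeberg_bounded x \<beta>"
proof -
  have std: "standardized_input x" using assms unfolding assumption_A2_def by simp
  have one: "(1, 1) \<in> input_index" unfolding input_index_def by simp
  have same: "distr M borel (x a b) = distr M borel (x 1 1)" if "(a, b) \<in> input_index" for a b
    using assms that one unfolding assumption_A2_def by blast
  note s1 = standardized_inputD[OF std one]
  define g where "g n r = r\<^sup>2 * min 1 (\<bar>r\<bar> / sqrt (real n))" for n and r :: real
  have gm: "g n \<in> borel_measurable borel" for n unfolding g_def by measurable
  define \<beta> where "\<beta> n = expectation (\<lambda>\<omega>. g n (x 1 1 \<omega>))" for n
  have eq: "expectation (\<lambda>\<omega>. g n (x a b \<omega>)) = \<beta> n" if ab: "(a, b) \<in> input_index" for a b n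
    unfolding \<beta>_def using integral_distr[OF standardized_inputD(5)[OF std ab] gm] integral_distr[OF s1(5) gm]
    by (simp add: same[OF ab])
  have "\<beta> \<longlonglongrightarrow> expectation (\<lambda>\<omega>. 0)"
    unfolding \<beta>_def
  proof (rule integral_dominated_convergence[where w = "\<lambda>\<omega>. (x 1 1 \<omega>)\<^sup>2"])
    show "AE \<omega> in M. (\<lambda>n. g n (x 1 1 \<omega>)) \<longlonglongrightarrow> 0"
    proof (rule AE_I2)
      fix \<omega>
      have "(\<lambda>n. (x 1 1 \<omega>)\<^sup>2 * min 1 (\<bar>x 1 1 \<omega>\<bar> / sqrt (real n))) \<longlonglongrightarrow> (x 1 1 \<omega>)\<^sup>2 * min 1 0"
        by (intro tendsto_intros inverse_sqrt_tendsto_0)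
      then show "(\<lambda>n. g n (x 1 1 \<omega>)) \<longlonglongrightarrow> 0" unfolding g_def by simp
    qed
    show "AE \<omega> in M. norm (g n (x 1 1 \<omega>)) \<le> (x 1 1 \<omega>)\<^sup>2" for n
      unfolding g_def by (intro AE_I2) (simp add: abs_mult mult_left_le)
  qed (use s1(2) measurable_compose[OF s1(5) gm] in auto)
  moreover have "\<beta> n \<ge> 0" for n unfolding \<beta>_def g_def by (intro integral_nonneg_AE AE_I2) simp
  ultimately have "lindeberg_bounded x \<beta>"
    unfolding lindeberg_bounded_def using eq unfolding g_def by auto
  then show ?thesis by blast
qed

section \<open>Almost sure convergence\<close>

text \<open>The restricted inputs have exactly the product law, so the mean equation and the fourth
  moment bound transfer to the original space. Different n share that space but need no joint
  control: summability of the fourth moments is enough.\<close>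

lemma semicircle_equation_AE:
  assumes indep: "indep_input x" and std: "standardized_input x" and lind: "lindeberg_bounded x \<beta>" and z: "Im z > 0"
  shows "AE \<omega> in M. (\<lambda>n. 1 + z * wigner_stieltjes n z (\<lambda>(a, b). x a b \<omega>)
      + (wigner_stieltjes n z (\<lambda>(a, b). x a b \<omega>))\<^sup>2) \<longlonglongrightarrow> 0"
proof -
  define X where "X e = (case e of (a, b) \<Rightarrow> x a b)" for e
  \<comment> \<open>The point mass at 0 is filler: the locale wants a probability measure at every
    pair, and nothing is known about \<open>x\<close> outside the input indices.\<close>
  define \<mu> where "\<mu> e = (if e \<in> input_index then distr M borel (X e) else return borel 0)" for e
  have Xm: "X e \<in> borel_measurable M" if "e \<in> input_index" for e
    using standardized_inputD(5)[OF std] that unfolding X_def by (cases e) auto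
  interpret independent_inputs \<mu>
  proof (rule independent_inputs.intro)
    show "prob_space (\<mu> e)" for e
    proof (cases "e \<in> input_index")
      case True
      then show ?thesis unfolding \<mu>_def using prob_space_distr[OF Xm[OF True]] by simp
    qed (simp add: \<mu>_def prob_space_return)
    show "sets (\<mu> e) = sets borel" for e unfolding \<mu>_def by simp
  qed
  have sub: "input_upto n \<subseteq> input_index" for n unfolding input_upto_def input_index_def by auto
  have intmu: "(\<integral>r. f r \<partial>\<mu> e) = expectation (\<lambda>\<omega>. f (X e \<omega>))" if "e \<in> input_index" "f \<in> borel_measurable borel"
    for e and f :: "real \<Rightarrow> real"
    unfolding \<mu>_def using that by (simp add: integral_distr Xm)
  have intgmu: "integrable (\<mu> e) f \<longleftrightarrow> integrable M (\<lambda>\<omega>. f (X e \<omega>))" if "e \<in> input_index" "f \<in> borel_measurable borel"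
    for e and f :: "real \<Rightarrow> real"
    unfolding \<mu>_def using that by (simp add: integrable_distr_eq Xm)
  have std_n: "standardized_upto n (\<beta> n)" for n
    unfolding standardized_upto_def
  proof
    fix e assume "e \<in> input_upto n"
    then have e: "e \<in> input_index" using sub by blast
    obtain a b where ab: "e = (a, b)" by (cases e)
    note s = standardized_inputD[OF std e[unfolded ab]]
    have Xe: "X e = x a b" unfolding X_def ab by simp
    have "expectation (\<lambda>\<omega>. (x a b \<omega>)\<^sup>2 * min 1 (\<bar>x a b \<omega>\<bar> / sqrt (real n))) \<le> \<beta> n"
      using lind e unfolding lindeberg_bounded_def ab by blast
    then show "integrable (\<mu> e) (\<lambda>r. r) \<and> integrable (\<mu> e) (\<lambda>r. r\<^sup>2) \<and> (\<integral>r. r \<partial>\<mu> e) = 0 \<and> (\<integral>r. r\<^sup>2 \<partial>\<mu> e) = 1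
        \<and> (\<integral>r. r\<^sup>2 * min 1 (\<bar>r\<bar> / sqrt (real n)) \<partial>\<mu> e) \<le> \<beta> n"
      using s by (simp add: intmu[OF e] intgmu[OF e] Xe)
  qed
  \<comment> \<open>Restricting makes the values points of the product space; the transform reads
    only the pairs kept, so it is unchanged.\<close>
  define R where "R n \<omega> = (\<lambda>e\<in>input_upto n. X e \<omega>)" for n \<omega>
  have Rm: "R n \<in> measurable M (law n)" for n
  proof -
    have "R n \<in> measurable M (PiM (input_upto n) (\<lambda>_. borel))"
      unfolding R_def using sub by (intro measurable_restrict Xm) auto
    moreover have "sets (law n) = sets (PiM (input_upto n) (\<lambda>_. borel))"
      by (intro sets_PiM_cong sets_borel refl)
    ultimately show ?thesis by (simp cong: measurable_cong_sets)
  qed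
  have law_eq: "distr M (law n) (R n) = law n" if n: "n > 0" for n
  proof -
    have ne: "input_upto n \<noteq> {}" using input_upto_mem[OF n n] by auto
    have iv: "indep_vars (\<lambda>_. borel) X (input_upto n)"
      using indep_vars_subset[OF indep[unfolded indep_input_def] sub] unfolding X_def[abs_def] .
    have "distr M (PiM (input_upto n) (\<lambda>_. borel)) (R n) = PiM (input_upto n) (\<lambda>e. distr M borel (X e))"
      using indep_vars_iff_distr_eq_PiM'[where M' = "\<lambda>_. borel" and X = X, OF ne] iv sub Xm unfolding R_def by blast
    moreover have "PiM (input_upto n) (\<lambda>e. distr M borel (X e)) = law n"
      using sub by (intro PiM_cong refl) (auto simp: \<mu>_def)
    moreover have "distr M (PiM (input_upto n) (\<lambda>_. borel)) (R n) = distr M (law n) (R n)"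
      by (intro distr_cong refl sets_PiM_cong) (simp add: sets_borel)
    ultimately show ?thesis by simp
  qed
  define S where "S n \<omega> = wigner_stieltjes n z (R n \<omega>)" for n \<omega>
  have S_eq: "wigner_stieltjes n z (\<lambda>(a, b). x a b \<omega>) = S n \<omega>" for n \<omega>
    unfolding S_def by (rule wigner_stieltjes_cong) (auto simp: R_def X_def)
  define m where "m n = (\<integral>w. wigner_stieltjes n z w \<partial>law n)" for n
  have Sm: "S n \<in> borel_measurable M" for n
    unfolding S_def[abs_def] by (rule measurable_compose[OF Rm wigner_stieltjes_measurable])
  have Sb: "norm (S n \<omega>) \<le> 1 / Im z" for n \<omega> unfolding S_def by (rule norm_wigner_stieltjes_le[OF z])
  have mb: "norm (m n) \<le> 1 / Im z" for n
  proof -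
    interpret P: prob_space "law n" by (rule prob_space_law)
    have int: "integrable (law n) (wigner_stieltjes n z)"
      by (rule P.integrable_const_bound[where B = "1 / Im z"])
        (auto simp: norm_wigner_stieltjes_le[OF z] wigner_stieltjes_measurable)
    show ?thesis unfolding m_def by (rule P.norm_expectation_le[OF int norm_wigner_stieltjes_le[OF z]])
  qed
  have conc: "AE \<omega> in M. (\<lambda>n. S n \<omega> - m n) \<longlonglongrightarrow> 0"
  proof (rule AE_tendsto_0_fourth_moment)
    show "integrable M (\<lambda>\<omega>. norm (S n \<omega> - m n) ^ 4)" for n
    proof (rule integrable_const_bound[where B = "(2 / Im z) ^ 4"])
      have "norm (S n \<omega> - m n) \<le> 2 / Im z" for \<omega>
        using norm_triangle_ineq4[of "S n \<omega>" "m n"] Sb[of n \<omega>] mb[of n] by simp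
      then show "AE \<omega> in M. norm (norm (S n \<omega> - m n) ^ 4) \<le> (2 / Im z) ^ 4"
        by (auto intro!: power_mono)
    qed (intro borel_measurable_power measurable_compose[OF _ borel_measurable_norm] borel_measurable_diff Sm borel_measurable_const)
    show "expectation (\<lambda>\<omega>. norm (S n \<omega> - m n) ^ 4) \<le> (4 * 1536 * 256 / Im z ^ 4) * inverse ((real n)\<^sup>2)" for n
    proof (cases "n = 0")
      \<comment> \<open>At n = 0 the bound is 0, since the inverse of 0 is 0; both the transform and
        its mean are 0 there as well.\<close>
      case True
      then have "S n \<omega> = 0" "m n = 0" for \<omega> unfolding S_def m_def wigner_stieltjes_def by simp_all
      then show ?thesis using True by simp
    next
      case False
      then have n: "n > 0" by simp
      have gm: "(\<lambda>w. norm (wigner_stieltjes n z w - m n) ^ 4) \<in> borel_measurable (law n)"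
        by (intro borel_measurable_power measurable_compose[OF _ borel_measurable_norm] borel_measurable_diff
            wigner_stieltjes_measurable borel_measurable_const)
      have "expectation (\<lambda>\<omega>. norm (S n \<omega> - m n) ^ 4) = (\<integral>w. norm (wigner_stieltjes n z w - m n) ^ 4 \<partial>distr M (law n) (R n))"
        unfolding S_def by (rule integral_distr[OF Rm gm, symmetric])
      also have "\<dots> \<le> 4 * 1536 * 256 / (Im z ^ 4 * (real n)\<^sup>2)"
        unfolding law_eq[OF n] m_def by (rule wigner_stieltjes_fourth_moment[OF z n])
      finally show ?thesis by (simp add: divide_inverse)
    qed
    show "summable (\<lambda>n. (4 * 1536 * 256 / Im z ^ 4) * inverse ((real n)\<^sup>2))"
      by (intro summable_mult inverse_power_summable) simp
  qed
  have mean: "(\<lambda>n. 1 + z * m n + (m n)\<^sup>2) \<longlonglongrightarrow> 0"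
  proof (rule Lim_null_comparison)
    define B where "B n = (8 / (Im z)\<^sup>2 + 8 / (Im z) ^ 3) * (\<beta> n + 1 / sqrt n) + 1 / (n * (Im z)\<^sup>2)
      + (1 + 4 * 1536 * 256 / Im z ^ 4) / n" for n :: nat
    have b0: "\<beta> n \<ge> 0" for n using lind unfolding lindeberg_bounded_def by blast
    show "\<forall>\<^sub>F n in sequentially. norm (1 + z * m n + (m n)\<^sup>2) \<le> B n"
      using eventually_gt_at_top[of "0::nat"]
    proof eventually_elim
      case (elim n)
      then show ?case unfolding m_def B_def by (rule loop_equation[OF std_n z _ b0])
    qed
    have "\<beta> \<longlonglongrightarrow> 0" using lind unfolding lindeberg_bounded_def by blast
    moreover have "(\<lambda>n. 1 / (n * (Im z)\<^sup>2)) \<longlonglongrightarrow> 0"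
      using tendsto_divide_zero[OF lim_1_over_n, of "(Im z)\<^sup>2"] by simp
    ultimately have "B \<longlonglongrightarrow> (8 / (Im z)\<^sup>2 + 8 / (Im z) ^ 3) * (0 + 0) + 0 + 0"
      unfolding B_def by (intro tendsto_add tendsto_mult tendsto_const inverse_sqrt_tendsto_0 lim_const_over_n)
    then show "B \<longlonglongrightarrow> 0" by simp
  qed
  show ?thesis
    unfolding S_eq
    using conc
  proof eventually_elim
    case (elim \<omega>)
    \<comment> \<open>The equation at \<open>S n\<close> and at its mean differ by this product,
      whose first factor is bounded.\<close>
    have "(\<lambda>n. (z + S n \<omega> + m n) * (S n \<omega> - m n)) \<longlonglongrightarrow> 0"
    proof (rule Lim_null_comparison)
      have "norm (z + S n \<omega> + m n) \<le> norm z + 1 / Im z + 1 / Im z" for n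
        by (intro order_trans[OF norm_triangle_ineq] add_mono Sb mb) simp
      then show "\<forall>\<^sub>F n in sequentially. norm ((z + S n \<omega> + m n) * (S n \<omega> - m n)) \<le> (norm z + 1 / Im z + 1 / Im z) * norm (S n \<omega> - m n)"
        unfolding norm_mult by (intro always_eventually allI mult_right_mono) auto
      show "(\<lambda>n. (norm z + 1 / Im z + 1 / Im z) * norm (S n \<omega> - m n)) \<longlonglongrightarrow> 0"
        by (intro tendsto_mult_right_zero tendsto_norm_zero elim)
    qed
    then have "(\<lambda>n. (1 + z * m n + (m n)\<^sup>2) + (z + S n \<omega> + m n) * (S n \<omega> - m n)) \<longlonglongrightarrow> 0 + 0"
      by (intro tendsto_add mean)
    moreover have "(1 + z * m n + (m n)\<^sup>2) + (z + S n \<omega> + m n) * (S n \<omega> - m n) = 1 + z * S n \<omega> + (S n \<omega>)\<^sup>2" for n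
      by (simp add: algebra_simps power2_eq_square)
    ultimately show ?case by simp
  qed
qed

end

lemma skew_esd_wigner:
  assumes n: "n > 0"
  shows "\<exists>lam. (\<forall>t. skew_esd ((1 / sqrt (real n)) \<cdot>\<^sub>m skew_wigner_mat y n) t = real (card {j. j < n \<and> lam j \<le> t}) / real n) \<and>
    (\<forall>z. Im z > 0 \<longrightarrow> empirical_stieltjes n lam z = wigner_stieltjes n z (\<lambda>(a, b). y a b))"
proof -
  let ?A = "(1 / sqrt (real n)) \<cdot>\<^sub>m skew_wigner_mat y n"
  have A: "?A \<in> carrier_mat n n" unfolding skew_wigner_mat_def hadamard_def sign_mat_def by simp
  have entry: "?A $$ (i, j) = wigner_entry n (\<lambda>(a, b). y a b) i j" if "i < n" "j < n" for i j
    using that unfolding skew_wigner_mat_def hadamard_def sign_mat_def wigner_mat_def wigner_entry_def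
    by (auto simp: min_def max_def)
  show ?thesis
    unfolding wigner_stieltjes_def
  proof (rule skew_esd_resolvent[OF A])
    show "?A $$ (j, i) = - (?A $$ (i, j))" if "i < n" "j < n" for i j
      unfolding entry[OF that] entry[OF that(2,1)] by (rule wigner_entry_skew)
    show "wigner_hermitian n (\<lambda>(a, b). y a b) i j = \<i> * of_real (?A $$ (i, j))" if "i < n" "j < n" for i j
      unfolding entry[OF that] wigner_hermitian_def ..
  qed
qed

theorem theorem4p1:
  fixes M :: "'a measure" and x :: "nat \<Rightarrow> nat \<Rightarrow> 'a \<Rightarrow> real"
  assumes "prob_space M"
    and "prob_space.assumption_A1 M x \<or> prob_space.assumption_A2 M x \<or>
         prob_space.assumption_A3 M x"
  shows "AE \<omega> in M.
           weak_conv
             (\<lambda>n. skew_esd ((1 / sqrt (real n)) \<cdot>\<^sub>m skew_wigner_mat (\<lambda>a b. x a b \<omega>) n))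
             (cdf semicircle_law)"
proof -
  interpret prob_space M by (rule assms(1))
  have base: "indep_input x" "standardized_input x"
    using assms(2) unfolding assumption_A1_def assumption_A2_def assumption_A3_def by auto
  obtain \<beta> where lind: "lindeberg_bounded x \<beta>"
    using assms(2) lindeberg_bounded_A1 lindeberg_bounded_A2 lindeberg_bounded_A3 by blast
  define Z where "Z p k = Complex (of_rat p) (inverse (real (Suc k)))" for p :: rat and k :: nat
  \<comment> \<open>Rational abscissae and heights 1 / (k + 1) are countably many points, so one
    null set serves them all.\<close>
  have "AE \<omega> in M. \<forall>p k. (\<lambda>n. 1 + Z p k * wigner_stieltjes n (Z p k) (\<lambda>(a, b). x a b \<omega>)
      + (wigner_stieltjes n (Z p k) (\<lambda>(a, b). x a b \<omega>))\<^sup>2) \<longlonglongrightarrow> 0"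
    unfolding AE_all_countable by (intro allI semicircle_equation_AE[OF base lind]) (simp add: Z_def)
  then show ?thesis
  proof eventually_elim
    case (elim \<omega>)
    let ?A = "\<lambda>n. (1 / sqrt (real n)) \<cdot>\<^sub>m skew_wigner_mat (\<lambda>a b. x a b \<omega>) n"
    \<comment> \<open>Eigenvalues are enumerated only after the outcome is fixed; every
      probabilistic statement was made about the resolvent, so the enumeration may be an arbitrary
      choice.\<close>
    have "\<forall>n. \<exists>lam. n > 0 \<longrightarrow> (\<forall>t. skew_esd (?A n) t = real (card {j. j < n \<and> lam j \<le> t}) / real n) \<and>
      (\<forall>z. Im z > 0 \<longrightarrow> empirical_stieltjes n lam z = wigner_stieltjes n z (\<lambda>(a, b). x a b \<omega>))"
      using skew_esd_wigner by blast
    from choice[OF this] obtain lam where "\<forall>n. n > 0 \<longrightarrow>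
      (\<forall>t. skew_esd (?A n) t = real (card {j. j < n \<and> lam n j \<le> t}) / real n) \<and>
      (\<forall>z. Im z > 0 \<longrightarrow> empirical_stieltjes n (lam n) z = wigner_stieltjes n z (\<lambda>(a, b). x a b \<omega>))" ..
    then have lam: "\<And>n t. n > 0 \<Longrightarrow> skew_esd (?A n) t = real (card {j. j < n \<and> lam n j \<le> t}) / real n"
      "\<And>n z. n > 0 \<Longrightarrow> Im z > 0 \<Longrightarrow> empirical_stieltjes n (lam n) z = wigner_stieltjes n z (\<lambda>(a, b). x a b \<omega>)"
      by blast+
    have lim: "(\<lambda>n. 1 + Z p k * empirical_stieltjes n (lam n) (Z p k) + (empirical_stieltjes n (lam n) (Z p k))\<^sup>2) \<longlonglongrightarrow> 0" for p k
    proof (rule Lim_transform_eventually)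
      show "(\<lambda>n. 1 + Z p k * wigner_stieltjes n (Z p k) (\<lambda>(a, b). x a b \<omega>)
          + (wigner_stieltjes n (Z p k) (\<lambda>(a, b). x a b \<omega>))\<^sup>2) \<longlonglongrightarrow> 0" using elim by blast
      have pos: "Im (Z p k) > 0" unfolding Z_def by simp
      show "\<forall>\<^sub>F n in sequentially. 1 + Z p k * wigner_stieltjes n (Z p k) (\<lambda>(a, b). x a b \<omega>)
          + (wigner_stieltjes n (Z p k) (\<lambda>(a, b). x a b \<omega>))\<^sup>2
          = 1 + Z p k * empirical_stieltjes n (lam n) (Z p k) + (empirical_stieltjes n (lam n) (Z p k))\<^sup>2"
        using eventually_gt_at_top[of "0::nat"] by eventually_elim (simp add: lam(2)[OF _ pos])
    qed
    show ?case
      unfolding weak_conv_def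
    proof (intro allI impI)
      fix t assume "isCont (cdf semicircle_law) t"
      from esd_tendsto_semicircle[OF lim[unfolded Z_def] this]
      have "(\<lambda>n. real (card {j. j < n \<and> lam n j \<le> t}) / real n) \<longlonglongrightarrow> cdf semicircle_law t" .
      moreover have "\<forall>\<^sub>F n in sequentially. real (card {j. j < n \<and> lam n j \<le> t}) / real n = skew_esd (?A n) t"
        using eventually_gt_at_top[of "0::nat"] by eventually_elim (simp only: lam(1))
      ultimately show "(\<lambda>n. skew_esd (?A n) t) \<longlonglongrightarrow> cdf semicircle_law t"
        by (rule Lim_transform_eventually)
    qed
  qed
qed

end
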